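(* (1) Let $\{(X_i,Y_i),\ i\in\mathbb{N}\}$ be a sequence of independent, identically distributed copies of a pair $(X,Y)$, where $X$ has distribution $F\in\mathcal{C}$ and $Y$ has distribution $G$ with $G(0-)=0$, $G(0)<1$. Let $H$ be the distribution of $XY$, and suppose that (A) for any $c>0$, $\overline{G}(cx)=o[\overline{H}(x)]$ as $x\to\infty$; (B) there exists a function $h:[0,\infty)\to(0,\infty)$ such that $\mathbf{P}[X>x\mid Y=y]\sim h(y)\,\mathbf{P}[X>x]$ as $x\to\infty$, uniformly for $y\in S_Y$; and that $\mathbf{E}[Y^{\alpha_F+\varepsilon}]<\infty$ for some $\varepsilon>0$. Then, for each $n\in\mathbb{N}$, $$\psi(x,n)\sim\sum_{i=1}^n\mathbf{P}[X_i\Theta_i>x],\qquad x\to\infty. \tag{$*$}$$ (2) If, under the assumptions of part (1), moreover $F\in\mathcal{C}\cap\mathcal{P_D}$ and $\mathbf{E}[Y^\alpha\vee Y^\beta]<1$ for some $0\le\beta\le\beta_F\le\alpha_F\le\alpha<\infty$, then $( * )$ holds uniformly for $n\in\mathbb{N}$, and hence also for $n=\infty$; namely $$\lim_{x\to\infty}\sup_{n\in\mathbb{N}}\left|\frac{\psi(x,n)}{\sum_{i=1}^n\mathbf{P}[X_i\Theta_i>x]}-1\right|=0 .$$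
   Context: For a distribution $F$ write $\overline{F}:=1-F$; throughout $\overline{F}(x)>0$ for all $x\ge 0$. $S_Y$ is the support of $Y$. Uniformity in (B) means $\lim_{x\to\infty}\sup_{y\in S_Y}\left|\frac{\mathbf{P}[X>x\mid Y=y]}{h(y)\mathbf{P}[X>x]}-1\right|=0$. $a\vee b=\max\{a,b\}$. Risk model: $X_i$ is the insurer's net loss in period $i$ and $Y_i\ge 0$ the stochastic discount factor. Put $\Theta_i:=\prod_{j=1}^iY_j$, $S_0^\Theta=0$, $S_n^\Theta=\sum_{i=1}^nX_i\Theta_i$ for $n\in\mathbb{N}\cup\{\infty\}$, $M_n:=\max_{0\le k\le n}S_k^\Theta$ (supremum over all $k\geq 0$ when $n=\infty$), and the ruin probability with initial capital $x>0$ is $\psi(x,n):=\mathbf{P}[M_n>x]$. $F\in\mathcal{C}$ (consistently varying) if $\lim_{b\uparrow1}\limsup_{x\to\infty}\overline{F}(bx)/\overline{F}(x)=1$. $F\in\mathcal{P_D}$ if for all (equivalently, for some) $v>1$, $\limsup_{x\to\infty}\overline{F}(vx)/\overline{F}(x)<1$. With $\overline{F}_*(v):=\liminf_{x\to\infty}\overline{F}(vx)/\overline{F}(x)$ and $\overline{F}^*(v):=\limsup_{x\to\infty}\overline{F}(vx)/\overline{F}(x)$, the lower and upper Matuszewska indices are $\beta_F:=\sup\{-\ln\overline{F}^*(v)/\ln v: v>1\}$ and $\alpha_F:=\inf\{-\ln\overline{F}_*(v)/\ln v: v>1\}$. *)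

theory Defs
  imports "HOL-Probability.Probability" "HOL-Library.Landau_Symbols" "HOL-Library.Extended_Nat"
begin

text \<open>A distribution is given by its distribution function, \<open>cdf (distr M borel X)\<close> for the
  distribution of \<open>X\<close>.\<close>

definition tail :: "(real \<Rightarrow> real) \<Rightarrow> real \<Rightarrow> real" where
  "tail F x = 1 - F x"

definition tail_ratio_limsup :: "(real \<Rightarrow> real) \<Rightarrow> real \<Rightarrow> ereal" where
  "tail_ratio_limsup F v = Limsup at_top (\<lambda>x. ereal (tail F (v * x) / tail F x))"

definition tail_ratio_liminf :: "(real \<Rightarrow> real) \<Rightarrow> real \<Rightarrow> ereal" where
  "tail_ratio_liminf F v = Liminf at_top (\<lambda>x. ereal (tail F (v * x) / tail F x))"

definition consistently_varying :: "(real \<Rightarrow> real) \<Rightarrow> bool" where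
  "consistently_varying F \<longleftrightarrow> (tail_ratio_limsup F \<longlongrightarrow> 1) (at_left 1)"

definition class_PD :: "(real \<Rightarrow> real) \<Rightarrow> bool" where
  "class_PD F \<longleftrightarrow> (\<forall>v>1. tail_ratio_limsup F v < 1)"

text \<open>\<open>- ln u\<close> with \<open>- ln 0 = \<infinity>\<close>; it is only applied to ratio limits for \<open>v > 1\<close>, which lie in
  \<open>[0, 1]\<close>.\<close>

definition neg_ln :: "ereal \<Rightarrow> ereal" where
  "neg_ln u = (if u = 0 then \<infinity> else ereal (- ln (real_of_ereal u)))"

definition lower_matuszewska :: "(real \<Rightarrow> real) \<Rightarrow> ereal" where
  "lower_matuszewska F = (SUP v\<in>{1<..}. neg_ln (tail_ratio_limsup F v) / ereal (ln v))"

definition upper_matuszewska :: "(real \<Rightarrow> real) \<Rightarrow> ereal" where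
  "upper_matuszewska F = (INF v\<in>{1<..}. neg_ln (tail_ratio_liminf F v) / ereal (ln v))"

text \<open>The upper index of a consistently varying distribution is a nonnegative real number, so that
  \<open>real_of_ereal (upper_matuszewska F)\<close> loses nothing for such distributions.\<close>

lemma upper_matuszewska_less_top:
  assumes "consistently_varying F" and pos: "\<And>x. 0 \<le> x \<Longrightarrow> 0 < tail F x"
  shows "upper_matuszewska F < \<infinity>"
proof -
  have "eventually (\<lambda>b. tail_ratio_limsup F b < 2) (at_left 1)"
    using assms(1) unfolding consistently_varying_def
    by (rule order_tendstoD) (simp add: one_ereal_def numeral_eq_ereal)
  moreover have "eventually (\<lambda>b::real. 0 < b \<and> b < 1) (at_left 1)"
    by (rule eventually_at_leftI[of 0]) auto
  ultimately have "eventually (\<lambda>b. tail_ratio_limsup F b < 2 \<and> 0 < b \<and> b < 1) (at_left (1::real))"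
    by eventually_elim auto
  then obtain b :: real where b: "tail_ratio_limsup F b < 2" "0 < b" "b < 1"
    using eventually_happens[of _ "at_left (1::real)"] by auto
  have "eventually (\<lambda>x. ereal (tail F (b * x) / tail F x) < 2) at_top"
    by (rule Limsup_lessD) (use b(1) in \<open>simp add: tail_ratio_limsup_def\<close>)
  then have ev: "eventually (\<lambda>x. tail F (b * x) / tail F x < 2) at_top"
    by (simp add: numeral_eq_ereal)
  have "filterlim (\<lambda>x. (1/b) * x) at_top at_top"
    by (rule filterlim_tendsto_pos_mult_at_top[OF tendsto_const _ filterlim_ident]) (use b in auto)
  from filterlim_iff[THEN iffD1, OF this, rule_format, OF ev]
  have "eventually (\<lambda>x. tail F x / tail F (1/b * x) < 2) at_top"
    using b by simp
  then have "eventually (\<lambda>x. ereal (1/2) \<le> ereal (tail F (1/b * x) / tail F x)) at_top"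
    using eventually_ge_at_top[of 0]
  proof eventually_elim
    case (elim x)
    have "0 < tail F x" "0 < tail F (1/b * x)"
      using elim b by (auto intro!: pos)
    with elim show ?case by (simp add: field_simps)
  qed
  then have "ereal (1/2) \<le> tail_ratio_liminf F (1/b)"
    unfolding tail_ratio_liminf_def by (rule Liminf_bounded)
  then have nz: "tail_ratio_liminf F (1/b) \<noteq> 0" by (auto simp: zero_ereal_def)
  have "upper_matuszewska F \<le> neg_ln (tail_ratio_liminf F (1/b)) / ereal (ln (1/b))"
    unfolding upper_matuszewska_def using b by (intro INF_lower) auto
  also have "\<dots> < \<infinity>"
    using nz b by (simp add: neg_ln_def)
  finally show ?thesis .
qed

lemma upper_matuszewska_nonneg:
  assumes "mono F" and pos: "\<And>x. 0 \<le> x \<Longrightarrow> 0 < tail F x"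
  shows "0 \<le> upper_matuszewska F"
  unfolding upper_matuszewska_def
proof (rule INF_greatest)
  fix v :: real assume "v \<in> {1<..}"
  then have v: "1 < v" by simp
  let ?l = "tail_ratio_liminf F v"
  have ev: "eventually (\<lambda>x. 0 \<le> tail F (v * x) / tail F x \<and> tail F (v * x) / tail F x \<le> 1) at_top"
    using eventually_ge_at_top[of 0]
  proof eventually_elim
    case (elim x)
    have "x \<le> v * x" using elim v mult_right_mono[of 1 v x] by simp
    then have "tail F (v * x) \<le> tail F x" using \<open>mono F\<close> by (simp add: tail_def monoD)
    moreover have "0 < tail F x" "0 < tail F (v * x)" using elim v by (auto intro!: pos)
    ultimately show ?case by simp
  qed
  have "0 \<le> ?l"
    unfolding tail_ratio_liminf_def
    by (rule Liminf_bounded) (use ev in \<open>eventually_elim, simp add: zero_ereal_def\<close>)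
  moreover have "?l \<le> Limsup at_top (\<lambda>x. ereal (tail F (v * x) / tail F x))"
    unfolding tail_ratio_liminf_def by (rule Liminf_le_Limsup) simp
  moreover have "Limsup at_top (\<lambda>x. ereal (tail F (v * x) / tail F x)) \<le> 1"
    by (rule Limsup_bounded) (use ev in \<open>eventually_elim, simp add: one_ereal_def\<close>)
  ultimately have l: "0 \<le> ?l" "?l \<le> 1" by auto
  then obtain r where r: "?l = ereal r" "0 \<le> r" "r \<le> 1"
    by (cases "?l") (auto simp: one_ereal_def)
  show "0 \<le> neg_ln ?l / ereal (ln v)"
    using v r by (auto simp: neg_ln_def zero_ereal_def intro!: divide_nonpos_pos)
qed

text \<open>A version of \<open>y \<mapsto> P[X \<in> \<cdot> | Y = y]\<close> as a Markov kernel.\<close>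

definition regular_cond_distr ::
    "'a measure \<Rightarrow> ('a \<Rightarrow> real) \<Rightarrow> ('a \<Rightarrow> real) \<Rightarrow> (real \<Rightarrow> real measure) \<Rightarrow> bool" where
  "regular_cond_distr M X Y K \<longleftrightarrow>
     K \<in> borel \<rightarrow>\<^sub>M prob_algebra borel \<and>
     (\<forall>A\<in>sets borel. \<forall>B\<in>sets borel.
        emeasure M {\<omega> \<in> space M. X \<omega> \<in> A \<and> Y \<omega> \<in> B} =
        (\<integral>\<^sup>+y\<in>B. emeasure (K y) A \<partial>distr M borel Y))"

definition distr_support :: "real measure \<Rightarrow> real set" where
  "distr_support N = {y. \<forall>U. open U \<and> y \<in> U \<longrightarrow> 0 < emeasure N U}"

definition disc_factor :: "(nat \<Rightarrow> 'a \<Rightarrow> real) \<Rightarrow> nat \<Rightarrow> 'a \<Rightarrow> real" where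
  "disc_factor Y i \<omega> = (\<Prod>j=1..i. Y j \<omega>)"

definition disc_sum :: "(nat \<Rightarrow> 'a \<Rightarrow> real) \<Rightarrow> (nat \<Rightarrow> 'a \<Rightarrow> real) \<Rightarrow> nat \<Rightarrow> 'a \<Rightarrow> real" where
  "disc_sum X Y n \<omega> = (\<Sum>i=1..n. X i \<omega> * disc_factor Y i \<omega>)"

text \<open>The maximum over \<open>0 \<le> k \<le> n\<close>; for \<open>n = \<infinity>\<close> the supremum over all \<open>k\<close>, which may be infinite.\<close>

definition max_disc_sum :: "(nat \<Rightarrow> 'a \<Rightarrow> real) \<Rightarrow> (nat \<Rightarrow> 'a \<Rightarrow> real) \<Rightarrow> enat \<Rightarrow> 'a \<Rightarrow> ereal" where
  "max_disc_sum X Y n \<omega> = (SUP k\<in>{k::nat. enat k \<le> n}. ereal (disc_sum X Y k \<omega>))"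

definition ruin_prob ::
    "'a measure \<Rightarrow> (nat \<Rightarrow> 'a \<Rightarrow> real) \<Rightarrow> (nat \<Rightarrow> 'a \<Rightarrow> real) \<Rightarrow> real \<Rightarrow> enat \<Rightarrow> real" where
  "ruin_prob M X Y x n = measure M {\<omega> \<in> space M. ereal x < max_disc_sum X Y n \<omega>}"

definition disc_loss_tail ::
    "'a measure \<Rightarrow> (nat \<Rightarrow> 'a \<Rightarrow> real) \<Rightarrow> (nat \<Rightarrow> 'a \<Rightarrow> real) \<Rightarrow> nat \<Rightarrow> real \<Rightarrow> real" where
  "disc_loss_tail M X Y i x = measure M {\<omega> \<in> space M. x < X i \<omega> * disc_factor Y i \<omega>}"

end

theory Submission
  imports Defs
begin

text \<open>
  Write \<open>f\<close> for the tail of \<open>X\<close>, \<open>\<Theta> n = Y 1 * \<dots> * Y n\<close>, and \<open>J x t = P(X * Y * t > x)\<close>, so that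
  \<open>J x 1\<close> is the tail of \<open>X * Y\<close>. The whole proof rests on two estimates for \<open>J\<close>, valid for large
  \<open>x\<close>, in which \<open>growth p q t = max (t powr p) (t powr q)\<close>:

    \<^item> a global bound \<open>J x t \<le> C * J x 1 * growth p q t\<close> for \<^emph>\<open>every\<close> \<open>t \<ge> 0\<close>, where \<open>p\<close> exceeds the
      upper Matuszewska index and \<open>q\<close> is 0 or lies below the lower one;

    \<^item> consistent variation: for every \<open>e > 0\<close> there is \<open>v > 1\<close> with \<open>J x 1 \<le> (1 + e) * J (v * x) 1\<close>.

  For \<open>f\<close> in place of \<open>J\<close> the first estimate is Potter's bound (\<open>potter_bound\<close>). It survives for
  large \<open>t\<close>, where \<open>x / t\<close> is no longer large, because \<open>f\<close> decays more slowly than \<open>x powr (- p)\<close>. Both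
  estimates pass from \<open>X\<close> to \<open>X * Y\<close> by conditioning on \<open>Y\<close>: the uniform equivalence
  \<open>P(X > x | Y = y) \<sim> h(y) f(x)\<close> bounds all conditional tails by one multiple of \<open>f\<close> and makes them vary
  consistently with a common \<open>v\<close>, while the values of \<open>Y\<close> of order \<open>x\<close> are negligible by hypothesis (A).

  The ruin probability is then governed by the principle of a single big jump. The \<open>i\<close>-th discounted
  loss is \<open>(X i * Y i) * \<Theta> (i - 1)\<close> with independent factors. So, for \<open>j < i\<close>, the probability that both
  \<open>\<bar>X j\<bar> * \<Theta> j\<close> and \<open>X i * \<Theta> i\<close> exceed \<open>c * x\<close> is at most a multiple of \<open>J x 1\<close> times the expectation of
  \<open>growth p q (\<Theta> (i - 1))\<close> over the event \<open>\<bar>X j\<bar> * \<Theta> j > c * x\<close>, and this expectation tends to 0 by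
  dominated convergence (\<open>joint_tail_negligible\<close>). If the positive parts of the losses sum to more
  than \<open>x\<close>, then one of them nearly exceeds \<open>x\<close> or two of them are of order \<open>x\<close>; this is the upper bound
  (\<open>ruin_prob_upper\<close>). Conversely a loss larger than \<open>v * x\<close> that is preceded only by small ones causes
  ruin at once, whatever follows it, because the maximum dominates every partial sum; these events
  are disjoint, and this is the lower bound (\<open>ruin_prob_lower\<close>).

  For the uniformity in the horizon, \<open>growth p q\<close> is submultiplicative, so \<open>E growth p q (\<Theta> n) \<le> \<rho> ^ n\<close>
  with \<open>\<rho> = E growth p q Y\<close>, and \<open>\<rho> < 1\<close> is the contraction hypothesis. If the losses after time \<open>N\<close> sum
  to more than \<open>x\<close>, then some loss at time \<open>N + 1 + k\<close> exceeds \<open>a k * x\<close> for geometric weights \<open>a k\<close> of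
  total at most 1; by the first estimate a weight costs only a factor \<open>a k powr (- p)\<close>, and the weights can
  be chosen to decay so slowly that \<open>\<rho> ^ k\<close> still wins (\<open>remote_losses_le\<close>). The exponents in the
  contraction hypothesis may coincide with the Matuszewska indices, where Potter's bound fails; by
  dominated convergence they can be moved strictly beyond them (\<open>contracting_exponents_open\<close>).
\<close>

section \<open>Potter bounds and Matuszewska indices\<close>

text \<open>The two exponents serve the two ranges of \<open>t\<close>: for \<open>q \<le> p\<close> this is \<open>t powr p\<close> when \<open>t \<ge> 1\<close> and
  \<open>t powr q\<close> when \<open>t \<le> 1\<close>. Since \<open>0 powr q = 0\<close> even for \<open>q = 0\<close>, it vanishes at 0, as the tail of
  \<open>X * Y * t\<close> does for \<open>t = 0\<close>.\<close>

definition growth :: "real \<Rightarrow> real \<Rightarrow> real \<Rightarrow> real" where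
  "growth p q t = max (t powr p) (t powr q)"

lemma growth_nonneg [simp]: "0 \<le> growth p q t"
  by (simp add: growth_def le_max_iff_disj)

lemma growth_zero [simp]: "growth p q 0 = 0"
  by (simp add: growth_def)

lemma growth_one [simp]: "growth p q 1 = 1"
  by (simp add: growth_def)

lemma growth_measurable [measurable]: "growth p q \<in> borel_measurable borel"
  unfolding growth_def[abs_def] by measurable

lemma growth_mult_le: "growth p q (s * t) \<le> growth p q s * growth p q t"
  unfolding growth_def powr_mult
  by (intro max.boundedI mult_mono) (auto simp: le_max_iff_disj)

lemma growth_prod_le:
  assumes "finite I"
  shows "growth p q (\<Prod>i\<in>I. t i) \<le> (\<Prod>i\<in>I. growth p q (t i))"
  using assms
proof (induction I rule: finite_induct)
  case (insert j I)
  have "growth p q (\<Prod>i\<in>insert j I. t i) \<le> growth p q (t j) * growth p q (\<Prod>i\<in>I. t i)"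
    using insert by (simp add: growth_mult_le)
  also have "\<dots> \<le> growth p q (t j) * (\<Prod>i\<in>I. growth p q (t i))"
    using insert by (intro mult_left_mono) auto
  finally show ?case using insert by simp
qed simp

lemma growth_inverse:
  assumes "0 < a" "a \<le> 1" "q \<le> p"
  shows "growth p q (1 / a) = a powr (- p)"
proof -
  have "(1 / a) powr q \<le> (1 / a) powr p"
    using assms by (intro powr_mono) auto
  then show ?thesis
    using assms by (simp add: growth_def max_def powr_minus powr_divide inverse_eq_divide)
qed

text \<open>Iterating the hypothesis compares \<open>f x\<close> with \<open>f (v ^ n * x)\<close>. The factor \<open>v powr p\<close> pays for rounding \<open>t\<close>
  up to the next power of \<open>v\<close>.\<close>

lemma potter_bound_upper:
  fixes f :: "real \<Rightarrow> real"
  assumes anti: "antimono f" and v: "1 < v" and "0 \<le> p" and "0 \<le> D" and fD: "\<And>x. 0 \<le> x \<Longrightarrow> 0 \<le> f x"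
    and step: "\<And>x. D \<le> x \<Longrightarrow> v powr (- p) * f x \<le> f (v * x)"
    and x: "D \<le> x" and t: "1 \<le> t"
  shows "f x \<le> v powr p * t powr p * f (t * x)"
proof -
  have iter: "(v ^ n) powr (- p) * f x \<le> f (v ^ n * x)" for n
  proof (induction n)
    case (Suc n)
    have "D \<le> v ^ n * x"
      using mult_right_mono[of 1 "v ^ n" x] v x \<open>0 \<le> D\<close> by simp
    have "(v ^ Suc n) powr (- p) * f x = v powr (- p) * ((v ^ n) powr (- p) * f x)"
      using v by (simp add: powr_mult)
    also have "\<dots> \<le> v powr (- p) * f (v ^ n * x)"
      using Suc by (intro mult_left_mono) auto
    also have "\<dots> \<le> f (v ^ Suc n * x)"
      using step[OF \<open>D \<le> v ^ n * x\<close>] by (simp add: mult.assoc)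
    finally show ?case .
  qed (use v in simp)
  \<comment> \<open>the least power of \<open>v\<close> that is at least \<open>t\<close>\<close>
  define n where "n = nat \<lceil>log v t\<rceil>"
  have log0: "0 \<le> log v t" using v t by simp
  have n: "log v t \<le> real n" "real n \<le> log v t + 1"
    unfolding n_def using log0 by linarith+
  have "t = v powr log v t" using v t by simp
  also have "\<dots> \<le> v ^ n" using n v by (simp flip: powr_realpow)
  finally have tn: "t \<le> v ^ n" .
  have "v ^ n \<le> v powr (log v t + 1)" using n v by (simp flip: powr_realpow)
  also have "\<dots> = v * t" using v t by (simp add: powr_add)
  finally have nt: "v ^ n \<le> v * t" .
  have pos: "0 < v ^ n" using v by simp
  have f0: "0 \<le> f (t * x)" using x t \<open>0 \<le> D\<close> by (intro fD) auto
  have "(v ^ n) powr (- p) * f x \<le> f (v ^ n * x)" by (rule iter)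
  also have "\<dots> \<le> f (t * x)"
    using tn x \<open>0 \<le> D\<close> by (intro antimonoD[OF anti] mult_right_mono) auto
  finally have le: "(v ^ n) powr (- p) * f x \<le> f (t * x)" .
  have "(v ^ n) powr p * (v ^ n) powr (- p) = 1"
    using v by (simp flip: powr_add)
  then have "f x = (v ^ n) powr p * ((v ^ n) powr (- p) * f x)"
    unfolding mult.assoc[symmetric] by simp
  also have "\<dots> \<le> (v ^ n) powr p * f (t * x)"
    using le by (intro mult_left_mono) auto
  also have "\<dots> \<le> (v * t) powr p * f (t * x)"
    using nt pos f0 \<open>0 \<le> p\<close> by (intro mult_right_mono powr_mono2) auto
  finally show ?thesis using v t by (simp add: powr_mult)
qed

lemma potter_bound_lower:
  fixes f :: "real \<Rightarrow> real"
  assumes anti: "antimono f" and v: "1 < v" and "0 \<le> q" and "0 \<le> D" and fD: "\<And>x. 0 \<le> x \<Longrightarrow> 0 \<le> f x"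
    and step: "\<And>x. D \<le> x \<Longrightarrow> f (v * x) \<le> v powr (- q) * f x"
    and x: "D \<le> x" and t: "1 \<le> t"
  shows "f (t * x) \<le> v powr q * t powr (- q) * f x"
proof -
  have iter: "f (v ^ n * x) \<le> (v ^ n) powr (- q) * f x" for n
  proof (induction n)
    case (Suc n)
    have "D \<le> v ^ n * x"
      using mult_right_mono[of 1 "v ^ n" x] v x \<open>0 \<le> D\<close> by simp
    then have "f (v ^ Suc n * x) \<le> v powr (- q) * f (v ^ n * x)"
      using step by (simp add: mult.assoc)
    also have "\<dots> \<le> v powr (- q) * ((v ^ n) powr (- q) * f x)"
      using Suc by (intro mult_left_mono) auto
    also have "\<dots> = (v ^ Suc n) powr (- q) * f x"
      using v by (simp add: powr_mult)
    finally show ?case .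
  qed (use v in simp)
  \<comment> \<open>the greatest power of \<open>v\<close> that is at most \<open>t\<close>\<close>
  define n where "n = nat \<lfloor>log v t\<rfloor>"
  have log0: "0 \<le> log v t" using v t by simp
  have n: "real n \<le> log v t" "log v t \<le> real n + 1"
    unfolding n_def using log0 by linarith+
  have "v ^ n \<le> v powr log v t" using n v by (simp flip: powr_realpow)
  also have "\<dots> = t" using v t by simp
  finally have nt: "v ^ n \<le> t" .
  have "t = v powr log v t" using v t by simp
  also have "\<dots> \<le> v powr (real n + 1)" using n v by simp
  also have "\<dots> = v * v ^ n" using v by (simp add: powr_add powr_realpow)
  finally have tn: "t / v \<le> v ^ n" using v by (simp add: field_simps)
  have "f (t * x) \<le> f (v ^ n * x)"
    using nt x \<open>0 \<le> D\<close> by (intro antimonoD[OF anti] mult_right_mono) auto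
  also have "\<dots> \<le> (v ^ n) powr (- q) * f x" by (rule iter)
  also have "\<dots> \<le> (t / v) powr (- q) * f x"
    using tn v t x \<open>0 \<le> q\<close> \<open>0 \<le> D\<close> fD by (intro mult_right_mono powr_mono2') auto
  also have "(t / v) powr (- q) = v powr q * t powr (- q)"
    using v t by (simp add: powr_divide powr_minus field_simps)
  finally show ?thesis .
qed

text \<open>The usual Potter bound requires both \<open>x\<close> and \<open>x / t\<close> to be large. The upper exponent also takes care
  of large \<open>t\<close>, so that \<open>t\<close> is unrestricted and the bound can be integrated over the whole range of a
  random \<open>t\<close>.\<close>

lemma potter_bound:
  fixes f :: "real \<Rightarrow> real"
  assumes anti: "antimono f" and pos: "\<And>x. 0 \<le> x \<Longrightarrow> 0 < f x"
    and "0 \<le> p" and "0 \<le> q"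
    and up: "\<exists>v>1. \<forall>\<^sub>F x in at_top. v powr (- p) * f x \<le> f (v * x)"
    and lo: "\<exists>v>1. \<forall>\<^sub>F x in at_top. f (v * x) \<le> v powr (- q) * f x"
  shows "\<exists>C>0. \<exists>D>0. \<forall>x\<ge>D. \<forall>t>0. f (x / t) \<le> C * f x * growth p q t"
proof -
  obtain v where v: "1 < v" "\<forall>\<^sub>F x in at_top. v powr (- p) * f x \<le> f (v * x)"
    using up by blast
  obtain w where w: "1 < w" "\<forall>\<^sub>F x in at_top. f (w * x) \<le> w powr (- q) * f x"
    using lo by blast
  have "\<forall>\<^sub>F x in at_top. v powr (- p) * f x \<le> f (v * x) \<and> f (w * x) \<le> w powr (- q) * f x"
    using v w by (intro eventually_conj) auto
  then obtain D0 where D0: "\<And>x. D0 \<le> x \<Longrightarrow> v powr (- p) * f x \<le> f (v * x) \<and> f (w * x) \<le> w powr (- q) * f x"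
    unfolding eventually_at_top_linorder by blast
  define D where "D = max D0 1"
  have D: "0 < D" by (simp add: D_def)
  have pos': "0 \<le> f x" if "0 \<le> x" for x using pos[OF that] by simp
  have U: "f x \<le> v powr p * t powr p * f (t * x)" if "D \<le> x" "1 \<le> t" for x t
    by (rule potter_bound_upper[OF anti v(1) \<open>0 \<le> p\<close> _ pos' _ that]) (use D D0 in \<open>auto simp: D_def\<close>)
  have L: "f (t * x) \<le> w powr q * t powr (- q) * f x" if "D \<le> x" "1 \<le> t" for x t
    by (rule potter_bound_lower[OF anti w(1) \<open>0 \<le> q\<close> _ pos' _ that]) (use D D0 in \<open>auto simp: D_def\<close>)
  define r where "r = f 0 / f D"
  have fD: "0 < f D" using pos D by simp
  have "f D \<le> f 0" using D by (intro antimonoD[OF anti]) simp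
  then have r: "1 \<le> r" using fD by (simp add: r_def)
  define C where "C = max (w powr q) (v powr p * r)"
  have "f (x / t) \<le> C * f x * growth p q t" if x: "D \<le> x" and t: "0 < t" for x t
  proof -
    have fx: "0 < f x" using x D pos by simp
    have Cg: "c * f x * t powr e \<le> C * f x * growth p q t"
      if "c \<le> C" "e \<in> {p, q}" "0 \<le> c" for c e
      using that fx by (intro mult_mono) (auto simp: growth_def C_def)
    consider "t \<le> 1" | "1 \<le> t" "D \<le> x / t" | "1 \<le> t" "x / t \<le> D" by linarith
    then show ?thesis
    proof cases
      case 1
      have "f (1 / t * x) \<le> w powr q * (1 / t) powr (- q) * f x"
        using 1 t x by (intro L) auto
      also have "\<dots> = w powr q * f x * t powr q"
        using t by (simp add: powr_minus powr_divide)
      also have "\<dots> \<le> C * f x * growth p q t" by (rule Cg) (auto simp: C_def)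
      finally show ?thesis by simp
    next
      case 2
      have "f (x / t) \<le> v powr p * t powr p * f (t * (x / t))" by (rule U) (use 2 in auto)
      also have "\<dots> = v powr p * f x * t powr p" using t by simp
      also have "\<dots> \<le> C * f x * growth p q t"
        using r mult_left_mono[of 1 r "v powr p"] by (intro Cg) (auto simp: C_def)
      finally show ?thesis .
    next
      \<comment> \<open>here \<open>x / t\<close> may be close to 0 and the left-hand side is only known to be at most \<open>f 0\<close>;
          but then \<open>t powr p\<close> exceeds \<open>(x / D) powr p\<close>, which outgrows \<open>1 / f x\<close>\<close>
      case 3
      have "f (x / t) \<le> f 0" using x t D by (intro antimonoD[OF anti]) simp
      also have "\<dots> = r * f D" using fD by (simp add: r_def)
      also have "\<dots> \<le> r * (v powr p * (x / D) powr p * f (x / D * D))"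
        using r x D by (intro mult_left_mono U) auto
      also have "\<dots> = v powr p * r * f x * (x / D) powr p" using D by simp
      also have "\<dots> \<le> v powr p * r * f x * t powr p"
        using 3 x t D r fx \<open>0 \<le> p\<close>
        by (intro mult_left_mono powr_mono2) (auto simp: field_simps)
      also have "\<dots> \<le> C * f x * growth p q t" by (rule Cg) (use r in \<open>auto simp: C_def\<close>)
      finally show ?thesis .
    qed
  qed
  moreover have "0 < C" using w by (simp add: C_def less_max_iff_disj)
  ultimately show ?thesis using D by blast
qed

lemma tail_ratio_bounds:
  assumes "mono F" and pos: "\<And>x. 0 \<le> x \<Longrightarrow> 0 < tail F x" and v: "1 < v"
  shows "\<forall>\<^sub>F x in at_top. 0 \<le> tail F (v * x) / tail F x \<and> tail F (v * x) / tail F x \<le> 1"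
  using eventually_ge_at_top[of 0]
proof eventually_elim
  case (elim x)
  have "x \<le> v * x" using elim v mult_right_mono[of 1 v x] by simp
  then have "tail F (v * x) \<le> tail F x" using \<open>mono F\<close> by (simp add: tail_def monoD)
  moreover have "0 < tail F x" "0 < tail F (v * x)" using elim v by (auto intro!: pos)
  ultimately show ?case by simp
qed

text \<open>As an infimum, the index is approached by a single \<open>v\<close>, and \<open>- ln r / ln v < p\<close> says that
  \<open>r > v powr (- p)\<close> for the ratio limit \<open>r\<close> at \<open>v\<close>. This is the hypothesis of the Potter bound.\<close>

lemma upper_matuszewska_lessD:
  assumes "mono F" and pos: "\<And>x. 0 \<le> x \<Longrightarrow> 0 < tail F x"
    and p: "upper_matuszewska F < ereal p"
  shows "\<exists>v>1. \<forall>\<^sub>F x in at_top. v powr (- p) * tail F x \<le> tail F (v * x)"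
proof -
  obtain v where v: "1 < v" and less: "neg_ln (tail_ratio_liminf F v) / ereal (ln v) < ereal p"
    using p by (auto simp: upper_matuszewska_def INF_less_iff)
  have lnv: "ln v \<noteq> 0" using v by simp
  have bounds: "\<forall>\<^sub>F x in at_top. 0 \<le> tail F (v * x) / tail F x \<and> tail F (v * x) / tail F x \<le> 1"
    using tail_ratio_bounds[OF assms(1) _ v] pos by blast
  let ?L = "tail_ratio_liminf F v"
  have "0 \<le> ?L" unfolding tail_ratio_liminf_def
    by (rule Liminf_bounded) (use bounds in \<open>eventually_elim, simp add: zero_ereal_def\<close>)
  moreover have "?L \<le> Limsup at_top (\<lambda>x. ereal (tail F (v * x) / tail F x))"
    unfolding tail_ratio_liminf_def by (rule Liminf_le_Limsup) simp
  moreover have "Limsup at_top (\<lambda>x. ereal (tail F (v * x) / tail F x)) \<le> 1"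
    by (rule Limsup_bounded) (use bounds in \<open>eventually_elim, simp add: one_ereal_def\<close>)
  ultimately have "0 \<le> ?L" "?L \<le> 1" by auto
  then obtain r where r: "?L = ereal r" "0 \<le> r"
    by (cases "?L") auto
  have "r \<noteq> 0" using less v r by (auto simp: neg_ln_def zero_ereal_def)
  then have "ereal (- ln r) / ereal (ln v) < ereal p" using less r by (simp add: neg_ln_def)
  then have "- ln r / ln v < p" using lnv by simp
  then have "- p * ln v < ln r" using v by (simp add: field_simps)
  then have "exp (- p * ln v) < exp (ln r)" by (rule exp_less_mono)
  then have "v powr (- p) < r" using v r \<open>r \<noteq> 0\<close> by (simp add: powr_def)
  then have "ereal (v powr (- p)) < ?L" using r by simp
  then have "\<forall>\<^sub>F x in at_top. ereal (v powr (- p)) < ereal (tail F (v * x) / tail F x)"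
    unfolding tail_ratio_liminf_def by (rule less_LiminfD)
  then have "\<forall>\<^sub>F x in at_top. v powr (- p) * tail F x \<le> tail F (v * x)"
    using eventually_ge_at_top[of 0]
  proof eventually_elim
    case (elim x)
    then show ?case using pos[of x] by (simp add: field_simps)
  qed
  then show ?thesis using v by blast
qed

lemma lower_matuszewska_greaterD:
  assumes "mono F" and pos: "\<And>x. 0 \<le> x \<Longrightarrow> 0 < tail F x"
    and q: "ereal q < lower_matuszewska F"
  shows "\<exists>v>1. \<forall>\<^sub>F x in at_top. tail F (v * x) \<le> v powr (- q) * tail F x"
proof -
  obtain v where v: "1 < v" and less: "ereal q < neg_ln (tail_ratio_limsup F v) / ereal (ln v)"
    using q by (auto simp: lower_matuszewska_def less_SUP_iff)
  have lnv: "ln v \<noteq> 0" using v by simp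
  have bounds: "\<forall>\<^sub>F x in at_top. 0 \<le> tail F (v * x) / tail F x \<and> tail F (v * x) / tail F x \<le> 1"
    using tail_ratio_bounds[OF assms(1) _ v] pos by blast
  let ?L = "tail_ratio_limsup F v"
  have "?L \<le> 1" unfolding tail_ratio_limsup_def
    by (rule Limsup_bounded) (use bounds in \<open>eventually_elim, simp add: one_ereal_def\<close>)
  moreover have "0 \<le> Liminf at_top (\<lambda>x. ereal (tail F (v * x) / tail F x))"
    by (rule Liminf_bounded) (use bounds in \<open>eventually_elim, simp add: zero_ereal_def\<close>)
  moreover have "Liminf at_top (\<lambda>x. ereal (tail F (v * x) / tail F x)) \<le> ?L"
    unfolding tail_ratio_limsup_def by (rule Liminf_le_Limsup) simp
  ultimately have "0 \<le> ?L" "?L \<le> 1" by auto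
  then obtain r where r: "?L = ereal r" "0 \<le> r"
    by (cases "?L") auto
  have "r < v powr (- q)"
  proof (cases "r = 0")
    case False
    then have "ereal q < ereal (- ln r) / ereal (ln v)" using less r by (simp add: neg_ln_def)
    then have "q < - ln r / ln v" using lnv by simp
    then have "ln r < - q * ln v" using v by (simp add: field_simps)
    then have "exp (ln r) < exp (- q * ln v)" by (rule exp_less_mono)
    then show ?thesis using v r False by (simp add: powr_def)
  qed (use v in simp)
  then have "?L < ereal (v powr (- q))" using r by simp
  then have "\<forall>\<^sub>F x in at_top. ereal (tail F (v * x) / tail F x) < ereal (v powr (- q))"
    unfolding tail_ratio_limsup_def by (rule Limsup_lessD)
  then have "\<forall>\<^sub>F x in at_top. tail F (v * x) \<le> v powr (- q) * tail F x"
    using eventually_ge_at_top[of 0]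
  proof eventually_elim
    case (elim x)
    then show ?case using pos[of x] by (simp add: field_simps)
  qed
  then show ?thesis using v by blast
qed

lemma consistently_varyingD:
  assumes "consistently_varying F" and pos: "\<And>x. 0 \<le> x \<Longrightarrow> 0 < tail F x" and "0 < \<eta>"
  shows "\<exists>v>1. \<forall>\<^sub>F x in at_top. tail F x \<le> (1 + \<eta>) * tail F (v * x)"
proof -
  have "\<forall>\<^sub>F b in at_left 1. tail_ratio_limsup F b < ereal (1 + \<eta>)"
    using assms(1) unfolding consistently_varying_def
    by (rule order_tendstoD) (use \<open>0 < \<eta>\<close> in \<open>simp add: one_ereal_def\<close>)
  moreover have "\<forall>\<^sub>F b::real in at_left 1. 0 < b \<and> b < 1"
    by (rule eventually_at_leftI[of 0]) auto
  ultimately have "\<forall>\<^sub>F b::real in at_left 1. tail_ratio_limsup F b < ereal (1 + \<eta>) \<and> 0 < b \<and> b < 1"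
    by eventually_elim auto
  then obtain b :: real where b: "tail_ratio_limsup F b < ereal (1 + \<eta>)" "0 < b" "b < 1"
    using eventually_happens[of _ "at_left (1::real)"] by auto
  have ev: "\<forall>\<^sub>F x in at_top. ereal (tail F (b * x) / tail F x) < ereal (1 + \<eta>)"
    by (rule Limsup_lessD) (use b(1) in \<open>simp add: tail_ratio_limsup_def\<close>)
  have "filterlim (\<lambda>x. (1 / b) * x) at_top at_top"
    by (rule filterlim_tendsto_pos_mult_at_top[OF tendsto_const _ filterlim_ident]) (use b in auto)
  from filterlim_iff[THEN iffD1, OF this, rule_format, OF ev]
  have "\<forall>\<^sub>F x in at_top. tail F x \<le> (1 + \<eta>) * tail F (1 / b * x)"
    using eventually_ge_at_top[of 0]
  proof eventually_elim
    case (elim x)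
    then show ?case using b pos[of "x / b"] by (simp add: field_simps)
  qed
  then show ?thesis using b by (intro exI[of _ "1 / b"]) auto
qed

section \<open>Disintegration along the discount factor\<close>

text \<open>The complement of the support is the union of the null sets among countably many basic open sets.\<close>

lemma AE_distr_support:
  assumes [simp]: "sets N = sets borel"
  shows "AE y in N. y \<in> distr_support N"
proof -
  obtain B :: "real set set" where B: "countable B" "topological_basis B"
    using ex_countable_basis by blast
  have B_sets: "U \<in> sets N" if "U \<in> B" for U
    using that B(2) by (simp add: topological_basis_open)
  define Z where "Z = {U \<in> B. emeasure N U = 0}"
  have "(\<Union>U\<in>Z. U) \<in> null_sets N"
    using B(1) B_sets by (intro null_sets_UN') (auto simp: Z_def intro: null_setsI)
  moreover have "y \<in> (\<Union>U\<in>Z. U)" if y: "y \<notin> distr_support N" for y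
  proof -
    obtain U where U: "open U" "y \<in> U" "emeasure N U = 0"
      using y by (auto simp: distr_support_def zero_less_iff_neq_zero)
    obtain V where V: "V \<in> B" "y \<in> V" "V \<subseteq> U"
      using topological_basisE[OF B(2) U(1,2)] .
    have "emeasure N V \<le> emeasure N U" using V U by (intro emeasure_mono) auto
    then show ?thesis using U V by (auto simp: Z_def)
  qed
  ultimately show ?thesis
    by (intro AE_I[where N="\<Union>U\<in>Z. U"]) auto
qed

text \<open>Both sides are measures in the set argument, and the rectangles generate the product
  \<open>\<sigma>\<close>-algebra.\<close>

lemma (in prob_space) regular_cond_distr_emeasure:
  assumes [measurable]: "X \<in> borel_measurable M" "Y \<in> borel_measurable M"
    and K: "regular_cond_distr M X Y K"
    and A: "A \<in> sets (borel \<Otimes>\<^sub>M borel)"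
  shows "emeasure M {\<omega> \<in> space M. (X \<omega>, Y \<omega>) \<in> A}
       = (\<integral>\<^sup>+y. emeasure (K y) {x. (x, y) \<in> A} \<partial>distr M borel Y)"
proof -
  have KP: "K \<in> borel \<rightarrow>\<^sub>M prob_algebra borel"
    and rect: "\<And>A B. A \<in> sets borel \<Longrightarrow> B \<in> sets borel \<Longrightarrow>
        emeasure M {\<omega> \<in> space M. X \<omega> \<in> A \<and> Y \<omega> \<in> B} = (\<integral>\<^sup>+y\<in>B. emeasure (K y) A \<partial>distr M borel Y)"
    using K unfolding regular_cond_distr_def by auto
  have K_space: "prob_space (K y)" "sets (K y) = sets borel" "space (K y) = UNIV" for y
    using measurable_space[OF KP, of y] sets_eq_imp_space_eq[of "K y" borel]
    by (auto simp: space_prob_algebra)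
  have meas: "(\<lambda>y. emeasure (K y) {x. (x, y) \<in> A}) \<in> borel_measurable borel"
    if "A \<in> sets (borel \<Otimes>\<^sub>M borel)" for A
  proof (rule emeasure_measurable_subprob_algebra2[where N=borel])
    have "(SIGMA y:space borel. {x. (x, y) \<in> A}) = {p \<in> space (borel \<Otimes>\<^sub>M borel). (snd p, fst p) \<in> A}"
      by (auto simp: space_pair_measure)
    also have "\<dots> \<in> sets (borel \<Otimes>\<^sub>M borel)"
      using that by measurable
    finally show "(SIGMA y:space borel. {x. (x, y) \<in> A}) \<in> sets (borel \<Otimes>\<^sub>M borel)" .
  qed (rule measurable_prob_algebraD[OF KP])
  have sec: "{x. (x, y) \<in> A} \<in> sets (K y)" if "A \<in> sets (borel \<Otimes>\<^sub>M borel)" for A :: "(real \<times> real) set" and y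
    using sets_Pair2[OF that, of y] K_space by (simp add: vimage_def)
  show ?thesis
    using Int_stable_pair_measure_generator pair_measure_closed A unfolding sets_pair_measure
  proof (induction rule: sigma_sets_induct_disjoint)
    case (basic A)
    then obtain a b where ab: "A = a \<times> b" "a \<in> sets borel" "b \<in> sets borel" by auto
    have "{\<omega> \<in> space M. (X \<omega>, Y \<omega>) \<in> A} = {\<omega> \<in> space M. X \<omega> \<in> a \<and> Y \<omega> \<in> b}"
      using ab by auto
    moreover have "emeasure (K y) {x. (x, y) \<in> A} = emeasure (K y) a * indicator b y" for y
      using ab by (auto split: split_indicator)
    ultimately show ?case using rect ab by simp
  next
    case empty show ?case by simp
  next
    case (compl A)
    have A: "A \<in> sets (borel \<Otimes>\<^sub>M borel)" using compl by (simp add: sets_pair_measure)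
    have meas_A: "(\<lambda>y. emeasure (K y) {x. (x, y) \<in> A}) \<in> borel_measurable (distr M borel Y)"
      using meas[OF A] by simp
    have fin: "(\<integral>\<^sup>+y. emeasure (K y) {x. (x, y) \<in> A} \<partial>distr M borel Y) \<noteq> \<infinity>"
      unfolding compl.IH[symmetric] by (simp add: emeasure_eq_measure)
    have "emeasure M {\<omega> \<in> space M. (X \<omega>, Y \<omega>) \<in> space borel \<times> space borel - A}
        = emeasure M (space M - {\<omega> \<in> space M. (X \<omega>, Y \<omega>) \<in> A})"
      by (intro arg_cong[where f="emeasure M"]) auto
    also have "\<dots> = 1 - emeasure M {\<omega> \<in> space M. (X \<omega>, Y \<omega>) \<in> A}"
      using A by (subst emeasure_compl) (auto simp: emeasure_space_1)
    also have "\<dots> = (\<integral>\<^sup>+y. 1 \<partial>distr M borel Y) - (\<integral>\<^sup>+y. emeasure (K y) {x. (x, y) \<in> A} \<partial>distr M borel Y)"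
      by (simp add: compl.IH emeasure_distr emeasure_space_1)
    also have "\<dots> = (\<integral>\<^sup>+y. 1 - emeasure (K y) {x. (x, y) \<in> A} \<partial>distr M borel Y)"
      using fin meas_A K_space
      by (intro nn_integral_diff[symmetric]) (auto intro!: prob_space.measure_le_1 prob_space.emeasure_le_1)
    also have "\<dots> = (\<integral>\<^sup>+y. emeasure (K y) {x. (x, y) \<in> space borel \<times> space borel - A} \<partial>distr M borel Y)"
    proof (intro nn_integral_cong)
      fix y
      have "{x. (x, y) \<in> space borel \<times> space borel - A} = space (K y) - {x. (x, y) \<in> A}"
        using K_space by auto
      then show "1 - emeasure (K y) {x. (x, y) \<in> A} = emeasure (K y) {x. (x, y) \<in> space borel \<times> space borel - A}"
        using sec[OF A, of y] prob_space.emeasure_space_1[OF K_space(1), of y]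
          prob_space.finite_measure[OF K_space(1), of y]
        by (simp add: emeasure_compl finite_measure.emeasure_finite)
    qed
    finally show ?case by simp
  next
    case (union A)
    have A: "A i \<in> sets (borel \<Otimes>\<^sub>M borel)" for i using union by (auto simp: sets_pair_measure)
    have "emeasure M {\<omega> \<in> space M. (X \<omega>, Y \<omega>) \<in> (\<Union>i. A i)} = emeasure M (\<Union>i. {\<omega> \<in> space M. (X \<omega>, Y \<omega>) \<in> A i})"
      by (intro arg_cong[where f="emeasure M"]) auto
    also have "\<dots> = (\<Sum>i. emeasure M {\<omega> \<in> space M. (X \<omega>, Y \<omega>) \<in> A i})"
      using union(1) A by (intro suminf_emeasure[symmetric]) (auto simp: disjoint_family_on_def)
    also have "\<dots> = (\<Sum>i. \<integral>\<^sup>+y. emeasure (K y) {x. (x, y) \<in> A i} \<partial>distr M borel Y)"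
      by (simp add: union.IH)
    also have "\<dots> = (\<integral>\<^sup>+y. (\<Sum>i. emeasure (K y) {x. (x, y) \<in> A i}) \<partial>distr M borel Y)"
      using meas[OF A] by (intro nn_integral_suminf[symmetric]) simp
    also have "\<dots> = (\<integral>\<^sup>+y. emeasure (K y) {x. (x, y) \<in> (\<Union>i. A i)} \<partial>distr M borel Y)"
    proof (intro nn_integral_cong)
      fix y
      have "(\<Sum>i. emeasure (K y) {x. (x, y) \<in> A i}) = emeasure (K y) (\<Union>i. {x. (x, y) \<in> A i})"
        using union(1) sec[OF A] by (intro suminf_emeasure) (auto simp: disjoint_family_on_def)
      also have "(\<Union>i. {x. (x, y) \<in> A i}) = {x. (x, y) \<in> (\<Union>i. A i)}" by auto
      finally show "(\<Sum>i. emeasure (K y) {x. (x, y) \<in> A i}) = emeasure (K y) {x. (x, y) \<in> (\<Union>i. A i)}" .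
    qed
    finally show ?case .
  qed
qed

section \<open>The tail of the product\<close>

text \<open>The extra argument \<open>t\<close> takes the place of the earlier discount factors. Scaling by \<open>t\<close> rather than
  evaluating the tail at \<open>x / t\<close> gives the right value for \<open>t = 0\<close> too.\<close>

definition product_tail :: "'a measure \<Rightarrow> ('a \<Rightarrow> real) \<Rightarrow> ('a \<Rightarrow> real) \<Rightarrow> real \<Rightarrow> real \<Rightarrow> real" where
  "product_tail M X Y x t = measure M {\<omega> \<in> space M. x < X \<omega> * Y \<omega> * t}"

locale conditional_tail_model = prob_space M for M :: "'a measure" +
  fixes X Y :: "'a \<Rightarrow> real" and K :: "real \<Rightarrow> real measure" and h f :: "real \<Rightarrow> real"
  assumes X_meas [measurable]: "X \<in> borel_measurable M"
    and Y_meas [measurable]: "Y \<in> borel_measurable M"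
    and K: "regular_cond_distr M X Y K"
    and Y_nonneg: "AE \<omega> in M. 0 \<le> Y \<omega>"
    and Y_pos: "0 < prob {\<omega> \<in> space M. 0 < Y \<omega>}"
    and f: "\<And>x. f x = prob {\<omega> \<in> space M. x < X \<omega>}"
    and f_pos: "\<And>x. 0 \<le> x \<Longrightarrow> 0 < f x"
    and h_pos: "\<And>y. 0 \<le> y \<Longrightarrow> 0 < h y"
    and uniform: "\<And>e. 0 < e \<Longrightarrow> \<forall>\<^sub>F x in at_top. \<forall>y\<in>distr_support (distr M borel Y).
        \<bar>measure (K y) {x<..} / (h y * f x) - 1\<bar> \<le> e"
begin

abbreviation "S \<equiv> distr_support (distr M borel Y)"

lemma K_kernel: "K \<in> borel \<rightarrow>\<^sub>M prob_algebra borel"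
  using K by (simp add: regular_cond_distr_def)

lemma K_space: "prob_space (K y)" "sets (K y) = sets borel" "space (K y) = UNIV"
  using measurable_space[OF K_kernel, of y] sets_eq_imp_space_eq[of "K y" borel]
  by (auto simp: space_prob_algebra)

lemma K_le_1: "measure (K y) A \<le> 1"
  using prob_space.prob_le_1[OF K_space(1)] .

lemma f_antimono: "antimono f"
  unfolding f by (intro antimonoI finite_measure_mono) auto

lemma f_le_1: "f x \<le> 1"
  unfolding f by simp

lemma distr_prob_space: "prob_space (distr M borel Y)"
  by (rule prob_space_distr) simp

lemma support_nonneg: "y \<in> S \<Longrightarrow> 0 \<le> y"
proof (rule ccontr)
  assume y: "y \<in> S" and "\<not> 0 \<le> y"
  then have "0 < emeasure (distr M borel Y) {..<0}"
    unfolding distr_support_def by auto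
  moreover have "AE y in distr M borel Y. 0 \<le> y"
    using Y_nonneg by (subst AE_distr_iff) auto
  then have "emeasure (distr M borel Y) {y \<in> space (distr M borel Y). y < 0} = 0"
    by (intro emeasure_eq_0_AE) (simp add: not_less)
  then have "emeasure (distr M borel Y) {..<0} = 0" by (simp add: lessThan_def)
  ultimately show False by simp
qed

lemma AE_support: "AE y in distr M borel Y. y \<in> S"
  by (rule AE_distr_support) simp

lemma K_section_measurable [measurable]:
  assumes "A \<in> sets (borel \<Otimes>\<^sub>M borel)"
  shows "(\<lambda>y. measure (K y) {x. (x, y) \<in> A}) \<in> borel_measurable borel"
proof (rule measure_measurable_prob_algebra2[OF _ K_kernel])
  have "(SIGMA y:space borel. {x. (x, y) \<in> A}) = {p \<in> space (borel \<Otimes>\<^sub>M borel). (snd p, fst p) \<in> A}"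
    by (auto simp: space_pair_measure)
  also have "\<dots> \<in> sets (borel \<Otimes>\<^sub>M borel)"
    using assms by measurable
  finally show "(SIGMA y:space borel. {x. (x, y) \<in> A}) \<in> sets (borel \<Otimes>\<^sub>M borel)" .
qed

lemma integrable_K_section [simp]:
  assumes "A \<in> sets (borel \<Otimes>\<^sub>M borel)"
  shows "integrable (distr M borel Y) (\<lambda>y. measure (K y) {x. (x, y) \<in> A})"
  using K_section_measurable[OF assms] distr_prob_space K_le_1
  by (intro finite_measure.integrable_const_bound[where B=1]) (auto simp: prob_space.finite_measure)

lemma prob_disintegrate:
  assumes A: "A \<in> sets (borel \<Otimes>\<^sub>M borel)"
  shows "prob {\<omega> \<in> space M. (X \<omega>, Y \<omega>) \<in> A} = (\<integral>y. measure (K y) {x. (x, y) \<in> A} \<partial>distr M borel Y)"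
proof -
  have "ennreal (prob {\<omega> \<in> space M. (X \<omega>, Y \<omega>) \<in> A})
      = (\<integral>\<^sup>+y. ennreal (measure (K y) {x. (x, y) \<in> A}) \<partial>distr M borel Y)"
    unfolding emeasure_eq_measure[symmetric] regular_cond_distr_emeasure[OF X_meas Y_meas K A]
    using finite_measure.emeasure_eq_measure[OF prob_space.finite_measure[OF K_space(1)]]
    by simp
  also have "\<dots> = ennreal (\<integral>y. measure (K y) {x. (x, y) \<in> A} \<partial>distr M borel Y)"
    using A by (intro nn_integral_eq_integral) auto
  finally show ?thesis
    by (subst (asm) ennreal_inj) (auto intro: integral_nonneg_AE)
qed

lemma product_set_measurable [measurable]:
  "{p. x < fst p * snd p * t} \<in> sets (borel \<Otimes>\<^sub>M borel)" for x t :: real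
proof -
  have "{p \<in> space (borel \<Otimes>\<^sub>M borel). x < fst p * snd p * t} \<in> sets (borel \<Otimes>\<^sub>M borel)"
    by measurable
  then show ?thesis by (simp add: space_pair_measure)
qed

lemma integrable_product_section [simp]:
  "integrable (distr M borel Y) (\<lambda>y. measure (K y) {z. x < z * y * t})"
  using integrable_K_section[OF product_set_measurable, of x t] by simp

lemma product_tail_disintegrate:
  "product_tail M X Y x t = (\<integral>y. measure (K y) {z. x < z * y * t} \<partial>distr M borel Y)"
  using prob_disintegrate[OF product_set_measurable, of x t] by (simp add: product_tail_def)

lemma product_section:
  fixes x y t :: real
  assumes "0 \<le> x" "0 \<le> y" "0 \<le> t"
  shows "{z. x < z * y * t} = (if y * t = 0 then {} else {x / (y * t)<..})"
proof (cases "y * t = 0")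
  case False
  then have "0 < y * t" using assms by (metis less_eq_real_def mult_nonneg_nonneg)
  then show ?thesis by (auto simp: pos_divide_less_eq mult.assoc)
qed (use assms in auto)

lemma conditional_tail_comparable:
  assumes "0 < e" "e < 1"
  shows "\<exists>D\<ge>0. \<forall>z\<ge>D. \<forall>y\<in>S. (1 - e) * (h y * f z) \<le> measure (K y) {z<..} \<and>
      measure (K y) {z<..} \<le> (1 + e) * (h y * f z)"
proof -
  obtain D0 where D0: "\<And>z y. D0 \<le> z \<Longrightarrow> y \<in> S \<Longrightarrow> \<bar>measure (K y) {z<..} / (h y * f z) - 1\<bar> \<le> e"
    using uniform[OF \<open>0 < e\<close>] unfolding eventually_at_top_linorder by blast
  show ?thesis
  proof (intro exI[of _ "max D0 0"] conjI allI impI ballI)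
    fix z y assume z: "max D0 0 \<le> z" and y: "y \<in> S"
    have pos: "0 < h y * f z" using z h_pos[OF support_nonneg[OF y]] f_pos by simp
    have *: "1 - e \<le> measure (K y) {z<..} / (h y * f z)" "measure (K y) {z<..} / (h y * f z) \<le> 1 + e"
      using D0[OF _ y, of z] z by (auto simp: abs_le_iff)
    show "(1 - e) * (h y * f z) \<le> measure (K y) {z<..}"
      using *(1) pos by (simp only: pos_le_divide_eq)
    show "measure (K y) {z<..} \<le> (1 + e) * (h y * f z)"
      using *(2) pos by (simp only: pos_divide_le_eq)
  qed simp
qed

text \<open>For \<open>x \<ge> D\<close> this is the uniform equivalence, once \<open>h\<close> is known to be bounded on the support: \<open>h y * f D\<close>
  is at most twice a probability. Below \<open>D\<close> the tail \<open>f\<close> is bounded away from 0.\<close>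

lemma conditional_tail_le: "\<exists>B>0. \<forall>y\<in>S. \<forall>z. measure (K y) {z<..} \<le> B * f z"
proof -
  obtain D where D: "0 \<le> D" and cmp: "\<And>z y. D \<le> z \<Longrightarrow> y \<in> S \<Longrightarrow>
      (1 - 1/2) * (h y * f z) \<le> measure (K y) {z<..} \<and> measure (K y) {z<..} \<le> (1 + 1/2) * (h y * f z)"
    using conditional_tail_comparable[of "1/2"] by auto
  have fD: "0 < f D" using f_pos D by simp
  have "measure (K y) {z<..} \<le> 3 / f D * f z" if y: "y \<in> S" for y z
  proof (cases "D \<le> z")
    case True
    have fz: "0 < f z" using f_pos D True by simp
    have "1/2 * (h y * f D) \<le> 1"
      using cmp[OF _ y, of D] K_le_1[of y "{D<..}"] by simp
    then have "h y \<le> 2 / f D" using fD by (simp add: field_simps)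
    then have "3/2 * (h y * f z) \<le> 3/2 * (2 / f D * f z)"
      using fz by (intro mult_left_mono mult_right_mono) auto
    then show ?thesis using cmp[OF True y] by simp
  next
    case False
    then have "f D \<le> f z" by (intro antimonoD[OF f_antimono]) simp
    then have "1 \<le> 3 / f D * f z" using fD by (simp add: field_simps)
    then show ?thesis using K_le_1[of y "{z<..}"] by simp
  qed
  then show ?thesis using fD by (intro exI[of _ "3 / f D"]) auto
qed

text \<open>The factor \<open>h y\<close> cancels between the two sides, so \<open>v\<close> and \<open>D\<close> do not depend on \<open>y\<close>.\<close>

lemma conditional_tail_consistently_varying:
  assumes cons: "\<And>e. 0 < e \<Longrightarrow> \<exists>v>1. \<forall>\<^sub>F x in at_top. f x \<le> (1 + e) * f (v * x)"
    and "0 < e"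
  shows "\<exists>v>1. \<exists>D>0. \<forall>z\<ge>D. \<forall>y\<in>S. measure (K y) {z<..} \<le> (1 + e) * measure (K y) {v * z<..}"
proof -
  \<comment> \<open>chosen such that \<open>1 + 3 * d = (1 + e) * (1 - d)\<close>\<close>
  define d where "d = e / (4 + e)"
  have d: "0 < d" "d < 1" and de: "d * (4 + e) = e" using \<open>0 < e\<close> by (auto simp: d_def)
  have "(1 + d) * (1 + d) \<le> 1 + 3 * d"
    using d mult_left_mono[of d 1 d] by (simp add: algebra_simps)
  also have "\<dots> = (1 + e) * (1 - d)" using de by (simp add: algebra_simps)
  finally have const: "(1 + d) * (1 + d) \<le> (1 + e) * (1 - d)" .
  obtain v where v: "1 < v" "\<forall>\<^sub>F x in at_top. f x \<le> (1 + d) * f (v * x)"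
    using cons[OF d(1)] by blast
  obtain D1 where D1: "\<And>x. D1 \<le> x \<Longrightarrow> f x \<le> (1 + d) * f (v * x)"
    using v(2) unfolding eventually_at_top_linorder by blast
  obtain D where D: "0 \<le> D" and cmp: "\<And>z y. D \<le> z \<Longrightarrow> y \<in> S \<Longrightarrow>
      (1 - d) * (h y * f z) \<le> measure (K y) {z<..} \<and> measure (K y) {z<..} \<le> (1 + d) * (h y * f z)"
    using conditional_tail_comparable[OF d] by auto
  have "measure (K y) {z<..} \<le> (1 + e) * measure (K y) {v * z<..}"
    if z: "max (max D D1) 1 \<le> z" and y: "y \<in> S" for y z
  proof -
    have vz: "z \<le> v * z" using v z mult_right_mono[of 1 v z] by simp
    have Dvz: "D \<le> v * z" using vz z by linarith
    have hy: "0 < h y" using h_pos support_nonneg y by simp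
    have fz: "0 < f (v * z)" using z vz by (intro f_pos) auto
    have "measure (K y) {z<..} \<le> (1 + d) * (h y * f z)" using cmp[OF _ y, of z] z by simp
    also have "\<dots> \<le> (1 + d) * (h y * ((1 + d) * f (v * z)))"
      using D1[of z] z hy d by (intro mult_left_mono) auto
    also have "\<dots> = (1 + d) * (1 + d) * (h y * f (v * z))" by simp
    also have "\<dots> \<le> (1 + e) * (1 - d) * (h y * f (v * z))"
      using const hy fz by (intro mult_right_mono) auto
    also have "\<dots> = (1 + e) * ((1 - d) * (h y * f (v * z)))" by simp
    also have "\<dots> \<le> (1 + e) * measure (K y) {v * z<..}"
      using cmp[OF Dvz y] \<open>0 < e\<close> by (intro mult_left_mono) auto
    finally show ?thesis .
  qed
  then show ?thesis
    using v(1) by (intro exI[of _ v] conjI exI[of _ "max (max D D1) 1"]) auto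
qed

text \<open>Conditioning on \<open>Y = y\<close> bounds the tail by \<open>B * f (x / (y * t))\<close>; then the Potter bound at \<open>y * t\<close> splits
  into a factor for \<open>t\<close> and one for \<open>y\<close>, which has a finite expectation.\<close>

lemma product_tail_le_growth:
  assumes pot: "\<exists>C>0. \<exists>D>0. \<forall>x\<ge>D. \<forall>t>0. f (x / t) \<le> C * f x * growth p q t"
    and int: "integrable M (\<lambda>\<omega>. growth p q (Y \<omega>))"
  shows "\<exists>C>0. \<exists>D>0. \<forall>x\<ge>D. \<forall>t\<ge>0. product_tail M X Y x t \<le> C * f x * growth p q t"
proof -
  obtain C D where CD: "0 < C" "0 < D" and pot': "\<And>x t. D \<le> x \<Longrightarrow> 0 < t \<Longrightarrow> f (x / t) \<le> C * f x * growth p q t"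
    using pot by blast
  obtain B where B: "0 < B" "\<And>y z. y \<in> S \<Longrightarrow> measure (K y) {z<..} \<le> B * f z"
    using conditional_tail_le by blast
  define E where "E = (\<integral>\<omega>. growth p q (Y \<omega>) \<partial>M)"
  have E: "0 \<le> E" unfolding E_def by (intro integral_nonneg_AE) simp
  have "product_tail M X Y x t \<le> B * C * (E + 1) * f x * growth p q t" if x: "D \<le> x" and t: "0 \<le> t" for x t
  proof -
    have fx: "0 < f x" using x CD by (intro f_pos) simp
    have "product_tail M X Y x t \<le> (\<integral>y. B * C * f x * growth p q t * growth p q y \<partial>distr M borel Y)"
      unfolding product_tail_disintegrate
    proof (rule integral_mono_AE)
      show "integrable (distr M borel Y) (\<lambda>y. B * C * f x * growth p q t * growth p q y)"
        using int by (intro integrable_mult_right) (simp add: integrable_distr_eq)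
      show "AE y in distr M borel Y. measure (K y) {z. x < z * y * t} \<le> B * C * f x * growth p q t * growth p q y"
        using AE_support
      proof eventually_elim
        case (elim y)
        have y: "0 \<le> y" using support_nonneg elim .
        show ?case
        proof (cases "y * t = 0")
          case False
          then have yt: "0 < y * t" using y t by (metis less_eq_real_def mult_nonneg_nonneg)
          have "measure (K y) {x / (y * t)<..} \<le> B * f (x / (y * t))" using B elim by simp
          also have "\<dots> \<le> B * (C * f x * growth p q (y * t))"
            using B yt x pot' by (intro mult_left_mono) auto
          also have "\<dots> \<le> B * (C * f x * (growth p q y * growth p q t))"
            using B CD fx growth_mult_le by (intro mult_left_mono) auto
          finally have "measure (K y) {x / (y * t)<..} \<le> B * C * f x * growth p q t * growth p q y"
            by (simp add: algebra_simps)
          moreover have "{z. x < z * y * t} = {x / (y * t)<..}"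
            using False x CD y t by (subst product_section) auto
          ultimately show ?thesis by simp
        qed (use x CD y t B fx in \<open>simp add: product_section\<close>)
      qed
    qed simp
    also have "\<dots> = B * C * f x * growth p q t * E"
      by (simp add: E_def integral_distr)
    also have "\<dots> \<le> B * C * f x * growth p q t * (E + 1)"
      using B CD fx by (intro mult_left_mono) auto
    finally show ?thesis by (simp add: mult_ac)
  qed
  moreover have "0 < B * C * (E + 1)" using B CD E by simp
  ultimately show ?thesis using CD by blast
qed

text \<open>Already the event that \<open>Y\<close> exceeds some \<open>y0 > 0\<close> suffices: given \<open>Y = y\<close>, the ratio of the conditional
  tail to \<open>f\<close> changes at most by a constant factor beyond \<open>D\<close>, so \<open>P(X > z, Y > y0)\<close> is at least a fixed fraction of
  \<open>P(X > D, Y > y0) * f z\<close>, and this probability is positive because \<open>h\<close> is. Comparing with the value at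
  \<open>D\<close> instead of integrating \<open>h\<close> avoids the question whether \<open>h\<close> is measurable.\<close>

lemma product_tail_ge:
  assumes pot: "\<exists>C>0. \<exists>D>0. \<forall>x\<ge>D. \<forall>t>0. f (x / t) \<le> C * f x * growth p q t"
  shows "\<exists>c>0. \<forall>\<^sub>F x in at_top. c * f x \<le> product_tail M X Y x 1"
proof -
  obtain C D1 where CD: "0 < C" "0 < D1" and pot': "\<And>x t. D1 \<le> x \<Longrightarrow> 0 < t \<Longrightarrow> f (x / t) \<le> C * f x * growth p q t"
    using pot by blast
  obtain D where D: "0 \<le> D" and cmp: "\<And>z y. D \<le> z \<Longrightarrow> y \<in> S \<Longrightarrow>
      (1 - 1/2) * (h y * f z) \<le> measure (K y) {z<..} \<and> measure (K y) {z<..} \<le> (1 + 1/2) * (h y * f z)"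
    using conditional_tail_comparable[of "1/2"] by auto
  have "\<exists>n::nat. 0 < prob {\<omega> \<in> space M. 1 / real (Suc n) < Y \<omega>}"
  proof (rule ccontr)
    assume "\<not> ?thesis"
    then have "prob {\<omega> \<in> space M. 1 / real (Suc n) < Y \<omega>} = 0" for n
      using measure_nonneg[of M] by (metis less_le)
    then have "AE \<omega> in M. \<omega> \<notin> {\<omega> \<in> space M. 1 / real (Suc n) < Y \<omega>}" for n
      by (subst prob_eq_0[symmetric]) auto
    then have "AE \<omega> in M. \<forall>n. \<omega> \<notin> {\<omega> \<in> space M. 1 / real (Suc n) < Y \<omega>}"
      by (simp add: AE_all_countable)
    then have "AE \<omega> in M. \<omega> \<notin> {\<omega> \<in> space M. 0 < Y \<omega>}"
    proof eventually_elim
      case (elim \<omega>)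
      then show ?case
        using reals_Archimedean[of "Y \<omega>"] by (auto simp: divide_inverse)
    qed
    then have "prob {\<omega> \<in> space M. 0 < Y \<omega>} = 0" by (subst prob_eq_0) auto
    then show False using Y_pos by simp
  qed
  then obtain n :: nat where n: "0 < prob {\<omega> \<in> space M. 1 / real (Suc n) < Y \<omega>}" by blast
  define y0 where "y0 = 1 / real (Suc n)"
  have y0: "0 < y0" "0 < prob {\<omega> \<in> space M. y0 < Y \<omega>}" using n by (auto simp: y0_def)
  have rect: "prob {\<omega> \<in> space M. z < X \<omega> \<and> y0 < Y \<omega>}
      = (\<integral>y. indicator {y0<..} y * measure (K y) {z<..} \<partial>distr M borel Y)"
    and rect_int: "integrable (distr M borel Y) (\<lambda>y. indicator {y0<..} y * measure (K y) {z<..})" for z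
  proof -
    have "{x. (x, y) \<in> {z<..} \<times> {y0<..}} = (if y0 < y then {z<..} else {})" for y by auto
    then have *: "measure (K y) {x. (x, y) \<in> {z<..} \<times> {y0<..}} = indicator {y0<..} y * measure (K y) {z<..}" for y
      by simp
    have A: "{z<..} \<times> {y0<..} \<in> sets (borel \<Otimes>\<^sub>M borel)" by simp
    show "prob {\<omega> \<in> space M. z < X \<omega> \<and> y0 < Y \<omega>}
      = (\<integral>y. indicator {y0<..} y * measure (K y) {z<..} \<partial>distr M borel Y)"
      using prob_disintegrate[OF A] unfolding * by simp
    show "integrable (distr M borel Y) (\<lambda>y. indicator {y0<..} y * measure (K y) {z<..})"
      using integrable_K_section[OF A] unfolding * .
  qed
  define c0 where "c0 = prob {\<omega> \<in> space M. D < X \<omega> \<and> y0 < Y \<omega>}"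
  have fD: "0 < f D" using D by (rule f_pos)
  have "0 < c0"
  proof (rule ccontr)
    assume "\<not> 0 < c0"
    then have "(\<integral>y. indicator {y0<..} y * measure (K y) {D<..} \<partial>distr M borel Y) = 0"
      unfolding c0_def rect using integral_nonneg_AE[of "\<lambda>y. indicator {y0<..} y * measure (K y) {D<..}" "distr M borel Y"]
      by (simp add: not_less order_antisym)
    then have "AE y in distr M borel Y. indicator {y0<..} y * measure (K y) {D<..} = 0"
      by (subst (asm) integral_nonneg_eq_0_iff_AE[OF rect_int]) auto
    then have "AE y in distr M borel Y. y \<le> y0"
      using AE_support
    proof eventually_elim
      case (elim y)
      have "0 < h y * f D" using h_pos[OF support_nonneg[OF elim(2)]] fD by simp
      then have "0 < measure (K y) {D<..}" using cmp[OF _ elim(2), of D] by simp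
      then show ?case using elim(1) by (auto split: split_indicator_asm)
    qed
    then have "AE \<omega> in M. Y \<omega> \<le> y0" by (subst (asm) AE_distr_iff) auto
    then have "prob {\<omega> \<in> space M. y0 < Y \<omega>} = 0"
      by (subst prob_eq_0) (auto elim!: AE_mp)
    then show False using y0 by simp
  qed
  have lower: "c0 / 3 * f z \<le> prob {\<omega> \<in> space M. z < X \<omega> \<and> y0 < Y \<omega>}" if z: "D \<le> z" for z
  proof -
    have "c0 / 3 * f z = (\<integral>y. f z / 3 * (indicator {y0<..} y * measure (K y) {D<..}) \<partial>distr M borel Y)"
      by (subst integral_mult_right_zero) (simp add: c0_def rect)
    also have "\<dots> \<le> (\<integral>y. indicator {y0<..} y * measure (K y) {z<..} \<partial>distr M borel Y)"
    proof (rule integral_mono_AE)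
      show "AE y in distr M borel Y. f z / 3 * (indicator {y0<..} y * measure (K y) {D<..})
          \<le> indicator {y0<..} y * measure (K y) {z<..}"
        using AE_support
      proof eventually_elim
        case (elim y)
        have hy: "0 < h y" using h_pos[OF support_nonneg[OF elim]] .
        have fz: "0 < f z" using z D by (intro f_pos) simp
        have "measure (K y) {D<..} \<le> 3/2 * (h y * f D)" using cmp[OF _ elim, of D] by simp
        also have "\<dots> \<le> 3/2 * (h y * 1)" using hy f_le_1[of D] by (intro mult_left_mono) auto
        finally have "f z / 3 * measure (K y) {D<..} \<le> f z / 3 * (3/2 * h y)"
          using fz by (intro mult_left_mono) auto
        also have "\<dots> \<le> measure (K y) {z<..}" using cmp[OF z elim] by (simp add: mult_ac)
        finally show ?case by (simp split: split_indicator)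
      qed
    qed (use rect_int in \<open>auto intro!: integrable_mult_right simp del: mult_eq_0_iff\<close>)
    finally show ?thesis by (simp add: rect)
  qed
  define g where "g = C * growth p q (1 / y0)"
  have "0 < growth p q (1 / y0)" using y0 by (simp add: growth_def less_max_iff_disj)
  then have g: "0 < g" using CD by (simp add: g_def)
  have "\<forall>\<^sub>F x in at_top. c0 / (3 * g) * f x \<le> product_tail M X Y x 1"
    using eventually_ge_at_top[of "D * y0"] eventually_ge_at_top[of "D1 * y0"] eventually_ge_at_top[of 0]
  proof eventually_elim
    case (elim x)
    have x: "D \<le> x / y0" "D1 \<le> x / y0" using elim y0 by (simp_all add: pos_le_divide_eq)
    have "f x = f (x / y0 / (1 / y0))" using y0 by simp
    also have "\<dots> \<le> C * f (x / y0) * growth p q (1 / y0)" using x y0 by (intro pot') auto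
    finally have "f x \<le> g * f (x / y0)" by (simp add: g_def mult_ac)
    then have "c0 / (3 * g) * f x \<le> c0 / (3 * g) * (g * f (x / y0))"
      using \<open>0 < c0\<close> g by (intro mult_left_mono) auto
    also have "\<dots> = c0 / 3 * f (x / y0)" using g by simp
    also have "\<dots> \<le> prob {\<omega> \<in> space M. x / y0 < X \<omega> \<and> y0 < Y \<omega>}" by (rule lower) fact
    also have "\<dots> \<le> product_tail M X Y x 1"
      unfolding product_tail_def
    proof (intro finite_measure_mono subsetI, goal_cases)
      case (1 \<omega>)
      then have *: "x / y0 < X \<omega>" "y0 < Y \<omega>" "\<omega> \<in> space M" by auto
      have "x = x / y0 * y0" using y0 by simp
      also have "\<dots> < X \<omega> * y0" using * y0 by (intro mult_strict_right_mono) auto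
      also have "\<dots> \<le> X \<omega> * Y \<omega>"
        using * y0 elim order_trans[of 0 "x / y0" "X \<omega>"] by (intro mult_left_mono) auto
      finally show ?case using * by simp
    qed simp
    finally show ?case .
  qed
  then show ?thesis using \<open>0 < c0\<close> g by (intro exI[of _ "c0 / (3 * g)"]) auto
qed

text \<open>Consistent variation is inherited from the conditional tails as long as \<open>x / y\<close> is large; the remaining
  values \<open>y > x / D\<close> contribute at most \<open>P(Y > x / D)\<close>, which is negligible by \<open>negl\<close>.\<close>

lemma product_tail_consistently_varying:
  assumes cons: "\<And>e. 0 < e \<Longrightarrow> \<exists>v>1. \<forall>\<^sub>F x in at_top. f x \<le> (1 + e) * f (v * x)"
    and negl: "\<And>c. 0 < c \<Longrightarrow> (\<lambda>x. prob {\<omega> \<in> space M. c * x < Y \<omega>}) \<in> o(\<lambda>x. product_tail M X Y x 1)"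
    and "0 < e"
  shows "\<exists>v>1. \<forall>\<^sub>F x in at_top. product_tail M X Y x 1 \<le> (1 + e) * product_tail M X Y (v * x) 1"
proof -
  obtain v D where v: "1 < v" and D: "0 < D"
    and K_cons: "\<And>z y. D \<le> z \<Longrightarrow> y \<in> S \<Longrightarrow> measure (K y) {z<..} \<le> (1 + e / 2) * measure (K y) {v * z<..}"
    using conditional_tail_consistently_varying[OF cons, of "e / 2"] \<open>0 < e\<close> by auto
  \<comment> \<open>\<open>Y > x / D\<close> is \<open>Y > c * (v * x)\<close>, to be compared with the tail at \<open>v * x\<close>\<close>
  define c where "c = 1 / (D * v)"
  have "0 < c" using D v by (simp add: c_def)
  then have "\<forall>\<^sub>F x in at_top. norm (prob {\<omega> \<in> space M. c * x < Y \<omega>}) \<le> e / 2 * norm (product_tail M X Y x 1)"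
    using \<open>0 < e\<close> by (intro landau_o.smallD[OF negl]) auto
  moreover have "filterlim (\<lambda>x. v * x) at_top at_top"
    by (rule filterlim_tendsto_pos_mult_at_top[OF tendsto_const _ filterlim_ident]) (use v in auto)
  ultimately have "\<forall>\<^sub>F x in at_top. norm (prob {\<omega> \<in> space M. c * (v * x) < Y \<omega>})
      \<le> e / 2 * norm (product_tail M X Y (v * x) 1)"
    by (rule eventually_compose_filterlim)
  then have "\<forall>\<^sub>F x in at_top. product_tail M X Y x 1 \<le> (1 + e) * product_tail M X Y (v * x) 1"
    using eventually_ge_at_top[of 0]
  proof eventually_elim
    case (elim x)
    have cv: "c * (v * x) = x / D" using v D by (simp add: c_def field_simps)
    have ind: "integrable (distr M borel Y) (indicator {x / D<..} :: real \<Rightarrow> real)"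
      by (simp add: emeasure_distr emeasure_eq_measure)
    have "product_tail M X Y x 1 \<le>
        (\<integral>y. (1 + e / 2) * measure (K y) {z. v * x < z * y * 1} + indicator {x / D<..} y \<partial>distr M borel Y)"
      unfolding product_tail_disintegrate
    proof (rule integral_mono_AE)
      show "integrable (distr M borel Y) (\<lambda>y. (1 + e / 2) * measure (K y) {z. v * x < z * y * 1} + indicator {x / D<..} y)"
        by (intro Bochner_Integration.integrable_add integrable_mult_right integrable_product_section ind)
      show "AE y in distr M borel Y. measure (K y) {z. x < z * y * 1}
          \<le> (1 + e / 2) * measure (K y) {z. v * x < z * y * 1} + indicator {x / D<..} y"
        using AE_support
      proof eventually_elim
        case y: (elim y)
        have y0: "0 \<le> y" using support_nonneg y .
        consider "y = 0" | "0 < y" "y \<le> x / D" | "x / D < y" using y0 by linarith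
        then show ?case
        proof cases
          case 2
          then have "D \<le> x / y" using D by (simp add: field_simps)
          then have "measure (K y) {x / y<..} \<le> (1 + e / 2) * measure (K y) {v * (x / y)<..}"
            using y by (rule K_cons)
          then show ?thesis using 2 elim v product_section[of x y 1] product_section[of "v * x" y 1] by simp
        next
          case 3
          have "measure (K y) {z. x < z * y * 1} \<le> 1" by (rule K_le_1)
          also have "\<dots> \<le> (1 + e / 2) * measure (K y) {z. v * x < z * y * 1} + 1"
            using \<open>0 < e\<close> by simp
          finally show ?thesis using 3 by simp
        qed (use elim \<open>0 < e\<close> in simp)
      qed
    qed (rule integrable_product_section)
    also have "\<dots> = (1 + e / 2) * product_tail M X Y (v * x) 1 + measure (distr M borel Y) {x / D<..}"
      unfolding product_tail_disintegrate
      by (subst Bochner_Integration.integral_add) (auto intro!: integrable_mult_right integrable_product_section ind simp del: mult_1_right)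
    also have "measure (distr M borel Y) {x / D<..} = prob {\<omega> \<in> space M. x / D < Y \<omega>}"
      by (simp add: measure_distr vimage_def Int_def conj_commute)
    also have "\<dots> \<le> e / 2 * product_tail M X Y (v * x) 1"
      using elim unfolding cv by (simp add: product_tail_def)
    finally show ?case by (simp add: algebra_simps)
  qed
  then show ?thesis using v by blast
qed

end

section \<open>Independent discounted losses\<close>

text \<open>Fubini for the independent pair \<open>(V, Z)\<close>. Both variables have values of the same type, as
  \<^const>\<open>prob_space.indep_var\<close> demands; the functions \<open>z\<close> and \<open>s\<close> extract real numbers from them.\<close>

lemma (in prob_space) prob_indep_scaled:
  fixes z s :: "_ \<Rightarrow> real"
  assumes ind: "indep_var N V L Z"
    and A [measurable]: "A \<in> sets N" and s [measurable]: "s \<in> borel_measurable N"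
    and z [measurable]: "z \<in> borel_measurable L"
  shows "prob {\<omega> \<in> space M. V \<omega> \<in> A \<and> x < z (Z \<omega>) * s (V \<omega>)}
       = (\<integral>\<omega>. indicator A (V \<omega>) * prob {\<omega>' \<in> space M. x < z (Z \<omega>') * s (V \<omega>)} \<partial>M)"
proof -
  have V [measurable]: "V \<in> measurable M N" and Z [measurable]: "Z \<in> measurable M L"
    using ind by (auto dest: indep_var_rv1 indep_var_rv2)
  define Q where "Q = distr M L Z"
  interpret Q: prob_space Q unfolding Q_def by (rule prob_space_distr) simp
  define B where "B = {w \<in> space (N \<Otimes>\<^sub>M L). fst w \<in> A \<and> x < z (snd w) * s (fst w)}"
  have B [measurable]: "B \<in> sets (N \<Otimes>\<^sub>M L)" unfolding B_def by measurable
  have BQ: "B \<in> sets (N \<Otimes>\<^sub>M Q)" using B by (simp add: Q_def cong: sets_pair_measure_cong)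
  have joint: "distr M N V \<Otimes>\<^sub>M Q = distr M (N \<Otimes>\<^sub>M L) (\<lambda>\<omega>. (V \<omega>, Z \<omega>))"
    using ind unfolding indep_var_distribution_eq Q_def by blast
  have sect: "emeasure Q (Pair a -` B) = ennreal (indicator A a * prob {\<omega>' \<in> space M. x < z (Z \<omega>') * s a})"
    if "a \<in> space N" for a
  proof -
    have "Pair a -` B \<in> sets L" using sets_Pair1[OF B] .
    then have "emeasure Q (Pair a -` B) = prob (Z -` (Pair a -` B) \<inter> space M)"
      by (simp add: Q_def emeasure_distr emeasure_eq_measure)
    also have "Z -` (Pair a -` B) \<inter> space M = (if a \<in> A then {\<omega>' \<in> space M. x < z (Z \<omega>') * s a} else {})"
      using that measurable_space[OF Z] by (auto simp: B_def space_pair_measure)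
    finally show ?thesis by auto
  qed
  have meas: "(\<lambda>a. emeasure Q (Pair a -` B)) \<in> borel_measurable N"
    using Q.measurable_emeasure_Pair[OF BQ] .
  then have "(\<lambda>a. enn2real (emeasure Q (Pair a -` B))) \<in> borel_measurable N"
    by measurable
  then have meas': "(\<lambda>a. indicator A a * prob {\<omega>' \<in> space M. x < z (Z \<omega>') * s a}) \<in> borel_measurable N"
    by (rule measurable_cong[THEN iffD1, rotated]) (simp add: sect)
  have "ennreal (prob {\<omega> \<in> space M. V \<omega> \<in> A \<and> x < z (Z \<omega>) * s (V \<omega>)})
      = emeasure (distr M (N \<Otimes>\<^sub>M L) (\<lambda>\<omega>. (V \<omega>, Z \<omega>))) B"
    unfolding emeasure_eq_measure[symmetric]
    using measurable_space[OF V] measurable_space[OF Z]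
    by (subst emeasure_distr) (auto simp: B_def space_pair_measure intro!: arg_cong[where f="emeasure M"])
  also have "\<dots> = (\<integral>\<^sup>+a. emeasure Q (Pair a -` B) \<partial>distr M N V)"
    unfolding joint[symmetric]
    using BQ by (subst Q.emeasure_pair_measure_alt) (simp_all cong: sets_pair_measure_cong)
  also have "\<dots> = (\<integral>\<^sup>+\<omega>. emeasure Q (Pair (V \<omega>) -` B) \<partial>M)"
    using meas by (subst nn_integral_distr) auto
  also have "\<dots> = (\<integral>\<^sup>+\<omega>. ennreal (indicator A (V \<omega>) * prob {\<omega>' \<in> space M. x < z (Z \<omega>') * s (V \<omega>)}) \<partial>M)"
    using measurable_space[OF V] by (intro nn_integral_cong) (simp add: sect)
  also have "\<dots> = ennreal (\<integral>\<omega>. indicator A (V \<omega>) * prob {\<omega>' \<in> space M. x < z (Z \<omega>') * s (V \<omega>)} \<partial>M)"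
    using measurable_compose[OF V meas']
    by (intro nn_integral_eq_integral integrable_const_bound[where B=1])
       (auto split: split_indicator)
  finally show ?thesis
    by (subst (asm) ennreal_inj) (auto intro: integral_nonneg_AE)
qed

text \<open>The deterministic core of the upper bound. If at most one of the first \<open>N\<close> terms exceeds \<open>c * x\<close>, then
  all others together contribute at most \<open>(1 - 1 / v) / 2 * x\<close>; the same amount is granted to the terms
  after \<open>N\<close>, which leaves \<open>x / v\<close> for the largest one.\<close>

lemma sum_positive_parts_greater:
  fixes u :: "nat \<Rightarrow> real"
  assumes "0 < x" "1 < v" and c: "c = (1 - 1 / v) / 2 / real (Suc N)"
    and gr: "x < (\<Sum>i=1..n. max 0 (u i))"
  shows "(\<exists>i\<in>{1..min n N}. x / v < u i) \<or> (\<exists>i\<in>{1..N}. \<exists>j\<in>{1..N}. i < j \<and> c * x < u i \<and> c * x < u j)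
       \<or> (1 - 1 / v) / 2 * x < (\<Sum>i\<in>{N<..n}. max 0 (u i))" (is "?P \<or> ?Q \<or> ?R")
proof (rule ccontr)
  assume "\<not> ?thesis"
  then have nP: "\<not> ?P" and nQ: "\<not> ?Q" and nR: "\<not> ?R"
    unfolding de_Morgan_disj by - (elim conjE, assumption)+
  have single: "u i \<le> x / v" if "i \<in> {1..min n N}" for i
    using nP that by (meson not_le)
  have pair: "u i \<le> c * x \<or> u j \<le> c * x" if "i \<in> {1..N}" "j \<in> {1..N}" "i < j" for i j
    using nQ that by (meson not_le)
  have rest: "(\<Sum>i\<in>{N<..n}. max 0 (u i)) \<le> (1 - 1 / v) / 2 * x"
    using nR by (simp only: not_less)
  have v: "1 / v < 1" using \<open>1 < v\<close> by simp
  have cx: "0 \<le> c * x" using v \<open>0 < x\<close> by (simp add: c)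
  have Nc: "real m * (c * x) \<le> (1 - 1 / v) / 2 * x" if "m \<le> N" for m
  proof -
    have "real m * (c * x) \<le> real (Suc N) * (c * x)" using that cx by (intro mult_right_mono) auto
    also have "\<dots> = real (Suc N) * c * x" by simp
    also have "real (Suc N) * c = (1 - 1 / v) / 2"
      unfolding c by (subst times_divide_eq_right, rule nonzero_mult_div_cancel_left) simp
    finally show ?thesis .
  qed
  have "(\<Sum>i=1..min n N. max 0 (u i)) \<le> x / v + (1 - 1 / v) / 2 * x"
  proof (cases "\<exists>i\<in>{1..min n N}. c * x < u i")
    case True
    then obtain k where k: "k \<in> {1..min n N}" "c * x < u k" by blast
    have "u i \<le> c * x" if "i \<in> {1..min n N} - {k}" for i
      using that k pair[of i k] pair[of k i] by (cases "i < k") auto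
    then have "(\<Sum>i\<in>{1..min n N} - {k}. max 0 (u i)) \<le> real (card ({1..min n N} - {k})) * (c * x)"
      using cx by (intro sum_bounded_above) auto
    also have "\<dots> \<le> (1 - 1 / v) / 2 * x" using k by (intro Nc) simp
    finally have "(\<Sum>i\<in>{1..min n N} - {k}. max 0 (u i)) \<le> (1 - 1 / v) / 2 * x" .
    moreover have "max 0 (u k) \<le> x / v" using single[OF k(1)] \<open>0 < x\<close> \<open>1 < v\<close> by simp
    moreover have "(\<Sum>i=1..min n N. max 0 (u i)) = max 0 (u k) + (\<Sum>i\<in>{1..min n N} - {k}. max 0 (u i))"
      using k by (intro sum.remove) auto
    ultimately show ?thesis by linarith
  next
    case False
    then have "(\<Sum>i=1..min n N. max 0 (u i)) \<le> real (card {1..min n N}) * (c * x)"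
      using cx by (intro sum_bounded_above) (auto simp: not_less)
    also have "\<dots> \<le> (1 - 1 / v) / 2 * x" by (intro Nc) simp
    finally show ?thesis using \<open>0 < x\<close> \<open>1 < v\<close> by (simp add: add_increasing)
  qed
  moreover have "(\<Sum>i=1..n. max 0 (u i)) = (\<Sum>i=1..min n N. max 0 (u i)) + (\<Sum>i\<in>{N<..n}. max 0 (u i))"
  proof -
    have "{1..n} = {1..min n N} \<union> {N<..n}" by auto
    then show ?thesis by (simp only:) (rule sum.union_disjoint, auto)
  qed
  ultimately have "(\<Sum>i=1..n. max 0 (u i)) \<le> x / v + (1 - 1 / v) / 2 * x + (1 - 1 / v) / 2 * x"
    using rest by linarith
  also have "\<dots> = x" by (simp add: field_simps)
  finally show False using gr by simp
qed

text \<open>From here on the distribution of \<open>(X, Y)\<close> enters only through the two tail estimates and the moment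
  condition for the exponents \<open>p\<close> and \<open>q\<close>.\<close>

locale discounted_losses = prob_space M for M :: "'a measure" +
  fixes X Y :: "'a \<Rightarrow> real" and Xs Ys :: "nat \<Rightarrow> 'a \<Rightarrow> real" and p q :: real
  assumes X_meas [measurable]: "X \<in> borel_measurable M"
    and Y_meas [measurable]: "Y \<in> borel_measurable M"
    and indep: "indep_vars (\<lambda>_. borel \<Otimes>\<^sub>M borel) (\<lambda>i \<omega>. (Xs i \<omega>, Ys i \<omega>)) {1..}"
    and copies: "\<And>i. 1 \<le> i \<Longrightarrow> distr M (borel \<Otimes>\<^sub>M borel) (\<lambda>\<omega>. (Xs i \<omega>, Ys i \<omega>))
        = distr M (borel \<Otimes>\<^sub>M borel) (\<lambda>\<omega>. (X \<omega>, Y \<omega>))"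
    and Y_nonneg: "AE \<omega> in M. 0 \<le> Y \<omega>"
    and p_pos: "0 < p" and q_le_p: "q \<le> p"
    and growth_integrable: "integrable M (\<lambda>\<omega>. growth p q (Y \<omega>))"
    and tail_pos: "\<And>x. 0 \<le> x \<Longrightarrow> 0 < product_tail M X Y x 1"
    and tail_growth: "\<exists>C>0. \<exists>D>0. \<forall>x\<ge>D. \<forall>t\<ge>0.
        product_tail M X Y x t \<le> C * product_tail M X Y x 1 * growth p q t"
    and tail_consistently_varying: "\<And>e. 0 < e \<Longrightarrow> \<exists>v>1. \<forall>\<^sub>F x in at_top.
        product_tail M X Y x 1 \<le> (1 + e) * product_tail M X Y (v * x) 1"
begin

abbreviation "\<Theta> \<equiv> disc_factor Ys"
abbreviation "T \<equiv> disc_loss_tail M Xs Ys"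
abbreviation "J \<equiv> product_tail M X Y"
abbreviation "pair_space \<equiv> (borel :: real measure) \<Otimes>\<^sub>M (borel :: real measure)"

definition disc_loss :: "nat \<Rightarrow> 'a \<Rightarrow> real" where
  "disc_loss i \<omega> = Xs i \<omega> * \<Theta> i \<omega>"

definition past :: "nat \<Rightarrow> 'a \<Rightarrow> nat \<Rightarrow> real \<times> real" where
  "past n \<omega> = restrict (\<lambda>i. (Xs i \<omega>, Ys i \<omega>)) {1..n}"

lemma pair_measurable: "1 \<le> i \<Longrightarrow> (\<lambda>\<omega>. (Xs i \<omega>, Ys i \<omega>)) \<in> measurable M pair_space"
  using indep unfolding indep_vars_def by auto

lemma Xs_measurable [measurable]: "1 \<le> i \<Longrightarrow> Xs i \<in> borel_measurable M"
  using measurable_compose[OF pair_measurable measurable_fst] by simp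

lemma Ys_measurable [measurable]: "1 \<le> i \<Longrightarrow> Ys i \<in> borel_measurable M"
  using measurable_compose[OF pair_measurable measurable_snd] by simp

lemma disc_factor_measurable [measurable]: "\<Theta> n \<in> borel_measurable M"
  unfolding disc_factor_def[abs_def] by (intro borel_measurable_prod) auto

lemma disc_loss_measurable [measurable]: "1 \<le> i \<Longrightarrow> disc_loss i \<in> borel_measurable M"
  unfolding disc_loss_def[abs_def] by measurable

lemma disc_sum_eq: "disc_sum Xs Ys n \<omega> = (\<Sum>i=1..n. disc_loss i \<omega>)"
  by (simp add: disc_sum_def disc_loss_def)

lemma T_eq_prob: "T i x = prob {\<omega> \<in> space M. x < disc_loss i \<omega>}"
  by (simp add: disc_loss_tail_def disc_loss_def)

lemma disc_loss_Suc: "disc_loss (Suc n) \<omega> = Xs (Suc n) \<omega> * Ys (Suc n) \<omega> * \<Theta> n \<omega>"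
  by (simp add: disc_loss_def disc_factor_def mult_ac)

lemma prob_copy:
  assumes i: "1 \<le> i" and [measurable]: "Measurable.pred pair_space P"
  shows "prob {\<omega> \<in> space M. P (Xs i \<omega>, Ys i \<omega>)} = prob {\<omega> \<in> space M. P (X \<omega>, Y \<omega>)}"
proof -
  have P: "{w \<in> space pair_space. P w} \<in> sets pair_space" by measurable
  have "prob {\<omega> \<in> space M. P (Xs i \<omega>, Ys i \<omega>)}
      = measure (distr M pair_space (\<lambda>\<omega>. (Xs i \<omega>, Ys i \<omega>))) {w \<in> space pair_space. P w}"
    using pair_measurable[OF i] P
    by (subst measure_distr) (auto simp: space_pair_measure intro!: arg_cong[where f=prob])
  also have "\<dots> = measure (distr M pair_space (\<lambda>\<omega>. (X \<omega>, Y \<omega>))) {w \<in> space pair_space. P w}"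
    by (simp only: copies[OF i])
  also have "\<dots> = prob {\<omega> \<in> space M. P (X \<omega>, Y \<omega>)}"
    using P by (subst measure_distr) (auto simp: space_pair_measure intro!: arg_cong[where f=prob])
  finally show ?thesis .
qed

lemma product_tail_copy: "prob {\<omega> \<in> space M. x < Xs (Suc n) \<omega> * Ys (Suc n) \<omega> * t} = J x t"
  using prob_copy[of "Suc n" "\<lambda>w. x < fst w * snd w * t"] by (simp add: product_tail_def)

lemma past_measurable: "past n \<in> measurable M (PiM {1..n} (\<lambda>_. pair_space))"
  unfolding past_def[abs_def] using pair_measurable by (intro measurable_restrict) auto

lemma prob_past_and_loss:
  assumes A: "A \<in> sets (PiM {1..n} (\<lambda>_. pair_space))"
    and s: "s \<in> borel_measurable (PiM {1..n} (\<lambda>_. pair_space))"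
  shows "prob {\<omega> \<in> space M. past n \<omega> \<in> A \<and> x < Xs (Suc n) \<omega> * Ys (Suc n) \<omega> * s (past n \<omega>)}
       = (\<integral>\<omega>. indicator A (past n \<omega>) * J x (s (past n \<omega>)) \<partial>M)"
proof -
  have ind: "indep_var (PiM {1..n} (\<lambda>_. pair_space)) (past n)
      (PiM {Suc n} (\<lambda>_. pair_space)) (\<lambda>\<omega>. restrict (\<lambda>i. (Xs i \<omega>, Ys i \<omega>)) {Suc n})"
    unfolding past_def[abs_def] by (rule indep_var_restrict[OF indep]) auto
  have z: "(\<lambda>g. fst (g (Suc n)) * snd (g (Suc n))) \<in> borel_measurable (PiM {Suc n} (\<lambda>_. pair_space))"
    by measurable
  show ?thesis
    using prob_indep_scaled[OF ind A s z, of x]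
    by (simp add: product_tail_copy)
qed

lemma disc_factor_past:
  assumes "k \<le> n"
  shows "(\<Prod>j=1..k. snd (past n \<omega> j)) = \<Theta> k \<omega>"
  unfolding disc_factor_def past_def using assms by (intro prod.cong) auto

lemma disc_factor_past_measurable [measurable]:
  assumes "k \<le> (n::nat)"
  shows "(\<lambda>g. \<Prod>j=1..k. snd (g j)) \<in> borel_measurable (PiM {1..n} (\<lambda>_. pair_space))"
proof (rule borel_measurable_prod)
  fix j assume "j \<in> {1..k}"
  then have "(\<lambda>g. g j) \<in> measurable (PiM {1..n} (\<lambda>_. pair_space)) pair_space"
    using assms by (intro measurable_component_singleton) auto
  then show "(\<lambda>g. snd (g j)) \<in> borel_measurable (PiM {1..n} (\<lambda>_. pair_space))"
    by measurable
qed

lemma T_eq_integral: "T (Suc n) x = (\<integral>\<omega>. J x (\<Theta> n \<omega>) \<partial>M)"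
  using prob_past_and_loss[OF sets.top disc_factor_past_measurable[OF order_refl], of n x]
    measurable_space[OF past_measurable, of _ n]
  by (simp add: disc_factor_past[simplified] T_eq_prob disc_loss_Suc cong: conj_cong Bochner_Integration.integral_cong)

lemma joint_eq_integral:
  assumes j: "1 \<le> j" "j \<le> n"
  shows "prob {\<omega> \<in> space M. w < \<bar>disc_loss j \<omega>\<bar> \<and> x < disc_loss (Suc n) \<omega>}
       = (\<integral>\<omega>. indicator {\<omega> \<in> space M. w < \<bar>disc_loss j \<omega>\<bar>} \<omega> * J x (\<Theta> n \<omega>) \<partial>M)"
proof -
  let ?N = "PiM {1..n} (\<lambda>_. pair_space)"
  let ?A = "{g \<in> space ?N. w < \<bar>fst (g j) * (\<Prod>k=1..j. snd (g k))\<bar>}"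
  have "(\<lambda>g. g j) \<in> measurable ?N pair_space"
    using j by (intro measurable_component_singleton) auto
  then have "(\<lambda>g. fst (g j)) \<in> borel_measurable ?N"
    by measurable
  then have A: "?A \<in> sets ?N"
    using disc_factor_past_measurable[OF j(2)] by measurable
  have "\<omega> \<in> space M \<Longrightarrow> past n \<omega> \<in> space ?N" for \<omega>
    by (rule measurable_space[OF past_measurable])
  then have mem: "past n \<omega> \<in> ?A \<longleftrightarrow> w < \<bar>disc_loss j \<omega>\<bar>" if "\<omega> \<in> space M" for \<omega>
    using that j by (simp add: disc_factor_past[simplified] disc_loss_def) (simp add: past_def)
  have "prob {\<omega> \<in> space M. w < \<bar>disc_loss j \<omega>\<bar> \<and> x < disc_loss (Suc n) \<omega>}
      = prob {\<omega> \<in> space M. past n \<omega> \<in> ?A \<and> x < Xs (Suc n) \<omega> * Ys (Suc n) \<omega> * (\<Prod>k=1..n. snd (past n \<omega> k))}"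
    using mem by (intro arg_cong[where f=prob] Collect_cong) (auto simp: disc_factor_past[simplified] disc_loss_Suc)
  also have "\<dots> = (\<integral>\<omega>. indicator ?A (past n \<omega>) * J x (\<Theta> n \<omega>) \<partial>M)"
    using prob_past_and_loss[OF A disc_factor_past_measurable[OF order_refl], of x]
    by (simp add: disc_factor_past[simplified])
  also have "\<dots> = (\<integral>\<omega>. indicator {\<omega> \<in> space M. w < \<bar>disc_loss j \<omega>\<bar>} \<omega> * J x (\<Theta> n \<omega>) \<partial>M)"
    using mem by (intro Bochner_Integration.integral_cong) (auto split: split_indicator)
  finally show ?thesis .
qed

lemma product_tail_measurable [measurable]: "J x \<in> borel_measurable borel"
proof -
  define Q where "Q = distr M borel (\<lambda>\<omega>. X \<omega> * Y \<omega>)"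
  interpret Q: prob_space Q unfolding Q_def by (rule prob_space_distr) simp
  have "{w \<in> space (borel \<Otimes>\<^sub>M borel). x < snd w * fst w} \<in> sets (borel \<Otimes>\<^sub>M (borel::real measure))"
    by measurable
  then have "{w. x < snd w * fst w} \<in> sets (borel \<Otimes>\<^sub>M Q)"
    by (simp add: Q_def space_pair_measure cong: sets_pair_measure_cong)
  from Q.measurable_emeasure_Pair[OF this]
  have "(\<lambda>t. enn2real (emeasure Q {z. x < z * t})) \<in> borel_measurable borel"
    by (simp add: vimage_def)
  moreover have "enn2real (emeasure Q {z. x < z * t}) = J x t" for t
    by (simp add: Q_def emeasure_distr emeasure_eq_measure vimage_def Int_def conj_commute product_tail_def)
  ultimately show ?thesis by simp
qed

lemma J_nonneg [simp]: "0 \<le> J x t" and J_le_1: "J x t \<le> 1"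
  by (simp_all add: product_tail_def)

lemma J_scale:
  assumes "0 < c"
  shows "J (c * x) t = J x (t / c)"
proof -
  have "c * x < z * t \<longleftrightarrow> x < z * (t / c)" for z
    using assms by (simp add: pos_less_divide_eq mult.commute)
  then show ?thesis by (simp add: product_tail_def)
qed

lemma J_antimono: "x \<le> x' \<Longrightarrow> J x' t \<le> J x t"
  unfolding product_tail_def by (intro finite_measure_mono) auto

lemma J_zero: "0 \<le> x \<Longrightarrow> J x 0 = 0"
  by (simp add: product_tail_def)

lemma integrable_J [simp]: "integrable M (\<lambda>\<omega>. J x (\<Theta> n \<omega>))"
  by (rule integrable_const_bound[where B=1]) (auto simp: J_le_1)

lemma Ys_nonneg: "1 \<le> i \<Longrightarrow> AE \<omega> in M. 0 \<le> Ys i \<omega>"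
proof -
  assume i: "1 \<le> i"
  have "prob {\<omega> \<in> space M. Ys i \<omega> < 0} = prob {\<omega> \<in> space M. Y \<omega> < 0}"
    using prob_copy[OF i, of "\<lambda>w. snd w < 0"] by simp
  also have "\<dots> = 0" using Y_nonneg by (subst prob_eq_0) (auto elim!: AE_mp)
  finally show ?thesis using i by (subst (asm) prob_eq_0) (auto elim!: AE_mp)
qed

lemma disc_factor_nonneg: "AE \<omega> in M. 0 \<le> \<Theta> n \<omega>"
proof -
  have "AE \<omega> in M. \<forall>i\<in>{1..n}. 0 \<le> Ys i \<omega>"
    using Ys_nonneg by (subst AE_ball_countable) auto
  then show ?thesis
    by eventually_elim (auto simp: disc_factor_def intro!: prod_nonneg)
qed

definition \<rho> :: real where
  "\<rho> = (\<integral>\<omega>. growth p q (Y \<omega>) \<partial>M)"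

lemma \<rho>_nonneg [simp]: "0 \<le> \<rho>"
  unfolding \<rho>_def by (intro integral_nonneg_AE) simp

lemma growth_Ys:
  assumes i: "1 \<le> i"
  shows "integrable M (\<lambda>\<omega>. growth p q (Ys i \<omega>))" "(\<integral>\<omega>. growth p q (Ys i \<omega>) \<partial>M) = \<rho>"
proof -
  let ?g = "\<lambda>w :: real \<times> real. growth p q (snd w)"
  have g [measurable]: "?g \<in> borel_measurable pair_space" by measurable
  show "integrable M (\<lambda>\<omega>. growth p q (Ys i \<omega>))"
    using integrable_distr_eq[OF pair_measurable[OF i] g] growth_integrable copies[OF i]
      integrable_distr_eq[of "\<lambda>\<omega>. (X \<omega>, Y \<omega>)" M pair_space ?g] by simp
  show "(\<integral>\<omega>. growth p q (Ys i \<omega>) \<partial>M) = \<rho>"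
    using integral_distr[OF pair_measurable[OF i] g] copies[OF i]
      integral_distr[of "\<lambda>\<omega>. (X \<omega>, Y \<omega>)" M pair_space ?g] by (simp add: \<rho>_def)
qed

lemma growth_disc_factor:
  shows "integrable M (\<lambda>\<omega>. growth p q (\<Theta> n \<omega>))" "(\<integral>\<omega>. growth p q (\<Theta> n \<omega>) \<partial>M) \<le> \<rho> ^ n"
proof -
  have "indep_vars (\<lambda>_. borel) (\<lambda>i \<omega>. growth p q (snd (Xs i \<omega>, Ys i \<omega>))) {1..}"
    by (rule indep_vars_compose2[OF indep]) measurable
  then have "indep_vars (\<lambda>_. borel) (\<lambda>i \<omega>. growth p q (Ys i \<omega>)) {1..}" by simp
  then have ind: "indep_vars (\<lambda>_. borel) (\<lambda>i \<omega>. growth p q (Ys i \<omega>)) {1..n}"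
    by (rule indep_vars_subset) auto
  have le: "growth p q (\<Theta> n \<omega>) \<le> (\<Prod>i=1..n. growth p q (Ys i \<omega>))" for \<omega>
    unfolding disc_factor_def by (rule growth_prod_le) simp
  have int: "integrable M (\<lambda>\<omega>. \<Prod>i=1..n. growth p q (Ys i \<omega>))"
    using ind growth_Ys(1) by (intro indep_vars_integrable) auto
  show *: "integrable M (\<lambda>\<omega>. growth p q (\<Theta> n \<omega>))"
    by (rule Bochner_Integration.integrable_bound[OF int]) (auto intro!: AE_I2 order_trans[OF le])
  have "(\<integral>\<omega>. growth p q (\<Theta> n \<omega>) \<partial>M) \<le> (\<integral>\<omega>. (\<Prod>i=1..n. growth p q (Ys i \<omega>)) \<partial>M)"
    using * int le by (intro integral_mono) auto
  also have "\<dots> = (\<Prod>i=1..n. (\<integral>\<omega>. growth p q (Ys i \<omega>) \<partial>M))"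
    using ind growth_Ys(1) by (intro indep_vars_lebesgue_integral) auto
  also have "\<dots> = \<rho> ^ n" using growth_Ys(2) by simp
  finally show "(\<integral>\<omega>. growth p q (\<Theta> n \<omega>) \<partial>M) \<le> \<rho> ^ n" .
qed

text \<open>Dominated convergence: \<open>growth p q (\<Theta> n)\<close> is integrable, and the events shrink to the empty set.\<close>

lemma growth_truncated_tendsto_0:
  fixes W :: "'a \<Rightarrow> real"
  assumes [measurable]: "W \<in> borel_measurable M" and "0 < c"
  shows "((\<lambda>x. \<integral>\<omega>. indicator {\<omega> \<in> space M. c * x < W \<omega>} \<omega> * growth p q (\<Theta> n \<omega>) \<partial>M) \<longlongrightarrow> 0) at_top"
proof -
  have "((\<lambda>x. \<integral>\<omega>. indicator {\<omega> \<in> space M. c * x < W \<omega>} \<omega> * growth p q (\<Theta> n \<omega>) \<partial>M) \<longlongrightarrow> (\<integral>\<omega>. 0 \<partial>M)) at_top"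
  proof (rule integral_dominated_convergence_at_top[where w="\<lambda>\<omega>. growth p q (\<Theta> n \<omega>)" and M=M
        and s="\<lambda>x \<omega>. indicator {\<omega> \<in> space M. c * x < W \<omega>} \<omega> * growth p q (\<Theta> n \<omega>)" and f="\<lambda>\<omega>. 0"])
    show "\<forall>\<^sub>F x in at_top. AE \<omega> in M. norm (indicator {\<omega> \<in> space M. c * x < W \<omega>} \<omega> * growth p q (\<Theta> n \<omega>)) \<le> growth p q (\<Theta> n \<omega>)"
      by (auto split: split_indicator)
    show "AE \<omega> in M. ((\<lambda>x. indicator {\<omega> \<in> space M. c * x < W \<omega>} \<omega> * growth p q (\<Theta> n \<omega>)) \<longlongrightarrow> 0) at_top"
    proof (intro AE_I2 tendsto_eventually)
      fix \<omega>
      show "\<forall>\<^sub>F x in at_top. indicator {\<omega> \<in> space M. c * x < W \<omega>} \<omega> * growth p q (\<Theta> n \<omega>) = 0"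
        using eventually_ge_at_top[of "W \<omega> / c"]
        by eventually_elim (use \<open>0 < c\<close> in \<open>auto simp: field_simps split: split_indicator\<close>)
    qed
  qed (use growth_disc_factor(1) in auto)
  then show ?thesis by simp
qed

end

section \<open>Ruin over a finite horizon\<close>

lemma small_share:
  fixes e :: real
  assumes "0 < e"
  shows "\<exists>k>0. real N * k \<le> e \<and> real N * (real N * k) \<le> e"
proof -
  define k where "k = e / (real (Suc N) * real (Suc N))"
  have k: "0 < k" using assms by (simp add: k_def)
  have Sk: "real (Suc N) * (real (Suc N) * k) = e" by (simp add: k_def field_simps del: of_nat_Suc)
  have "real N * (real N * k) \<le> real (Suc N) * (real (Suc N) * k)"
    using k by (intro mult_mono) auto
  moreover have "real N * k \<le> real (Suc N) * (real (Suc N) * k)"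
    using k by (intro mult_mono) auto
  ultimately show ?thesis using k unfolding Sk by blast
qed

context discounted_losses
begin

text \<open>Given the past, the new loss exceeds \<open>c * x\<close> with probability \<open>J (c * x) (\<Theta> n)\<close>, which is at most a multiple
  of \<open>J x 1 * growth p q (\<Theta> n)\<close>. Integrated over the event that the earlier loss is large, this is
  \<open>o(J x 1)\<close>. The absolute value is what the lower bound
  for the ruin probability uses: an earlier large gain could offset a later large loss.\<close>

lemma joint_tail_negligible:
  assumes j: "1 \<le> j" "j \<le> n" and "0 < c" "0 < e"
  shows "\<forall>\<^sub>F x in at_top. prob {\<omega> \<in> space M. c * x < \<bar>disc_loss j \<omega>\<bar> \<and> c * x < disc_loss (Suc n) \<omega>} \<le> e * J x 1"
proof -
  obtain C D where C: "0 < C" "0 < D" and CD: "\<And>x t. D \<le> x \<Longrightarrow> 0 \<le> t \<Longrightarrow> J x t \<le> C * J x 1 * growth p q t"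
    using tail_growth by blast
  define g where "g = C * growth p q (1 / c) + 1"
  have g: "0 < g" unfolding g_def using C by (intro add_nonneg_pos mult_nonneg_nonneg) auto
  let ?I = "\<lambda>x. \<integral>\<omega>. indicator {\<omega> \<in> space M. c * x < \<bar>disc_loss j \<omega>\<bar>} \<omega> * growth p q (\<Theta> n \<omega>) \<partial>M"
  have "(?I \<longlongrightarrow> 0) at_top"
    using j \<open>0 < c\<close> by (intro growth_truncated_tendsto_0) auto
  then have "\<forall>\<^sub>F x in at_top. ?I x < e / g"
    by (rule order_tendstoD) (use \<open>0 < e\<close> g in simp)
  then show ?thesis
    using eventually_ge_at_top[of D] eventually_ge_at_top[of 0]
  proof eventually_elim
    case (elim x)
    have W: "{\<omega> \<in> space M. c * x < \<bar>disc_loss j \<omega>\<bar>} \<in> sets M"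
      using j by measurable
    have int: "integrable M (\<lambda>\<omega>. indicator {\<omega> \<in> space M. c * x < \<bar>disc_loss j \<omega>\<bar>} \<omega> * growth p q (\<Theta> n \<omega>))"
      using integrable_real_mult_indicator[OF W growth_disc_factor(1)[of n]] by (simp add: mult.commute)
    have "prob {\<omega> \<in> space M. c * x < \<bar>disc_loss j \<omega>\<bar> \<and> c * x < disc_loss (Suc n) \<omega>}
        = (\<integral>\<omega>. indicator {\<omega> \<in> space M. c * x < \<bar>disc_loss j \<omega>\<bar>} \<omega> * J (c * x) (\<Theta> n \<omega>) \<partial>M)"
      by (rule joint_eq_integral[OF j])
    also have "\<dots> \<le> (\<integral>\<omega>. g * J x 1 * (indicator {\<omega> \<in> space M. c * x < \<bar>disc_loss j \<omega>\<bar>} \<omega> * growth p q (\<Theta> n \<omega>)) \<partial>M)"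
    proof (rule integral_mono_AE)
      show "integrable M (\<lambda>\<omega>. indicator {\<omega> \<in> space M. c * x < \<bar>disc_loss j \<omega>\<bar>} \<omega> * J (c * x) (\<Theta> n \<omega>))"
        using W by (intro integrable_const_bound[where B=1]) (auto simp: J_le_1 split: split_indicator)
      show "integrable M (\<lambda>\<omega>. g * J x 1 * (indicator {\<omega> \<in> space M. c * x < \<bar>disc_loss j \<omega>\<bar>} \<omega> * growth p q (\<Theta> n \<omega>)))"
        by (rule integrable_mult_right[OF int])
      show "AE \<omega> in M. indicator {\<omega> \<in> space M. c * x < \<bar>disc_loss j \<omega>\<bar>} \<omega> * J (c * x) (\<Theta> n \<omega>)
          \<le> g * J x 1 * (indicator {\<omega> \<in> space M. c * x < \<bar>disc_loss j \<omega>\<bar>} \<omega> * growth p q (\<Theta> n \<omega>))"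
        using disc_factor_nonneg[of n]
      proof eventually_elim
        case \<omega>: (elim \<omega>)
        have "J (c * x) (\<Theta> n \<omega>) = J x (1 / c * \<Theta> n \<omega>)"
          using \<open>0 < c\<close> by (simp add: J_scale)
        also have "\<dots> \<le> C * J x 1 * growth p q (1 / c * \<Theta> n \<omega>)"
          using elim \<omega> \<open>0 < c\<close> by (intro CD mult_nonneg_nonneg) auto
        also have "\<dots> \<le> C * J x 1 * (growth p q (1 / c) * growth p q (\<Theta> n \<omega>))"
          using C by (intro mult_left_mono growth_mult_le mult_nonneg_nonneg) auto
        also have "\<dots> = (C * growth p q (1 / c)) * (J x 1 * growth p q (\<Theta> n \<omega>))" by simp
        also have "\<dots> \<le> g * (J x 1 * growth p q (\<Theta> n \<omega>))"
          by (intro mult_right_mono) (simp_all add: g_def)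
        finally have "J (c * x) (\<Theta> n \<omega>) \<le> g * J x 1 * growth p q (\<Theta> n \<omega>)" by (simp add: mult.assoc)
        then show ?case by (simp split: split_indicator)
      qed
    qed
    also have "\<dots> = g * J x 1 * ?I x" by (rule integral_mult_right_zero)
    also have "\<dots> \<le> g * J x 1 * (e / g)"
      using elim g by (intro mult_left_mono mult_nonneg_nonneg) auto
    also have "\<dots> = e * J x 1" using g by simp
    finally show ?case .
  qed
qed

text \<open>Where \<open>\<Theta> n \<le> x / D\<close>, the consistent variation of \<open>J\<close> applies at \<open>x / \<Theta> n\<close>; elsewhere the global bound
  and dominated convergence give \<open>o(J (v * x) 1)\<close>. The same \<open>v\<close> serves all \<open>n\<close>, so in the uniform result
  it can be fixed before the number of leading losses is chosen.\<close>

lemma T_consistently_varying: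
  assumes "0 < e"
  shows "\<exists>v>1. \<forall>n. \<forall>k>0. \<forall>\<^sub>F x in at_top. T (Suc n) x \<le> (1 + e) * T (Suc n) (v * x) + k * J (v * x) 1"
proof -
  obtain v where v: "1 < v" and "\<forall>\<^sub>F x in at_top. J x 1 \<le> (1 + e) * J (v * x) 1"
    using tail_consistently_varying[OF assms] by blast
  then obtain D1 where D1: "\<And>x. D1 \<le> x \<Longrightarrow> J x 1 \<le> (1 + e) * J (v * x) 1"
    unfolding eventually_at_top_linorder by blast
  obtain C D0 where C: "0 < C" and CD: "\<And>x t. D0 \<le> x \<Longrightarrow> 0 \<le> t \<Longrightarrow> J x t \<le> C * J x 1 * growth p q t"
    using tail_growth by blast
  define D where "D = max 1 (max D0 D1)"
  have D: "0 < D" "D0 \<le> D" "D1 \<le> D" by (auto simp: D_def)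
  define g where "g = C * growth p q v + 1"
  have g: "0 < g" unfolding g_def using C by (intro add_nonneg_pos mult_nonneg_nonneg) auto
  have "\<forall>\<^sub>F x in at_top. T (Suc n) x \<le> (1 + e) * T (Suc n) (v * x) + k * J (v * x) 1" if "0 < k" for n k
  proof -
    let ?I = "\<lambda>x. \<integral>\<omega>. indicator {\<omega> \<in> space M. 1 / D * x < \<Theta> n \<omega>} \<omega> * growth p q (\<Theta> n \<omega>) \<partial>M"
    have "(?I \<longlongrightarrow> 0) at_top"
      using D by (intro growth_truncated_tendsto_0) auto
    then have "\<forall>\<^sub>F x in at_top. ?I x < k / g"
      by (rule order_tendstoD) (use \<open>0 < k\<close> g in simp)
    then show ?thesis
      using eventually_ge_at_top[of D]
    proof eventually_elim
      case (elim x)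
      have x0: "0 \<le> x" using elim D by simp
      have vx: "D0 \<le> v * x"
        using elim D v x0 mult_right_mono[of 1 v x] by linarith
      have W: "{\<omega> \<in> space M. 1 / D * x < \<Theta> n \<omega>} \<in> sets M" by measurable
      have int: "integrable M (\<lambda>\<omega>. indicator {\<omega> \<in> space M. 1 / D * x < \<Theta> n \<omega>} \<omega> * growth p q (\<Theta> n \<omega>))"
        using integrable_real_mult_indicator[OF W growth_disc_factor(1)[of n]] by (simp add: mult.commute)
      have int': "integrable M (\<lambda>\<omega>. g * J (v * x) 1 * (indicator {\<omega> \<in> space M. 1 / D * x < \<Theta> n \<omega>} \<omega> * growth p q (\<Theta> n \<omega>)))"
        by (rule integrable_mult_right[OF int])
      have "T (Suc n) x = (\<integral>\<omega>. J x (\<Theta> n \<omega>) \<partial>M)" by (rule T_eq_integral)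
      also have "\<dots> \<le> (\<integral>\<omega>. (1 + e) * J (v * x) (\<Theta> n \<omega>)
          + g * J (v * x) 1 * (indicator {\<omega> \<in> space M. 1 / D * x < \<Theta> n \<omega>} \<omega> * growth p q (\<Theta> n \<omega>)) \<partial>M)"
      proof (rule integral_mono_AE)
        show "integrable M (\<lambda>\<omega>. (1 + e) * J (v * x) (\<Theta> n \<omega>)
          + g * J (v * x) 1 * (indicator {\<omega> \<in> space M. 1 / D * x < \<Theta> n \<omega>} \<omega> * growth p q (\<Theta> n \<omega>)))"
          using int' by (intro Bochner_Integration.integrable_add integrable_mult_right integrable_J) auto
        show "AE \<omega> in M. J x (\<Theta> n \<omega>) \<le> (1 + e) * J (v * x) (\<Theta> n \<omega>)
          + g * J (v * x) 1 * (indicator {\<omega> \<in> space M. 1 / D * x < \<Theta> n \<omega>} \<omega> * growth p q (\<Theta> n \<omega>))"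
          using disc_factor_nonneg[of n] AE_space
        proof eventually_elim
          case \<omega>: (elim \<omega>)
          let ?t = "\<Theta> n \<omega>"
          consider "?t = 0" | "0 < ?t" "?t \<le> x / D" | "x / D < ?t" using \<omega> by linarith
          then show ?case
          proof cases
            case 1
            then show ?thesis using x0 v by (simp add: J_zero)
          next
            case 2
            then have "D \<le> x / ?t" using D by (simp add: field_simps)
            then have "J (x / ?t) 1 \<le> (1 + e) * J (v * (x / ?t)) 1" using D by (intro D1) simp
            moreover have "J (1 / ?t * y) 1 = J y ?t" for y
              using 2 J_scale[of "1 / ?t" y 1] by simp
            from this[of x] this[of "v * x"] have "J (x / ?t) 1 = J x ?t" "J (v * (x / ?t)) 1 = J (v * x) ?t"
              by simp_all
            ultimately show ?thesis using 2 by (simp add: mult.commute)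
          next
            case 3
            have "J x ?t = J (v * x) (v * ?t)" using v by (simp add: J_scale)
            also have "\<dots> \<le> C * J (v * x) 1 * growth p q (v * ?t)"
              using vx \<omega> v by (intro CD) auto
            also have "\<dots> \<le> C * J (v * x) 1 * (growth p q v * growth p q ?t)"
              using C by (intro mult_left_mono growth_mult_le mult_nonneg_nonneg) auto
            also have "\<dots> = (C * growth p q v) * (J (v * x) 1 * growth p q ?t)" by simp
            also have "\<dots> \<le> g * (J (v * x) 1 * growth p q ?t)"
              by (intro mult_right_mono) (simp_all add: g_def)
            also have "\<dots> \<le> (1 + e) * J (v * x) ?t + g * (J (v * x) 1 * growth p q ?t)"
              using \<open>0 < e\<close> by simp
            finally show ?thesis using 3 \<omega> by (simp add: mult.assoc)
          qed
        qed
      qed simp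
      also have "\<dots> = (1 + e) * T (Suc n) (v * x) + g * J (v * x) 1 * ?I x"
        unfolding T_eq_integral
        by (subst Bochner_Integration.integral_add[OF integrable_mult_right[OF integrable_J] int'])
           (simp only: integral_mult_right_zero)
      also have "g * J (v * x) 1 * ?I x \<le> g * J (v * x) 1 * (k / g)"
        using elim g by (intro mult_left_mono mult_nonneg_nonneg) auto
      also have "\<dots> = k * J (v * x) 1" using g by simp
      finally show ?case by simp
    qed
  qed
  then show ?thesis using v by blast
qed

lemma T_one: "T 1 x = J x 1"
  using T_eq_integral[of 0 x] by (simp add: disc_factor_def prob_space)

lemma T_nonneg [simp]: "0 \<le> T i x"
  by (simp add: disc_loss_tail_def)

lemma T_antimono: "1 \<le> i \<Longrightarrow> x \<le> x' \<Longrightarrow> T i x' \<le> T i x"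
  unfolding T_eq_prob by (intro finite_measure_mono) auto

lemma disc_sum_measurable [measurable]: "disc_sum Xs Ys n \<in> borel_measurable M"
  unfolding disc_sum_eq[abs_def] by (intro borel_measurable_sum) auto

lemma ruin_event:
  "{\<omega> \<in> space M. ereal x < max_disc_sum Xs Ys n \<omega>}
    = {\<omega> \<in> space M. \<exists>k. enat k \<le> n \<and> x < disc_sum Xs Ys k \<omega>}"
  by (auto simp: max_disc_sum_def less_SUP_iff)

lemma ruin_event_measurable [measurable]:
  "{\<omega> \<in> space M. ereal x < max_disc_sum Xs Ys n \<omega>} \<in> sets M"
  unfolding ruin_event by measurable

lemma ruin_prob_nonneg: "0 \<le> ruin_prob M Xs Ys x n"
  by (simp add: ruin_prob_def)

lemma positive_parts_measurable [measurable]: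
  "(\<lambda>\<omega>. \<Sum>i\<in>{N<..n}. max 0 (disc_loss i \<omega>)) \<in> borel_measurable M"
  by (intro borel_measurable_sum borel_measurable_max disc_loss_measurable) auto

lemma loss_events_measurable:
  "1 \<le> j \<Longrightarrow> {\<omega> \<in> space M. x < disc_loss j \<omega>} \<in> sets M"
  "1 \<le> i \<Longrightarrow> {\<omega> \<in> space M. w < \<bar>disc_loss i \<omega>\<bar>} \<in> sets M"
  "1 \<le> i \<Longrightarrow> 1 \<le> j \<Longrightarrow> {\<omega> \<in> space M. w < \<bar>disc_loss i \<omega>\<bar> \<and> x < disc_loss j \<omega>} \<in> sets M"
  by measurable

lemma ruin_prob_le_sum:
  assumes "0 < x" "1 < v" and c: "c = (1 - 1 / v) / 2 / real (Suc N)"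
  shows "ruin_prob M Xs Ys x (enat n)
    \<le> (\<Sum>i=1..min n N. T i (x / v))
      + (\<Sum>j\<in>{1..N}. \<Sum>i\<in>{1..<j}. prob {\<omega> \<in> space M. c * x < \<bar>disc_loss i \<omega>\<bar> \<and> c * x < disc_loss j \<omega>})
      + prob {\<omega> \<in> space M. (1 - 1 / v) / 2 * x < (\<Sum>i\<in>{N<..n}. max 0 (disc_loss i \<omega>))}"
proof -
  let ?A = "\<lambda>i. {\<omega> \<in> space M. x / v < disc_loss i \<omega>}"
  let ?B = "\<lambda>j i. {\<omega> \<in> space M. c * x < \<bar>disc_loss i \<omega>\<bar> \<and> c * x < disc_loss j \<omega>}"
  let ?R = "{\<omega> \<in> space M. (1 - 1 / v) / 2 * x < (\<Sum>i\<in>{N<..n}. max 0 (disc_loss i \<omega>))}"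
  have A: "?A i \<in> sets M" if "i \<in> {1..min n N}" for i using that by (intro loss_events_measurable) auto
  have B: "?B j i \<in> sets M" if "j \<in> {1..N}" "i \<in> {1..<j}" for i j using that by (intro loss_events_measurable) auto
  have B': "(\<Union>i\<in>{1..<j}. ?B j i) \<in> sets M" if "j \<in> {1..N}" for j using B[OF that] by auto
  have R: "?R \<in> sets M" by measurable
  have "{\<omega> \<in> space M. ereal x < max_disc_sum Xs Ys (enat n) \<omega>}
      \<subseteq> ((\<Union>i\<in>{1..min n N}. ?A i) \<union> (\<Union>j\<in>{1..N}. \<Union>i\<in>{1..<j}. ?B j i)) \<union> ?R"
  proof
    fix \<omega> assume "\<omega> \<in> {\<omega> \<in> space M. ereal x < max_disc_sum Xs Ys (enat n) \<omega>}"
    then obtain k where \<omega>: "\<omega> \<in> space M" and k: "k \<le> n" "x < disc_sum Xs Ys k \<omega>"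
      unfolding ruin_event by auto
    have "disc_sum Xs Ys k \<omega> \<le> (\<Sum>i=1..k. max 0 (disc_loss i \<omega>))"
      unfolding disc_sum_eq by (intro sum_mono) simp
    also have "\<dots> \<le> (\<Sum>i=1..n. max 0 (disc_loss i \<omega>))"
      using k by (intro sum_mono2) auto
    finally have "x < (\<Sum>i=1..n. max 0 (disc_loss i \<omega>))" using k by simp
    from sum_positive_parts_greater[OF assms(1,2) c this]
    show "\<omega> \<in> ((\<Union>i\<in>{1..min n N}. ?A i) \<union> (\<Union>j\<in>{1..N}. \<Union>i\<in>{1..<j}. ?B j i)) \<union> ?R"
    proof (elim disjE)
      assume "\<exists>i\<in>{1..min n N}. x / v < disc_loss i \<omega>"
      then show ?thesis using \<omega> by blast
    next
      assume "\<exists>i\<in>{1..N}. \<exists>j\<in>{1..N}. i < j \<and> c * x < disc_loss i \<omega> \<and> c * x < disc_loss j \<omega>"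
      then obtain i j where ij: "i \<in> {1..N}" "j \<in> {1..N}" "i < j" "c * x < disc_loss i \<omega>" "c * x < disc_loss j \<omega>"
        by blast
      then have "\<omega> \<in> ?B j i" using \<omega> by (auto intro: less_le_trans)
      moreover have "i \<in> {1..<j}" using ij by auto
      ultimately show ?thesis using ij(2) by blast
    next
      assume "(1 - 1 / v) / 2 * x < (\<Sum>i\<in>{N<..n}. max 0 (disc_loss i \<omega>))"
      then show ?thesis using \<omega> by blast
    qed
  qed
  then have "ruin_prob M Xs Ys x (enat n)
      \<le> prob (((\<Union>i\<in>{1..min n N}. ?A i) \<union> (\<Union>j\<in>{1..N}. \<Union>i\<in>{1..<j}. ?B j i)) \<union> ?R)"
    unfolding ruin_prob_def using A B' R by (intro finite_measure_mono) auto
  also have "\<dots> \<le> prob ((\<Union>i\<in>{1..min n N}. ?A i) \<union> (\<Union>j\<in>{1..N}. \<Union>i\<in>{1..<j}. ?B j i)) + prob ?R"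
    using A B' R by (intro measure_Un_le) auto
  also have "prob ((\<Union>i\<in>{1..min n N}. ?A i) \<union> (\<Union>j\<in>{1..N}. \<Union>i\<in>{1..<j}. ?B j i))
      \<le> prob (\<Union>i\<in>{1..min n N}. ?A i) + prob (\<Union>j\<in>{1..N}. \<Union>i\<in>{1..<j}. ?B j i)"
    using A B' by (intro measure_Un_le) auto
  also have "prob (\<Union>i\<in>{1..min n N}. ?A i) \<le> (\<Sum>i=1..min n N. prob (?A i))"
    using A by (intro measure_UNION_le) auto
  also have "prob (\<Union>j\<in>{1..N}. \<Union>i\<in>{1..<j}. ?B j i) \<le> (\<Sum>j\<in>{1..N}. prob (\<Union>i\<in>{1..<j}. ?B j i))"
    using B' by (intro measure_UNION_le) auto
  also have "\<dots> \<le> (\<Sum>j\<in>{1..N}. \<Sum>i\<in>{1..<j}. prob (?B j i))"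
    using B by (intro sum_mono measure_UNION_le) auto
  finally show ?thesis by (simp add: T_eq_prob)
qed

lemma joint_tails_negligible:
  assumes "0 < c" "0 < e"
  shows "\<forall>\<^sub>F x in at_top. \<forall>j\<in>{1..N}. \<forall>i\<in>{1..<j}.
    prob {\<omega> \<in> space M. c * x < \<bar>disc_loss i \<omega>\<bar> \<and> c * x < disc_loss j \<omega>} \<le> e * J x 1"
proof (intro eventually_ball_finite ballI)
  fix i j assume "j \<in> {1..N}" "i \<in> {1..<j}"
  then obtain n where "j = Suc n" "1 \<le> i" "i \<le> n" by (cases j) auto
  then show "\<forall>\<^sub>F x in at_top. prob {\<omega> \<in> space M. c * x < \<bar>disc_loss i \<omega>\<bar> \<and> c * x < disc_loss j \<omega>} \<le> e * J x 1"
    using joint_tail_negligible assms by blast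
qed auto

lemma double_sum_le:
  fixes a :: "nat \<Rightarrow> nat \<Rightarrow> real"
  assumes "\<And>j i. j \<in> {1..N} \<Longrightarrow> i \<in> {1..<j} \<Longrightarrow> a j i \<le> b" "0 \<le> b"
  shows "(\<Sum>j\<in>{1..N}. \<Sum>i\<in>{1..<j}. a j i) \<le> real N * (real N * b)"
proof -
  have "(\<Sum>i\<in>{1..<j}. a j i) \<le> real N * b" if "j \<in> {1..N}" for j
  proof -
    have "(\<Sum>i\<in>{1..<j}. a j i) \<le> real (card {1..<j}) * b"
      using that assms by (intro sum_bounded_above) auto
    also have "\<dots> \<le> real N * b" using that assms by (intro mult_right_mono) auto
    finally show ?thesis .
  qed
  then have "(\<Sum>j\<in>{1..N}. \<Sum>i\<in>{1..<j}. a j i) \<le> real (card {1..N}) * (real N * b)"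
    by (intro sum_bounded_above) auto
  then show ?thesis by simp
qed

text \<open>The \<open>d\<close> is chosen before \<open>N\<close>: for a fixed horizon \<open>N = n\<close> makes the last term vanish, and for the uniform
  result \<open>N\<close> is chosen so large, depending on \<open>d\<close>, that the last term is small.\<close>

lemma ruin_prob_upper:
  assumes "0 < e"
  shows "\<exists>d>0. \<forall>N. \<forall>\<^sub>F x in at_top. \<forall>n\<ge>1. ruin_prob M Xs Ys x (enat n)
    \<le> (1 + e) * (\<Sum>i=1..n. T i x) + prob {\<omega> \<in> space M. d * x < (\<Sum>i\<in>{N<..n}. max 0 (disc_loss i \<omega>))}"
proof -
  obtain v where v: "1 < v" and T_v: "\<And>n k. 0 < k \<Longrightarrow>
      \<forall>\<^sub>F x in at_top. T (Suc n) x \<le> (1 + e / 2) * T (Suc n) (v * x) + k * J (v * x) 1"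
    using T_consistently_varying[of "e / 2"] \<open>0 < e\<close> by auto
  define d where "d = (1 - 1 / v) / 2"
  have d: "0 < d" using v by (simp add: d_def)
  have "\<forall>\<^sub>F x in at_top. \<forall>n\<ge>1. ruin_prob M Xs Ys x (enat n)
    \<le> (1 + e) * (\<Sum>i=1..n. T i x) + prob {\<omega> \<in> space M. d * x < (\<Sum>i\<in>{N<..n}. max 0 (disc_loss i \<omega>))}" for N
  proof -
    define c where "c = (1 - 1 / v) / 2 / real (Suc N)"
    have c: "0 < c" using v by (simp add: c_def)
    obtain k where k: "0 < k" and Nk: "real N * k \<le> e / 4" "real N * (real N * k) \<le> e / 4"
      using small_share[of "e / 4" N] \<open>0 < e\<close> by auto
    have lim: "filterlim (\<lambda>x. 1 / v * x) at_top at_top"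
      by (rule filterlim_tendsto_pos_mult_at_top[OF tendsto_const _ filterlim_ident]) (use v in auto)
    have "\<forall>\<^sub>F x in at_top. \<forall>i\<in>{1..N}. T i (x / v) \<le> (1 + e / 2) * T i x + k * J x 1"
    proof (intro eventually_ball_finite ballI)
      fix i assume "i \<in> {1..N}"
      then obtain m where i: "i = Suc m" by (cases i) auto
      show "\<forall>\<^sub>F x in at_top. T i (x / v) \<le> (1 + e / 2) * T i x + k * J x 1"
        using eventually_compose_filterlim[OF T_v[OF k, of m] lim] v by (simp add: i)
    qed auto
    then show ?thesis
      using joint_tails_negligible[OF c k, of N] eventually_gt_at_top[of 0]
    proof eventually_elim
      case (elim x)
      show ?case
      proof (intro allI impI)
        fix n :: nat assume n: "1 \<le> n"
        have J: "J x 1 \<le> (\<Sum>i=1..n. T i x)"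
          using n unfolding T_one[symmetric] by (intro member_le_sum) auto
        have "(\<Sum>i=1..min n N. T i (x / v)) \<le> (\<Sum>i=1..min n N. (1 + e / 2) * T i x + k * J x 1)"
          using elim(1) by (intro sum_mono) auto
        also have "\<dots> = (1 + e / 2) * (\<Sum>i=1..min n N. T i x) + real (min n N) * (k * J x 1)"
          by (simp add: sum.distrib sum_distrib_left)
        also have "\<dots> \<le> (1 + e / 2) * (\<Sum>i=1..n. T i x) + real N * (k * J x 1)"
          using \<open>0 < e\<close> k by (intro add_mono mult_left_mono mult_right_mono sum_mono2) auto
        finally have 1: "(\<Sum>i=1..min n N. T i (x / v)) \<le> (1 + e / 2) * (\<Sum>i=1..n. T i x) + real N * k * J x 1"
          by simp
        have "(\<Sum>j\<in>{1..N}. \<Sum>i\<in>{1..<j}. prob {\<omega> \<in> space M. c * x < \<bar>disc_loss i \<omega>\<bar> \<and> c * x < disc_loss j \<omega>})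
            \<le> real N * (real N * (k * J x 1))"
          using elim(2) k by (intro double_sum_le) auto
        then have 2: "(\<Sum>j\<in>{1..N}. \<Sum>i\<in>{1..<j}. prob {\<omega> \<in> space M. c * x < \<bar>disc_loss i \<omega>\<bar> \<and> c * x < disc_loss j \<omega>})
            \<le> real N * (real N * k) * J x 1" by (simp add: mult.assoc)
        have "real N * k * J x 1 + real N * (real N * k) * J x 1 \<le> e / 4 * J x 1 + e / 4 * J x 1"
          using Nk by (intro add_mono mult_right_mono) auto
        also have "\<dots> = e / 2 * J x 1" by simp
        also have "\<dots> \<le> e / 2 * (\<Sum>i=1..n. T i x)" using J \<open>0 < e\<close> by (intro mult_left_mono) auto
        finally have 3: "real N * k * J x 1 + real N * (real N * k) * J x 1 \<le> e / 2 * (\<Sum>i=1..n. T i x)" .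
        have 4: "(1 + e) * (\<Sum>i=1..n. T i x) = (1 + e / 2) * (\<Sum>i=1..n. T i x) + e / 2 * (\<Sum>i=1..n. T i x)"
          by (simp add: algebra_simps)
        show "ruin_prob M Xs Ys x (enat n) \<le> (1 + e) * (\<Sum>i=1..n. T i x)
            + prob {\<omega> \<in> space M. d * x < (\<Sum>i\<in>{N<..n}. max 0 (disc_loss i \<omega>))}"
          using ruin_prob_le_sum[OF elim(3) v c_def, of n] 1 2 3 4 unfolding d_def[symmetric] by linarith
      qed
    qed
  qed
  then show ?thesis using d by blast
qed

text \<open>The \<open>j\<close>-th event says that the \<open>j\<close>-th loss exceeds \<open>v * x\<close> and all earlier ones are at most \<open>c * x\<close> in
  absolute value. Then \<open>disc_sum Xs Ys j\<close> exceeds \<open>x\<close>, whatever happens after time \<open>j\<close>. For different \<open>j\<close> the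
  events are disjoint since \<open>c < v\<close>, so their probabilities simply add up.\<close>

lemma ruin_prob_ge_sum:
  assumes "0 < x" "1 < v" and c: "c = (v - 1) / real (Suc N)"
  shows "(\<Sum>i=1..min n N. T i (v * x))
      - (\<Sum>j\<in>{1..N}. \<Sum>i\<in>{1..<j}. prob {\<omega> \<in> space M. c * x < \<bar>disc_loss i \<omega>\<bar> \<and> c * x < disc_loss j \<omega>})
    \<le> ruin_prob M Xs Ys x (enat n)"
proof -
  let ?A = "\<lambda>j. {\<omega> \<in> space M. v * x < disc_loss j \<omega>}"
  let ?B = "\<lambda>j i. {\<omega> \<in> space M. c * x < \<bar>disc_loss i \<omega>\<bar> \<and> c * x < disc_loss j \<omega>}"
  let ?E = "\<lambda>j. {\<omega> \<in> space M. v * x < disc_loss j \<omega> \<and> (\<forall>i\<in>{1..<j}. \<bar>disc_loss i \<omega>\<bar> \<le> c * x)}"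
  have c0: "0 < c" using \<open>1 < v\<close> by (simp add: c)
  have SNc: "real (Suc N) * c = v - 1"
    unfolding c by (subst times_divide_eq_right, rule nonzero_mult_div_cancel_left) simp
  have "1 * c \<le> real (Suc N) * c" using c0 by (intro mult_right_mono) auto
  then have "c < v" using SNc by simp
  then have cx: "0 < c * x" "c * x < v * x" using \<open>0 < x\<close> c0 by auto
  have A: "?A j \<in> sets M" if "1 \<le> j" for j using that by (intro loss_events_measurable) auto
  have B: "?B j i \<in> sets M" if "1 \<le> j" "i \<in> {1..<j}" for i j using that by (intro loss_events_measurable) auto
  have E: "?E j \<in> sets M" if "1 \<le> j" for j
  proof -
    have "?E j = ?A j - (\<Union>i\<in>{1..<j}. {\<omega> \<in> space M. c * x < \<bar>disc_loss i \<omega>\<bar>})" by (auto simp: not_less)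
    moreover have "{\<omega> \<in> space M. c * x < \<bar>disc_loss i \<omega>\<bar>} \<in> sets M" if "i \<in> {1..<j}" for i
      using that by (intro loss_events_measurable) auto
    ultimately show ?thesis using A[OF \<open>1 \<le> j\<close>] by auto
  qed
  have "T j (v * x) - (\<Sum>i\<in>{1..<j}. prob (?B j i)) \<le> prob (?E j)" if j: "1 \<le> j" for j
  proof -
    have "?A j \<subseteq> ?E j \<union> (\<Union>i\<in>{1..<j}. ?B j i)"
      using cx by (auto simp: not_le)
    then have "T j (v * x) \<le> prob (?E j \<union> (\<Union>i\<in>{1..<j}. ?B j i))"
      unfolding T_eq_prob using E B j by (intro finite_measure_mono) auto
    also have "\<dots> \<le> prob (?E j) + prob (\<Union>i\<in>{1..<j}. ?B j i)"
      using E B j by (intro measure_Un_le) auto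
    also have "prob (\<Union>i\<in>{1..<j}. ?B j i) \<le> (\<Sum>i\<in>{1..<j}. prob (?B j i))"
      using B j by (intro measure_UNION_le) auto
    finally show ?thesis by simp
  qed
  then have "(\<Sum>j=1..min n N. T j (v * x) - (\<Sum>i\<in>{1..<j}. prob (?B j i))) \<le> (\<Sum>j=1..min n N. prob (?E j))"
    by (intro sum_mono) auto
  also have "\<dots> = prob (\<Union>j\<in>{1..min n N}. ?E j)"
  proof (rule finite_measure_finite_Union[symmetric])
    have "?E i \<inter> ?E j = {}" if "1 \<le> i" "i < j" for i j
      using cx that by force
    then have "?E i \<inter> ?E j = {}" if "1 \<le> i" "1 \<le> j" "i \<noteq> j" for i j
      using that by (cases i j rule: linorder_cases) (blast | simp add: Int_commute)+
    then show "disjoint_family_on ?E {1..min n N}"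
      unfolding disjoint_family_on_def by auto
  qed (use E in auto)
  also have "\<dots> \<le> ruin_prob M Xs Ys x (enat n)"
    unfolding ruin_prob_def
  proof (rule finite_measure_mono)
    show "(\<Union>j\<in>{1..min n N}. ?E j) \<subseteq> {\<omega> \<in> space M. ereal x < max_disc_sum Xs Ys (enat n) \<omega>}"
    proof
      fix \<omega> assume "\<omega> \<in> (\<Union>j\<in>{1..min n N}. ?E j)"
      then obtain j where j: "1 \<le> j" "j \<le> n" "j \<le> N" and \<omega>: "\<omega> \<in> space M" "v * x < disc_loss j \<omega>"
        and small: "\<And>i. i \<in> {1..<j} \<Longrightarrow> \<bar>disc_loss i \<omega>\<bar> \<le> c * x"
        by auto
      have "(\<Sum>i\<in>{1..<j}. - disc_loss i \<omega>) \<le> real (card {1..<j}) * (c * x)"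
      proof (rule sum_bounded_above)
        fix i assume "i \<in> {1..<j}"
        from small[OF this] show "- disc_loss i \<omega> \<le> c * x" by linarith
      qed
      also have "\<dots> \<le> real (Suc N) * (c * x)" using j cx by (intro mult_right_mono) auto
      also have "\<dots> = (v - 1) * x" by (simp only: mult.assoc[symmetric] SNc)
      finally have "x - v * x \<le> (\<Sum>i\<in>{1..<j}. disc_loss i \<omega>)" by (simp add: sum_negf algebra_simps)
      moreover have "disc_sum Xs Ys j \<omega> = disc_loss j \<omega> + (\<Sum>i\<in>{1..<j}. disc_loss i \<omega>)"
      proof -
        have "{1..j} = insert j {1..<j}" using j by auto
        then show ?thesis by (simp add: disc_sum_eq)
      qed
      ultimately have "x < disc_sum Xs Ys j \<omega>" using \<omega> by linarith
      then show "\<omega> \<in> {\<omega> \<in> space M. ereal x < max_disc_sum Xs Ys (enat n) \<omega>}"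
        unfolding ruin_event using \<omega> j by auto
    qed
  qed (rule ruin_event_measurable)
  finally have "(\<Sum>j=1..min n N. T j (v * x)) - (\<Sum>j=1..min n N. \<Sum>i\<in>{1..<j}. prob (?B j i)) \<le> ruin_prob M Xs Ys x (enat n)"
    by (simp add: sum_subtractf)
  moreover have "(\<Sum>j=1..min n N. \<Sum>i\<in>{1..<j}. prob (?B j i)) \<le> (\<Sum>j=1..N. \<Sum>i\<in>{1..<j}. prob (?B j i))"
    by (intro sum_mono2) (auto intro!: sum_nonneg)
  ultimately show ?thesis by linarith
qed

lemma ruin_prob_lower:
  assumes "0 < e"
  shows "\<forall>\<^sub>F x in at_top. \<forall>n. (1 - e) * (\<Sum>i=1..min n N. T i x) \<le> ruin_prob M Xs Ys x (enat n)"
proof -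
  obtain v where v: "1 < v" and T_v: "\<And>n k. 0 < k \<Longrightarrow>
      \<forall>\<^sub>F x in at_top. T (Suc n) x \<le> (1 + e / 2) * T (Suc n) (v * x) + k * J (v * x) 1"
    using T_consistently_varying[of "e / 2"] \<open>0 < e\<close> by auto
  define c where "c = (v - 1) / real (Suc N)"
  have c: "0 < c" using v by (simp add: c_def)
  obtain k where k: "0 < k" and Nk: "real N * k \<le> e / 4" "real N * (real N * k) \<le> e / 4"
    using small_share[of "e / 4" N] \<open>0 < e\<close> by auto
  have "\<forall>\<^sub>F x in at_top. \<forall>i\<in>{1..N}. T i x \<le> (1 + e / 2) * T i (v * x) + k * J (v * x) 1"
  proof (intro eventually_ball_finite ballI)
    fix i assume "i \<in> {1..N}"
    then obtain m where i: "i = Suc m" by (cases i) auto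
    show "\<forall>\<^sub>F x in at_top. T i x \<le> (1 + e / 2) * T i (v * x) + k * J (v * x) 1"
      using T_v[OF k, of m] by (simp add: i)
  qed auto
  then show ?thesis
    using joint_tails_negligible[OF c k, of N] eventually_gt_at_top[of 0]
  proof eventually_elim
    case (elim x)
    show ?case
    proof
      fix n :: nat
      show "(1 - e) * (\<Sum>i=1..min n N. T i x) \<le> ruin_prob M Xs Ys x (enat n)"
      proof (cases "min n N = 0")
        case True
        then show ?thesis by (simp add: ruin_prob_nonneg)
      next
        case False
        let ?S = "\<Sum>i=1..min n N. T i x" and ?V = "\<Sum>i=1..min n N. T i (v * x)"
        have "x \<le> v * x" using v elim mult_right_mono[of 1 v x] by simp
        then have Jv: "J (v * x) 1 \<le> J x 1" and V: "?V \<le> ?S"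
          by (auto intro!: J_antimono sum_mono T_antimono)
        have J: "J x 1 \<le> ?S"
          using False unfolding T_one[symmetric] by (intro member_le_sum) auto
        have "?S \<le> (\<Sum>i=1..min n N. (1 + e / 2) * T i (v * x) + k * J (v * x) 1)"
          using elim(1) by (intro sum_mono) auto
        also have "\<dots> = ?V + e / 2 * ?V + real (min n N) * (k * J (v * x) 1)"
          by (simp add: sum.distrib sum_distrib_left algebra_simps)
        also have "\<dots> \<le> ?V + e / 2 * ?S + real N * (k * J x 1)"
          using \<open>0 < e\<close> k V Jv by (intro add_mono mult_left_mono mult_mono) auto
        finally have 1: "?S \<le> ?V + e / 2 * ?S + real N * k * J x 1"
          by simp
        have "(\<Sum>j\<in>{1..N}. \<Sum>i\<in>{1..<j}. prob {\<omega> \<in> space M. c * x < \<bar>disc_loss i \<omega>\<bar> \<and> c * x < disc_loss j \<omega>})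
            \<le> real N * (real N * (k * J x 1))"
          using elim(2) k by (intro double_sum_le) auto
        then have 2: "(\<Sum>j\<in>{1..N}. \<Sum>i\<in>{1..<j}. prob {\<omega> \<in> space M. c * x < \<bar>disc_loss i \<omega>\<bar> \<and> c * x < disc_loss j \<omega>})
            \<le> real N * (real N * k) * J x 1" by (simp add: mult.assoc)
        have "real N * k * J x 1 + real N * (real N * k) * J x 1 \<le> e / 4 * J x 1 + e / 4 * J x 1"
          using Nk by (intro add_mono mult_right_mono) auto
        also have "\<dots> = e / 2 * J x 1" by simp
        also have "\<dots> \<le> e / 2 * ?S" using J \<open>0 < e\<close> by (intro mult_left_mono) auto
        finally have 3: "real N * k * J x 1 + real N * (real N * k) * J x 1 \<le> e / 2 * ?S" .
        have 4: "(1 - e) * ?S = ?S - e / 2 * ?S - e / 2 * ?S"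
          by (simp add: algebra_simps)
        show ?thesis
          using ruin_prob_ge_sum[OF elim(3) v c_def, of n] 1 2 3 4 by linarith
      qed
    qed
  qed
qed

theorem ruin_prob_finite_horizon:
  assumes "0 < e" and n: "1 \<le> n"
  shows "\<forall>\<^sub>F x in at_top. \<bar>ruin_prob M Xs Ys x (enat n) - (\<Sum>i=1..n. T i x)\<bar> \<le> e * (\<Sum>i=1..n. T i x)"
proof -
  obtain d where d: "0 < d" and up: "\<forall>\<^sub>F x in at_top. \<forall>n'\<ge>1. ruin_prob M Xs Ys x (enat n')
    \<le> (1 + e) * (\<Sum>i=1..n'. T i x) + prob {\<omega> \<in> space M. d * x < (\<Sum>i\<in>{n<..n'}. max 0 (disc_loss i \<omega>))}"
    using ruin_prob_upper[OF assms(1)] by blast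
  show ?thesis
    using up ruin_prob_lower[OF assms(1), of n] eventually_ge_at_top[of 0]
  proof eventually_elim
    case (elim x)
    have "{\<omega> \<in> space M. d * x < (\<Sum>i\<in>{n<..n}. max 0 (disc_loss i \<omega>))} = {}"
      using d elim by (auto simp: not_less)
    then have zero: "prob {\<omega> \<in> space M. d * x < (\<Sum>i\<in>{n<..n}. max 0 (disc_loss i \<omega>))} = 0"
      by (simp only: measure_empty)
    have "ruin_prob M Xs Ys x (enat n) \<le> (1 + e) * (\<Sum>i=1..n. T i x)"
      using elim(1)[rule_format, OF n] unfolding zero by simp
    moreover have "(1 - e) * (\<Sum>i=1..n. T i x) \<le> ruin_prob M Xs Ys x (enat n)"
      using elim(2)[rule_format, of n] by simp
    ultimately show ?case by (simp add: abs_le_iff algebra_simps)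
  qed
qed

end

section \<open>Uniformity in the horizon\<close>

lemma sum_geometric_le:
  fixes u :: real
  assumes "0 \<le> u" "u < 1"
  shows "(\<Sum>k<m. u ^ k) \<le> 1 / (1 - u)"
proof -
  have "(1 - u) * (\<Sum>k<m. u ^ k) = 1 - u ^ m" by (rule one_diff_power_eq[symmetric])
  also have "\<dots> \<le> 1" using assms by simp
  finally show ?thesis using assms by (simp add: pos_le_divide_eq mult.commute)
qed

lemma sum_greaterThanAtMost_shift:
  fixes f :: "nat \<Rightarrow> real"
  shows "(\<Sum>i\<in>{N<..n}. f i) = (\<Sum>k<n - N. f (Suc (N + k)))"
  by (rule sum.reindex_bij_witness[of _ "\<lambda>k. Suc (N + k)" "\<lambda>i. i - Suc N"]) auto

context discounted_losses
begin

lemma T_scaled_le: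
  "\<exists>C>0. \<exists>D>0. \<forall>x\<ge>D. \<forall>a. 0 < a \<and> a \<le> 1 \<longrightarrow> (\<forall>n. T (Suc n) (a * x) \<le> C * J x 1 * a powr (- p) * \<rho> ^ n)"
proof -
  obtain C D where C: "0 < C" "0 < D" and CD: "\<And>x t. D \<le> x \<Longrightarrow> 0 \<le> t \<Longrightarrow> J x t \<le> C * J x 1 * growth p q t"
    using tail_growth by blast
  have "T (Suc n) (a * x) \<le> C * J x 1 * a powr (- p) * \<rho> ^ n" if x: "D \<le> x" and a: "0 < a" "a \<le> 1" for x a n
  proof -
    have J0: "0 \<le> C * J x 1 * a powr (- p)" using C by simp
    have "T (Suc n) (a * x) = (\<integral>\<omega>. J (a * x) (\<Theta> n \<omega>) \<partial>M)" by (rule T_eq_integral)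
    also have "\<dots> \<le> (\<integral>\<omega>. C * J x 1 * a powr (- p) * growth p q (\<Theta> n \<omega>) \<partial>M)"
    proof (rule integral_mono_AE)
      show "AE \<omega> in M. J (a * x) (\<Theta> n \<omega>) \<le> C * J x 1 * a powr (- p) * growth p q (\<Theta> n \<omega>)"
        using disc_factor_nonneg[of n]
      proof eventually_elim
        case (elim \<omega>)
        have "J (a * x) (\<Theta> n \<omega>) = J x (1 / a * \<Theta> n \<omega>)" using a by (simp add: J_scale)
        also have "\<dots> \<le> C * J x 1 * growth p q (1 / a * \<Theta> n \<omega>)"
          using x elim a by (intro CD mult_nonneg_nonneg) auto
        also have "\<dots> \<le> C * J x 1 * (growth p q (1 / a) * growth p q (\<Theta> n \<omega>))"
          using C by (intro mult_left_mono growth_mult_le mult_nonneg_nonneg) auto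
        finally show ?case using growth_inverse[OF a q_le_p] by simp
      qed
    qed (use growth_disc_factor(1) in \<open>auto simp del: mult_eq_0_iff\<close>)
    also have "\<dots> = C * J x 1 * a powr (- p) * (\<integral>\<omega>. growth p q (\<Theta> n \<omega>) \<partial>M)" by (rule integral_mult_right_zero)
    also have "\<dots> \<le> C * J x 1 * a powr (- p) * \<rho> ^ n"
      using growth_disc_factor(2)[of n] J0 by (intro mult_left_mono) auto
    finally show ?thesis .
  qed
  then show ?thesis using C by blast
qed

text \<open>If every loss after time \<open>N\<close> stays below its share \<open>a k * x\<close>, the sum stays below \<open>x\<close>. A union bound then
  leaves \<open>\<rho> ^ N\<close> times the series of \<open>a k powr (- p) * \<rho> ^ k\<close>, which converges when \<open>a k\<close> is
  proportional to \<open>s ^ k\<close> with \<open>s powr p > \<rho>\<close>.\<close>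

lemma remote_losses_le:
  assumes "\<rho> < 1"
  shows "\<exists>C>0. \<exists>D>0. \<forall>x\<ge>D. \<forall>N n.
    prob {\<omega> \<in> space M. x < (\<Sum>i\<in>{N<..n}. max 0 (disc_loss i \<omega>))} \<le> C * \<rho> ^ N * J x 1"
proof -
  obtain C D where C: "0 < C" "0 < D"
    and CD: "\<And>x a n. D \<le> x \<Longrightarrow> 0 < a \<Longrightarrow> a \<le> 1 \<Longrightarrow> T (Suc n) (a * x) \<le> C * J x 1 * a powr (- p) * \<rho> ^ n"
    using T_scaled_le by blast
  \<comment> \<open>any number strictly between \<open>\<rho>\<close> and 1; it will be \<open>s powr p\<close>\<close>
  define r where "r = (1 + \<rho>) / 2"
  have r: "\<rho> < r" "0 < r" "r < 1" using assms \<rho>_nonneg by (auto simp: r_def simp del: \<rho>_nonneg)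
  define s where "s = r powr (1 / p)"
  have s: "0 < s" "s < 1"
    using r p_pos powr_less_mono2[of "1 / p" r 1] by (auto simp: s_def)
  have sp: "(s ^ k) powr (- p) = 1 / r ^ k" for k
  proof -
    have "(s ^ k) powr p = r ^ k"
      using r p_pos by (simp add: s_def powr_powr flip: powr_realpow)
    then show ?thesis by (simp add: powr_minus inverse_eq_divide)
  qed
  define a where "a k = (1 - s) * s ^ k" for k
  have a: "0 < a k" "a k \<le> 1" for k
    using s mult_le_one[of "1 - s" "s ^ k"] by (auto simp: a_def power_le_one)
  have a_sum: "(\<Sum>k<m. a k) \<le> 1" for m
  proof -
    have "(\<Sum>k<m. a k) = 1 - s ^ m"
      unfolding a_def sum_distrib_left[symmetric] by (rule one_diff_power_eq[symmetric])
    then show ?thesis using s by simp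
  qed
  define C' where "C' = C * (1 - s) powr (- p) * (1 / (1 - \<rho> / r))"
  have C': "0 < C'" using C s r by (simp add: C'_def)
  have "prob {\<omega> \<in> space M. x < (\<Sum>i\<in>{N<..n}. max 0 (disc_loss i \<omega>))} \<le> C' * \<rho> ^ N * J x 1"
    if x: "D \<le> x" for x N n
  proof -
    let ?A = "\<lambda>k. {\<omega> \<in> space M. a k * x < disc_loss (Suc (N + k)) \<omega>}"
    have A: "?A k \<in> sets M" for k by (rule loss_events_measurable) simp
    have "{\<omega> \<in> space M. x < (\<Sum>i\<in>{N<..n}. max 0 (disc_loss i \<omega>))} \<subseteq> (\<Union>k\<in>{..<n - N}. ?A k)"
    proof (rule subsetI, rule ccontr)
      fix \<omega> assume \<omega>: "\<omega> \<in> {\<omega> \<in> space M. x < (\<Sum>i\<in>{N<..n}. max 0 (disc_loss i \<omega>))}"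
        and "\<omega> \<notin> (\<Union>k\<in>{..<n - N}. ?A k)"
      then have le: "disc_loss (Suc (N + k)) \<omega> \<le> a k * x" if "k < n - N" for k
        using that by (auto simp: not_less)
      have "(\<Sum>i\<in>{N<..n}. max 0 (disc_loss i \<omega>)) = (\<Sum>k<n - N. max 0 (disc_loss (Suc (N + k)) \<omega>))"
        by (rule sum_greaterThanAtMost_shift)
      also have "\<dots> \<le> (\<Sum>k<n - N. a k * x)"
        using le a x C by (intro sum_mono) (auto simp: less_imp_le)
      also have "\<dots> = (\<Sum>k<n - N. a k) * x" by (rule sum_distrib_right[symmetric])
      also have "\<dots> \<le> 1 * x" using a_sum x C by (intro mult_right_mono) auto
      finally show False using \<omega> by simp
    qed
    then have "prob {\<omega> \<in> space M. x < (\<Sum>i\<in>{N<..n}. max 0 (disc_loss i \<omega>))} \<le> prob (\<Union>k\<in>{..<n - N}. ?A k)"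
      using A by (intro finite_measure_mono) auto
    also have "\<dots> \<le> (\<Sum>k<n - N. prob (?A k))" using A by (intro measure_UNION_le) auto
    also have "\<dots> = (\<Sum>k<n - N. T (Suc (N + k)) (a k * x))" by (simp add: T_eq_prob)
    also have "\<dots> \<le> (\<Sum>k<n - N. C * (1 - s) powr (- p) * \<rho> ^ N * J x 1 * (\<rho> / r) ^ k)"
    proof (rule sum_mono)
      fix k
      have "T (Suc (N + k)) (a k * x) \<le> C * J x 1 * a k powr (- p) * \<rho> ^ (N + k)"
        using x a by (rule CD)
      also have "a k powr (- p) = (1 - s) powr (- p) * (1 / r ^ k)"
        unfolding a_def powr_mult sp ..
      also have "C * J x 1 * ((1 - s) powr (- p) * (1 / r ^ k)) * \<rho> ^ (N + k)
          = C * (1 - s) powr (- p) * \<rho> ^ N * J x 1 * (\<rho> / r) ^ k"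
        by (simp add: power_add power_divide)
      finally show "T (Suc (N + k)) (a k * x) \<le> C * (1 - s) powr (- p) * \<rho> ^ N * J x 1 * (\<rho> / r) ^ k" .
    qed
    also have "\<dots> = C * (1 - s) powr (- p) * \<rho> ^ N * J x 1 * (\<Sum>k<n - N. (\<rho> / r) ^ k)"
      by (rule sum_distrib_left[symmetric])
    also have "\<dots> \<le> C * (1 - s) powr (- p) * \<rho> ^ N * J x 1 * (1 / (1 - \<rho> / r))"
      using C r by (intro mult_left_mono sum_geometric_le mult_nonneg_nonneg) auto
    finally show ?thesis by (simp add: C'_def mult_ac)
  qed
  then show ?thesis using C' C by blast
qed

text \<open>The first \<open>N\<close> losses are treated by the bounds for a finite horizon, which hold for all \<open>n\<close> at once because
  only \<open>min n N\<close> losses enter. The others are small on both sides: in the ruin probability by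
  \<open>remote_losses_le\<close> and in the sum of the tails by the geometric decay of \<open>T\<close>.\<close>

theorem ruin_prob_uniform:
  assumes rho: "\<rho> < 1" and "0 < e"
  shows "\<forall>\<^sub>F x in at_top. \<forall>n\<ge>1.
    \<bar>ruin_prob M Xs Ys x (enat n) - (\<Sum>i=1..n. T i x)\<bar> \<le> e * (\<Sum>i=1..n. T i x)"
proof -
  define e' where "e' = min e 1 / 2"
  have e': "0 < e'" "e' \<le> 1 / 2" "2 * e' \<le> e" using \<open>0 < e\<close> by (auto simp: e'_def min_def)
  obtain d where d: "0 < d" and up: "\<And>N. \<forall>\<^sub>F x in at_top. \<forall>n\<ge>1. ruin_prob M Xs Ys x (enat n)
    \<le> (1 + e') * (\<Sum>i=1..n. T i x) + prob {\<omega> \<in> space M. d * x < (\<Sum>i\<in>{N<..n}. max 0 (disc_loss i \<omega>))}"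
    using ruin_prob_upper[OF e'(1)] by blast
  obtain C1 D1 where C1: "0 < C1" "0 < D1" and CD1: "\<And>x t. D1 \<le> x \<Longrightarrow> 0 \<le> t \<Longrightarrow> J x t \<le> C1 * J x 1 * growth p q t"
    using tail_growth by blast
  obtain C2 D2 where C2: "0 < C2" "0 < D2" and CD2: "\<And>x N n. D2 \<le> x \<Longrightarrow>
      prob {\<omega> \<in> space M. x < (\<Sum>i\<in>{N<..n}. max 0 (disc_loss i \<omega>))} \<le> C2 * \<rho> ^ N * J x 1"
    using remote_losses_le[OF rho] by blast
  obtain C3 D3 where C3: "0 < C3" "0 < D3"
    and CD3: "\<And>x a n. D3 \<le> x \<Longrightarrow> 0 < a \<Longrightarrow> a \<le> 1 \<Longrightarrow> T (Suc n) (a * x) \<le> C3 * J x 1 * a powr (- p) * \<rho> ^ n"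
    using T_scaled_le by blast
  define A where "A = C2 * C1 * growth p q (1 / d) + C3 / (1 - \<rho>) + 1"
  have A: "C2 * C1 * growth p q (1 / d) \<le> A" "C3 / (1 - \<rho>) \<le> A" "0 < A"
    using C1 C2 C3 rho by (auto simp: A_def intro!: add_nonneg_pos add_nonneg_nonneg)
  have "(\<lambda>N. A * \<rho> ^ N) \<longlonglongrightarrow> A * 0"
    using rho by (intro tendsto_mult tendsto_const LIMSEQ_realpow_zero) auto
  then have "\<forall>\<^sub>F N in sequentially. A * \<rho> ^ N < e'"
    by (rule order_tendstoD) (use e' in simp)
  then obtain N where N: "A * \<rho> ^ N < e'"
    using eventually_happens[of _ sequentially] by auto
  show ?thesis
    using up[of N] ruin_prob_lower[OF e'(1), of N] eventually_ge_at_top[of D1] eventually_ge_at_top[of "D2 / d"]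
      eventually_ge_at_top[of D3]
  proof eventually_elim
    case (elim x)
    show ?case
    proof (intro allI impI)
      fix n :: nat assume n: "1 \<le> n"
      let ?s = "\<Sum>i=1..n. T i x"
      have J: "J x 1 \<le> ?s"
        using n unfolding T_one[symmetric] by (intro member_le_sum) auto
      have small: "B * \<rho> ^ N * J x 1 \<le> e' * ?s" if "B \<le> A" for B
      proof -
        have "B * \<rho> ^ N * J x 1 \<le> A * \<rho> ^ N * J x 1"
          using that by (intro mult_right_mono) auto
        also have "\<dots> \<le> e' * J x 1" using N by (intro mult_right_mono) auto
        also have "\<dots> \<le> e' * ?s" using J e' by (intro mult_left_mono) auto
        finally show ?thesis .
      qed
      have "prob {\<omega> \<in> space M. d * x < (\<Sum>i\<in>{N<..n}. max 0 (disc_loss i \<omega>))} \<le> C2 * \<rho> ^ N * J (d * x) 1"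
        using elim d by (intro CD2) (simp add: pos_divide_le_eq mult.commute)
      also have "J (d * x) 1 = J x (1 / d)" using d by (rule J_scale)
      also have "C2 * \<rho> ^ N * J x (1 / d) \<le> C2 * \<rho> ^ N * (C1 * J x 1 * growth p q (1 / d))"
        using elim d C2 by (intro mult_left_mono CD1) auto
      also have "\<dots> = C2 * C1 * growth p q (1 / d) * \<rho> ^ N * J x 1" by simp
      also have "\<dots> \<le> e' * ?s" by (rule small) (rule A)
      finally have 1: "prob {\<omega> \<in> space M. d * x < (\<Sum>i\<in>{N<..n}. max 0 (disc_loss i \<omega>))} \<le> e' * ?s" .
      have 2: "ruin_prob M Xs Ys x (enat n) \<le> (1 + e') * ?s + e' * ?s"
        using elim(1)[rule_format, OF n] 1 by linarith
      have split: "?s = (\<Sum>i=1..min n N. T i x) + (\<Sum>i\<in>{N<..n}. T i x)"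
      proof -
        have "{1..n} = {1..min n N} \<union> {N<..n}" by auto
        then show ?thesis by (simp only:) (rule sum.union_disjoint, auto)
      qed
      have "(\<Sum>i\<in>{N<..n}. T i x) = (\<Sum>k<n - N. T (Suc (N + k)) x)" by (rule sum_greaterThanAtMost_shift)
      also have "\<dots> \<le> (\<Sum>k<n - N. C3 * J x 1 * \<rho> ^ N * \<rho> ^ k)"
      proof (rule sum_mono)
        fix k
        show "T (Suc (N + k)) x \<le> C3 * J x 1 * \<rho> ^ N * \<rho> ^ k"
          using CD3[OF elim(5), of 1 "N + k"] by (simp add: power_add mult.assoc)
      qed
      also have "\<dots> = C3 * J x 1 * \<rho> ^ N * (\<Sum>k<n - N. \<rho> ^ k)" by (rule sum_distrib_left[symmetric])
      also have "\<dots> \<le> C3 * J x 1 * \<rho> ^ N * (1 / (1 - \<rho>))"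
        using C3 rho by (intro mult_left_mono sum_geometric_le mult_nonneg_nonneg) auto
      also have "\<dots> = C3 / (1 - \<rho>) * \<rho> ^ N * J x 1" by simp
      also have "\<dots> \<le> e' * ?s" by (rule small) (rule A)
      finally have "(1 - e') * ?s \<le> (\<Sum>i=1..min n N. T i x)"
        using split by (simp add: algebra_simps)
      then have "(1 - e') * ((1 - e') * ?s) \<le> (1 - e') * (\<Sum>i=1..min n N. T i x)"
        using e' by (intro mult_left_mono) auto
      also have "\<dots> \<le> ruin_prob M Xs Ys x (enat n)" using elim(2) by blast
      finally have 3: "(1 - e') * ((1 - e') * ?s) \<le> ruin_prob M Xs Ys x (enat n)" .
      have s0: "0 \<le> ?s" by (intro sum_nonneg) simp
      have "(1 - e') * ((1 - e') * ?s) = ?s - 2 * e' * ?s + e' * e' * ?s" by (simp add: algebra_simps)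
      moreover have "0 \<le> e' * e' * ?s" using s0 e' by simp
      ultimately have "?s - 2 * e' * ?s \<le> ruin_prob M Xs Ys x (enat n)" using 3 by linarith
      moreover have "ruin_prob M Xs Ys x (enat n) \<le> ?s + 2 * e' * ?s" using 2 by (simp add: algebra_simps)
      moreover have "2 * e' * ?s \<le> e * ?s" using e' s0 by (intro mult_right_mono) auto
      ultimately show "\<bar>ruin_prob M Xs Ys x (enat n) - ?s\<bar> \<le> e * ?s"
        unfolding abs_le_iff by linarith
    qed
  qed
qed

lemma T_summable:
  assumes "\<rho> < 1"
  shows "\<forall>\<^sub>F x in at_top. summable (\<lambda>i. T (Suc i) x)"
proof -
  obtain C D where "0 < C" "0 < D"
    and CD: "\<And>x a n. D \<le> x \<Longrightarrow> 0 < a \<Longrightarrow> a \<le> 1 \<Longrightarrow> T (Suc n) (a * x) \<le> C * J x 1 * a powr (- p) * \<rho> ^ n"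
    using T_scaled_le by blast
  show ?thesis
    using eventually_ge_at_top[of D]
  proof eventually_elim
    case (elim x)
    have "summable (\<lambda>i. C * J x 1 * \<rho> ^ i)"
      using assms by (intro summable_mult summable_geometric) simp
    then show ?case
      by (rule summable_comparison_test') (use CD[OF elim, of 1] in auto)
  qed
qed

lemma ruin_prob_tendsto:
  "(\<lambda>n. ruin_prob M Xs Ys x (enat n)) \<longlonglongrightarrow> ruin_prob M Xs Ys x \<infinity>"
proof -
  let ?A = "\<lambda>n. {\<omega> \<in> space M. ereal x < max_disc_sum Xs Ys (enat n) \<omega>}"
  have "(\<lambda>n. prob (?A n)) \<longlonglongrightarrow> prob (\<Union>n. ?A n)"
  proof (rule finite_Lim_measure_incseq)
    show "incseq ?A" unfolding ruin_event incseq_def by (auto intro: order_trans)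
  qed auto
  also have "(\<Union>n. ?A n) = {\<omega> \<in> space M. ereal x < max_disc_sum Xs Ys \<infinity> \<omega>}"
    unfolding ruin_event by auto
  finally show ?thesis by (simp add: ruin_prob_def)
qed

text \<open>The relative error bound is uniform in \<open>n\<close>, hence passes to the limit.\<close>

theorem ruin_prob_infinite_horizon:
  assumes "\<rho> < 1" "0 < e"
  shows "\<forall>\<^sub>F x in at_top. \<bar>ruin_prob M Xs Ys x \<infinity> - (\<Sum>i. T (Suc i) x)\<bar> \<le> e * (\<Sum>i. T (Suc i) x)"
  using ruin_prob_uniform[OF assms] T_summable[OF assms(1)]
proof eventually_elim
  case (elim x)
  have lim: "(\<lambda>n. \<Sum>i=1..n. T i x) \<longlonglongrightarrow> (\<Sum>i. T (Suc i) x)"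
    using summable_LIMSEQ[OF elim(2)] by (simp add: sum.atLeast1_atMost_eq)
  have "(\<lambda>n. \<bar>ruin_prob M Xs Ys x (enat n) - (\<Sum>i=1..n. T i x)\<bar>) \<longlonglongrightarrow> \<bar>ruin_prob M Xs Ys x \<infinity> - (\<Sum>i. T (Suc i) x)\<bar>"
    by (intro tendsto_rabs tendsto_diff ruin_prob_tendsto lim)
  moreover have "(\<lambda>n. e * (\<Sum>i=1..n. T i x)) \<longlonglongrightarrow> e * (\<Sum>i. T (Suc i) x)"
    by (intro tendsto_mult tendsto_const lim)
  ultimately show ?case
    by (rule LIMSEQ_le) (use elim(1) in blast)
qed

end

section \<open>Asymptotics of the ruin probability\<close>

lemma abs_ratio_minus_one:
  fixes a b :: real
  assumes "0 < b"
  shows "\<bar>a / b - 1\<bar> = \<bar>a - b\<bar> / b"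
proof -
  have "a / b - 1 = (a - b) / b" using assms by (simp add: diff_divide_distrib)
  then show ?thesis using assms by (simp add: abs_divide)
qed

lemma asymp_equiv_if_relative_error:
  fixes f g :: "real \<Rightarrow> real"
  assumes err: "\<And>e. 0 < e \<Longrightarrow> \<forall>\<^sub>F x in F. \<bar>f x - g x\<bar> \<le> e * g x"
    and pos: "\<forall>\<^sub>F x in F. 0 < g x"
  shows "f \<sim>[F] g"
proof (rule asymp_equivI'[OF tendstoI])
  fix e :: real assume "0 < e"
  then have "\<forall>\<^sub>F x in F. \<bar>f x - g x\<bar> \<le> e / 2 * g x" by (intro err) simp
  then show "\<forall>\<^sub>F x in F. dist (f x / g x) 1 < e"
    using pos
  proof eventually_elim
    case (elim x)
    then have "\<bar>f x - g x\<bar> / g x \<le> e / 2" by (simp only: pos_divide_le_eq)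
    moreover have "dist (f x / g x) 1 = \<bar>f x - g x\<bar> / g x"
      using elim by (simp add: dist_real_def abs_ratio_minus_one)
    ultimately show ?case using \<open>0 < e\<close> by linarith
  qed
qed

lemma SUP_ratio_tendsto_0:
  fixes f g :: "nat \<Rightarrow> real \<Rightarrow> real"
  assumes err: "\<And>e. 0 < e \<Longrightarrow> \<forall>\<^sub>F x in F. \<forall>n\<ge>1. \<bar>f n x - g n x\<bar> \<le> e * g n x"
    and pos: "\<forall>\<^sub>F x in F. \<forall>n\<ge>1. 0 < g n x"
  shows "((\<lambda>x. SUP n\<in>{1..}. ereal \<bar>f n x / g n x - 1\<bar>) \<longlongrightarrow> 0) F"
proof (rule order_tendstoI)
  fix a :: ereal assume "a < 0"
  have "0 \<le> (SUP n\<in>{1..}. ereal \<bar>f n x / g n x - 1\<bar>)" for x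
    by (rule SUP_upper2[of 1]) auto
  then show "\<forall>\<^sub>F x in F. a < (SUP n\<in>{1..}. ereal \<bar>f n x / g n x - 1\<bar>)"
    using \<open>a < 0\<close> by (intro always_eventually) (auto intro: less_le_trans)
next
  fix a :: ereal assume "0 < a"
  then obtain e where e: "0 < e" "ereal e < a"
    using ereal_dense2[of 0 a] by (auto simp: zero_ereal_def)
  show "\<forall>\<^sub>F x in F. (SUP n\<in>{1..}. ereal \<bar>f n x / g n x - 1\<bar>) < a"
    using err[OF e(1)] pos
  proof eventually_elim
    case (elim x)
    have "(SUP n\<in>{1..}. ereal \<bar>f n x / g n x - 1\<bar>) \<le> ereal e"
    proof (rule SUP_least)
      fix n :: nat assume "n \<in> {1..}"
      then have *: "\<bar>f n x - g n x\<bar> \<le> e * g n x" "0 < g n x" using elim by auto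
      then have "\<bar>f n x - g n x\<bar> / g n x \<le> e" by (simp only: pos_divide_le_eq)
      moreover have "\<bar>f n x / g n x - 1\<bar> = \<bar>f n x - g n x\<bar> / g n x"
        using * by (simp add: abs_ratio_minus_one)
      ultimately show "ereal \<bar>f n x / g n x - 1\<bar> \<le> ereal e" by simp
    qed
    then show ?case using e by simp
  qed
qed

lemma (in prob_space) tail_cdf_eq:
  assumes [measurable]: "Z \<in> borel_measurable M"
  shows "tail (cdf (distr M borel Z)) x = prob {\<omega> \<in> space M. x < Z \<omega>}"
proof -
  have "cdf (distr M borel Z) x = prob {\<omega> \<in> space M. Z \<omega> \<le> x}"
    by (simp add: cdf_def measure_distr vimage_def Int_def conj_commute)
  moreover have "prob {\<omega> \<in> space M. x < Z \<omega>} = prob (space M - {\<omega> \<in> space M. Z \<omega> \<le> x})"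
    by (intro arg_cong[where f=prob]) auto
  ultimately show ?thesis by (simp add: tail_def prob_compl)
qed

lemma powr_le_one_plus:
  fixes y :: real
  assumes "0 \<le> y" "0 \<le> s" "s \<le> t"
  shows "y powr s \<le> 1 + y powr t"
proof (cases "y \<le> 1")
  case True
  then have "y powr s \<le> 1" using assms by (intro powr_le1) auto
  then show ?thesis by (simp add: add_increasing2)
next
  case False
  then have "y powr s \<le> y powr t" using assms by (intro powr_mono) auto
  then show ?thesis by simp
qed

lemma (in prob_space) growth_integrable_between:
  assumes [measurable]: "Y \<in> borel_measurable M" and nonneg: "AE \<omega> in M. 0 \<le> Y \<omega>"
    and "0 \<le> q" "q \<le> r" "0 \<le> p" "p \<le> r" and int: "integrable M (\<lambda>\<omega>. Y \<omega> powr r)"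
  shows "integrable M (\<lambda>\<omega>. growth p q (Y \<omega>))" "AE \<omega> in M. norm (growth p q (Y \<omega>)) \<le> 1 + Y \<omega> powr r"
proof -
  show bd: "AE \<omega> in M. norm (growth p q (Y \<omega>)) \<le> 1 + Y \<omega> powr r"
    using nonneg
  proof eventually_elim
    case (elim \<omega>)
    then have "Y \<omega> powr p \<le> 1 + Y \<omega> powr r" "Y \<omega> powr q \<le> 1 + Y \<omega> powr r"
      using assms(3-6) by (auto intro!: powr_le_one_plus)
    then show ?case by (simp add: growth_def le_max_iff_disj)
  qed
  show "integrable M (\<lambda>\<omega>. growth p q (Y \<omega>))"
  proof (rule Bochner_Integration.integrable_bound)
    show "integrable M (\<lambda>\<omega>. 1 + Y \<omega> powr r)" using int by simp
    show "AE \<omega> in M. norm (growth p q (Y \<omega>)) \<le> norm (1 + Y \<omega> powr r)"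
      using bd by eventually_elim auto
  qed simp
qed

text \<open>Here \<open>b\<close> and \<open>a\<close> are the lower and the upper index. The exponents of the contraction hypothesis satisfy
  only \<open>\<beta> \<le> b\<close> and \<open>a \<le> \<alpha>\<close>, but the expectation is continuous in them as long as \<open>Y\<close> has a moment beyond
  \<open>a\<close>, so strict inequalities can be had at the price of a slightly larger expectation.\<close>

lemma (in prob_space) contracting_exponents_open:
  assumes [measurable]: "Y \<in> borel_measurable M" and nonneg: "AE \<omega> in M. 0 \<le> Y \<omega>"
    and "0 \<le> a" "a \<le> \<alpha>" "0 \<le> \<beta>" "\<beta> \<le> b" "0 < b" "0 < \<epsilon>"
    and int: "integrable M (\<lambda>\<omega>. Y \<omega> powr max \<alpha> (a + \<epsilon>))"
    and less: "(\<integral>\<omega>. growth \<alpha> \<beta> (Y \<omega>) \<partial>M) < 1" and "b \<le> a"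
  shows "\<exists>p q. a < p \<and> 0 \<le> q \<and> q < b \<and> integrable M (\<lambda>\<omega>. growth p q (Y \<omega>)) \<and> (\<integral>\<omega>. growth p q (Y \<omega>) \<partial>M) < 1"
proof -
  \<comment> \<open>\<open>P k > a\<close> tends to \<open>\<alpha>\<close>, even if \<open>\<alpha> = a\<close>; \<open>Q k < b\<close> tends to \<open>\<beta>\<close>, even if \<open>\<beta> = b\<close>\<close>
  define P where "P k = max \<alpha> (a + \<epsilon> / real (Suc k))" for k
  define Q where "Q k = max 0 (min \<beta> (b - 1 / real (Suc k)))" for k
  have PQ: "a < P k" "0 \<le> Q k" "Q k < b" "P k \<le> max \<alpha> (a + \<epsilon>)" for k
  proof -
    have "0 < \<epsilon> / real (Suc k)" using \<open>0 < \<epsilon>\<close> by simp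
    moreover have "\<epsilon> / real (Suc k) \<le> \<epsilon> / 1"
      using \<open>0 < \<epsilon>\<close> by (intro divide_left_mono) auto
    ultimately show "a < P k" "P k \<le> max \<alpha> (a + \<epsilon>)" by (auto simp: P_def less_max_iff_disj)
    have "b - 1 / real (Suc k) < b" by simp
    then have "min \<beta> (b - 1 / real (Suc k)) < b" by (rule min.strict_coboundedI2)
    then show "0 \<le> Q k" "Q k < b" using \<open>0 < b\<close> unfolding Q_def by auto
  qed
  have inv: "(\<lambda>k. c / real (Suc k)) \<longlonglongrightarrow> 0" for c
    using LIMSEQ_Suc[OF lim_const_over_n[of c]] by simp
  have "P \<longlonglongrightarrow> max \<alpha> (a + 0)" unfolding P_def by (intro tendsto_intros inv)
  then have P: "P \<longlonglongrightarrow> \<alpha>" using \<open>a \<le> \<alpha>\<close> by simp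
  have "Q \<longlonglongrightarrow> max 0 (min \<beta> (b - 0))" unfolding Q_def by (intro tendsto_intros inv)
  then have Q: "Q \<longlonglongrightarrow> \<beta>" using \<open>\<beta> \<le> b\<close> \<open>0 \<le> \<beta>\<close> by simp
  let ?r = "max \<alpha> (a + \<epsilon>)"
  have le: "Q k \<le> ?r" "0 \<le> P k" for k
    using PQ[of k] \<open>b \<le> a\<close> \<open>a \<le> \<alpha>\<close> \<open>0 \<le> a\<close> by (auto simp: le_max_iff_disj)
  note between = growth_integrable_between[OF assms(1) nonneg PQ(2) le(1) le(2) PQ(4) int]
  have "(\<lambda>k. \<integral>\<omega>. growth (P k) (Q k) (Y \<omega>) \<partial>M) \<longlonglongrightarrow> (\<integral>\<omega>. growth \<alpha> \<beta> (Y \<omega>) \<partial>M)"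
  proof (rule integral_dominated_convergence[where w="\<lambda>\<omega>. 1 + Y \<omega> powr ?r"])
    show "AE \<omega> in M. (\<lambda>k. growth (P k) (Q k) (Y \<omega>)) \<longlonglongrightarrow> growth \<alpha> \<beta> (Y \<omega>)"
    proof (rule AE_I2)
      fix \<omega>
      show "(\<lambda>k. growth (P k) (Q k) (Y \<omega>)) \<longlonglongrightarrow> growth \<alpha> \<beta> (Y \<omega>)"
      \<comment> \<open>\<open>y powr s\<close> is continuous in \<open>s\<close> for every \<open>y\<close>, with the constant value 0 for \<open>y = 0\<close>\<close>
      proof (cases "Y \<omega> = 0")
        case False
        then show ?thesis unfolding growth_def by (intro tendsto_max tendsto_powr tendsto_const P Q)
      qed simp
    qed
  qed (use int between(2) in auto)
  then have "\<forall>\<^sub>F k in sequentially. (\<integral>\<omega>. growth (P k) (Q k) (Y \<omega>) \<partial>M) < 1"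
    using less by (rule order_tendstoD)
  then obtain k where "(\<integral>\<omega>. growth (P k) (Q k) (Y \<omega>) \<partial>M) < 1"
    using eventually_happens[of _ sequentially] by auto
  then show ?thesis using PQ[of k] between(1)[of k] by blast
qed

lemma lower_matuszewska_pos:
  assumes "class_PD F" "mono F" and pos: "\<And>x. 0 \<le> x \<Longrightarrow> 0 < tail F x"
  shows "0 < lower_matuszewska F"
proof -
  let ?L = "tail_ratio_limsup F 2"
  have bounds: "\<forall>\<^sub>F x in at_top. 0 \<le> tail F (2 * x) / tail F x \<and> tail F (2 * x) / tail F x \<le> 1"
    using tail_ratio_bounds[OF assms(2), of 2] pos by simp
  have "0 \<le> Liminf at_top (\<lambda>x. ereal (tail F (2 * x) / tail F x))"
    by (rule Liminf_bounded) (use bounds in \<open>eventually_elim, simp add: zero_ereal_def\<close>)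
  moreover have "Liminf at_top (\<lambda>x. ereal (tail F (2 * x) / tail F x)) \<le> ?L"
    unfolding tail_ratio_limsup_def by (rule Liminf_le_Limsup) simp
  moreover have "?L < 1" using assms(1) by (simp add: class_PD_def)
  ultimately have "0 \<le> ?L" "?L < 1" by auto
  then obtain r where r: "?L = ereal r" "0 \<le> r" "r < 1" by (cases ?L) auto
  have ln2: "0 < ln (2 :: real)" by simp
  have "0 < neg_ln ?L / ereal (ln 2)"
  proof (cases "r = 0")
    case True
    then show ?thesis using r ln2 by (simp add: neg_ln_def zero_ereal_def)
  next
    case False
    then have "0 < - ln r / ln 2" using r ln2 by (intro divide_pos_pos) auto
    then show ?thesis using r False ln2 by (simp add: neg_ln_def)
  qed
  also have "\<dots> \<le> lower_matuszewska F"
    unfolding lower_matuszewska_def by (rule SUP_upper) simp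
  finally show ?thesis .
qed

theorem corollary4p1:
  fixes M :: "'a measure"
    and X Y :: "'a \<Rightarrow> real"
    and Xs Ys :: "nat \<Rightarrow> 'a \<Rightarrow> real"
    and F G H :: "real \<Rightarrow> real"
    and K :: "real \<Rightarrow> real measure"
  assumes "prob_space M"
    and "X \<in> borel_measurable M" and "Y \<in> borel_measurable M"
    and indep: "prob_space.indep_vars M (\<lambda>_. borel \<Otimes>\<^sub>M borel) (\<lambda>i \<omega>. (Xs i \<omega>, Ys i \<omega>)) {1..}"
    and copies: "\<And>i. 1 \<le> i \<Longrightarrow>
        distr M (borel \<Otimes>\<^sub>M borel) (\<lambda>\<omega>. (Xs i \<omega>, Ys i \<omega>)) = distr M (borel \<Otimes>\<^sub>M borel) (\<lambda>\<omega>. (X \<omega>, Y \<omega>))"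
    and F_def: "F = cdf (distr M borel X)"
    and G_def: "G = cdf (distr M borel Y)"
    and H_def: "H = cdf (distr M borel (\<lambda>\<omega>. X \<omega> * Y \<omega>))"
    and F_tail_pos: "\<And>x. 0 \<le> x \<Longrightarrow> 0 < tail F x"
    and F_C: "consistently_varying F"
    and G_0: "(G \<longlongrightarrow> 0) (at_left 0)" "G 0 < 1"
    and A: "\<And>c. 0 < c \<Longrightarrow> (\<lambda>x. tail G (c * x)) \<in> o[at_top](tail H)"
    and K: "regular_cond_distr M X Y K"
    and B: "\<exists>h :: real \<Rightarrow> real. (\<forall>y\<ge>0. 0 < h y) \<and>
        ((\<lambda>x. SUP y\<in>distr_support (distr M borel Y).
            ereal \<bar>measure (K y) {x<..} / (h y * measure M {\<omega> \<in> space M. x < X \<omega>}) - 1\<bar>)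
          \<longlongrightarrow> 0) at_top"
    and moment: "\<exists>\<epsilon>>0. (\<integral>\<^sup>+\<omega>. ennreal (Y \<omega> powr (real_of_ereal (upper_matuszewska F) + \<epsilon>)) \<partial>M) < \<infinity>"
  shows "(\<forall>n\<ge>1. (\<lambda>x. ruin_prob M Xs Ys x (enat n)) \<sim>[at_top]
                  (\<lambda>x. \<Sum>i=1..n. disc_loss_tail M Xs Ys i x)) \<and>
         (class_PD F \<and>
          (\<exists>\<alpha> \<beta> :: real. 0 \<le> \<beta> \<and> ereal \<beta> \<le> lower_matuszewska F \<and>
             lower_matuszewska F \<le> upper_matuszewska F \<and> upper_matuszewska F \<le> ereal \<alpha> \<and>
             (\<integral>\<^sup>+\<omega>. ennreal (max (Y \<omega> powr \<alpha>) (Y \<omega> powr \<beta>)) \<partial>M) < 1)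
          \<longrightarrow>
          ((\<lambda>x. SUP n\<in>{1::nat..}.
              ereal \<bar>ruin_prob M Xs Ys x (enat n) / (\<Sum>i=1..n. disc_loss_tail M Xs Ys i x) - 1\<bar>)
            \<longlongrightarrow> 0) at_top \<and>
          (\<forall>\<^sub>F x in at_top. summable (\<lambda>i. disc_loss_tail M Xs Ys (Suc i) x)) \<and>
          (\<lambda>x. ruin_prob M Xs Ys x \<infinity>) \<sim>[at_top] (\<lambda>x. \<Sum>i. disc_loss_tail M Xs Ys (Suc i) x))"
proof -
  interpret prob_space M by fact
  note [measurable] = assms(2,3)
  have tail_F: "tail F x = prob {\<omega> \<in> space M. x < X \<omega>}" for x
    unfolding F_def by (rule tail_cdf_eq) simp
  have tail_G: "tail G x = prob {\<omega> \<in> space M. x < Y \<omega>}" for x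
    unfolding G_def by (rule tail_cdf_eq) simp
  have tail_H: "tail H x = product_tail M X Y x 1" for x
    unfolding H_def product_tail_def by (subst tail_cdf_eq) simp_all
  have F_mono: "mono F"
  proof -
    interpret D: prob_space "distr M borel X" by (rule prob_space_distr) simp
    show ?thesis unfolding F_def
      by (intro monoI finite_borel_measure.cdf_nondecreasing finite_borel_measure.intro
          finite_borel_measure_axioms.intro D.finite_measure) auto
  qed
  have F_anti: "antimono (tail F)"
    using F_mono by (intro antimonoI) (simp add: tail_def monoD)
  have Y_nonneg: "AE \<omega> in M. 0 \<le> Y \<omega>"
  proof -
    interpret D: real_distribution "distr M borel Y" by (rule real_distribution_distr) simp
    have "measure (distr M borel Y) {..<0} = 0"
      using D.cdf_at_left[of 0] G_0(1) unfolding G_def by (rule tendsto_unique[rotated]) simp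
    then have "prob {\<omega> \<in> space M. Y \<omega> < 0} = 0"
      by (simp add: measure_distr vimage_def Int_def conj_commute)
    then show ?thesis by (subst (asm) prob_eq_0) (auto elim!: AE_mp)
  qed
  have Y_pos: "0 < prob {\<omega> \<in> space M. 0 < Y \<omega>}"
    using G_0(2) unfolding tail_G[symmetric] by (simp add: tail_def)
  obtain h where h_pos: "\<And>y. 0 \<le> y \<Longrightarrow> 0 < h y" and h_lim: "((\<lambda>x. SUP y\<in>distr_support (distr M borel Y).
            ereal \<bar>measure (K y) {x<..} / (h y * measure M {\<omega> \<in> space M. x < X \<omega>}) - 1\<bar>)
          \<longlongrightarrow> 0) at_top"
    using B by blast
  interpret conditional_tail_model M X Y K h "tail F"
  proof
    fix e :: real assume "0 < e"
    then have "\<forall>\<^sub>F x in at_top. (SUP y\<in>distr_support (distr M borel Y).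
        ereal \<bar>measure (K y) {x<..} / (h y * tail F x) - 1\<bar>) < ereal e"
      using order_tendstoD(2)[OF h_lim, of "ereal e"] by (simp add: tail_F)
    then show "\<forall>\<^sub>F x in at_top. \<forall>y\<in>distr_support (distr M borel Y).
        \<bar>measure (K y) {x<..} / (h y * tail F x) - 1\<bar> \<le> e"
    proof eventually_elim
      case (elim x)
      show ?case
      proof
        fix y assume "y \<in> distr_support (distr M borel Y)"
        then have "ereal \<bar>measure (K y) {x<..} / (h y * tail F x) - 1\<bar> \<le> (SUP y\<in>distr_support (distr M borel Y).
            ereal \<bar>measure (K y) {x<..} / (h y * tail F x) - 1\<bar>)"
          by (rule SUP_upper)
        with elim have "ereal \<bar>measure (K y) {x<..} / (h y * tail F x) - 1\<bar> < ereal e"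
          by (rule le_less_trans[rotated])
        then show "\<bar>measure (K y) {x<..} / (h y * tail F x) - 1\<bar> \<le> e" by simp
      qed
    qed
  qed (use assms Y_nonneg Y_pos tail_F F_tail_pos h_pos in auto)

  obtain a where a: "upper_matuszewska F = ereal a" "0 \<le> a"
    using upper_matuszewska_less_top[OF F_C F_tail_pos] upper_matuszewska_nonneg[OF F_mono F_tail_pos]
    by (cases "upper_matuszewska F") auto
  have cons: "\<exists>v>1. \<forall>\<^sub>F x in at_top. tail F x \<le> (1 + e) * tail F (v * x)" if "0 < e" for e
    by (rule consistently_varyingD[OF F_C F_tail_pos that])
  have negl: "(\<lambda>x. prob {\<omega> \<in> space M. c * x < Y \<omega>}) \<in> o(\<lambda>x. product_tail M X Y x 1)" if "0 < c" for c
    using A[OF that] unfolding tail_G ext[of "tail H", OF tail_H] .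

  have model: "discounted_losses M X Y Xs Ys p q"
    if p: "a < p" and q: "0 \<le> q" "q \<le> p"
      and lo: "\<exists>v>1. \<forall>\<^sub>F x in at_top. tail F (v * x) \<le> v powr (- q) * tail F x"
      and int: "integrable M (\<lambda>\<omega>. growth p q (Y \<omega>))" for p q
  proof -
    have up: "\<exists>v>1. \<forall>\<^sub>F x in at_top. v powr (- p) * tail F x \<le> tail F (v * x)"
      using p by (intro upper_matuszewska_lessD[OF F_mono F_tail_pos]) (simp_all add: a)
    have pot: "\<exists>C>0. \<exists>D>0. \<forall>x\<ge>D. \<forall>t>0. tail F (x / t) \<le> C * tail F x * growth p q t"
      using p q a by (intro potter_bound[OF F_anti F_tail_pos _ _ up lo]) auto
    obtain c where c: "0 < c" "\<forall>\<^sub>F x in at_top. c * tail F x \<le> product_tail M X Y x 1"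
      using product_tail_ge[OF pot] by blast
    then obtain D0 where D0: "\<And>x. D0 \<le> x \<Longrightarrow> c * tail F x \<le> product_tail M X Y x 1"
      unfolding eventually_at_top_linorder by blast
    obtain C D where C: "0 < C" "0 < D"
      and CD: "\<And>x t. D \<le> x \<Longrightarrow> 0 \<le> t \<Longrightarrow> product_tail M X Y x t \<le> C * tail F x * growth p q t"
      using product_tail_le_growth[OF pot int] by blast
    show ?thesis
    proof
      show "0 < product_tail M X Y x 1" if "0 \<le> x" for x
      proof -
        have "0 < c * tail F (max x D0)" using that c F_tail_pos by simp
        also have "\<dots> \<le> product_tail M X Y (max x D0) 1" by (rule D0) simp
        also have "\<dots> \<le> product_tail M X Y x 1"
          unfolding product_tail_def by (intro finite_measure_mono) auto
        finally show ?thesis .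
      qed
      have "product_tail M X Y x t \<le> C / c * product_tail M X Y x 1 * growth p q t"
        if x: "max D D0 \<le> x" and t: "0 \<le> t" for x t
      proof -
        have "product_tail M X Y x t \<le> C * tail F x * growth p q t" using x t by (intro CD) auto
        also have "\<dots> = C / c * (c * tail F x) * growth p q t" using c by simp
        also have "\<dots> \<le> C / c * product_tail M X Y x 1 * growth p q t"
          using x c C D0 by (intro mult_right_mono mult_left_mono) auto
        finally show ?thesis .
      qed
      moreover have "0 < C / c" "0 < max D D0" using C c by auto
      ultimately show "\<exists>C>0. \<exists>D>0. \<forall>x\<ge>D. \<forall>t\<ge>0.
          product_tail M X Y x t \<le> C * product_tail M X Y x 1 * growth p q t"
        by blast
      show "\<exists>v>1. \<forall>\<^sub>F x in at_top. product_tail M X Y x 1 \<le> (1 + e) * product_tail M X Y (v * x) 1"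
        if "0 < e" for e
        by (rule product_tail_consistently_varying[OF cons negl that])
    qed (use assms Y_nonneg p q a int in auto)
  qed

  obtain \<epsilon> where \<epsilon>: "0 < \<epsilon>" "(\<integral>\<^sup>+\<omega>. ennreal (Y \<omega> powr (a + \<epsilon>)) \<partial>M) < \<infinity>"
    using moment unfolding a(1) by auto
  have moment_int: "integrable M (\<lambda>\<omega>. Y \<omega> powr (a + \<epsilon>))"
    using \<epsilon>(2) by (intro integrableI_nonneg) auto
  \<comment> \<open>the trivial lower exponent 0 serves a fixed finite horizon\<close>
  have lo0: "\<exists>v>1. \<forall>\<^sub>F x in at_top. tail F (v * x) \<le> v powr (- 0) * tail F x"
  proof (intro exI[of _ 2] conjI)
    show "\<forall>\<^sub>F x in at_top. tail F (2 * x) \<le> 2 powr (- 0) * tail F x"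
      using eventually_ge_at_top[of 0]
      by eventually_elim (auto intro!: antimonoD[OF F_anti])
  qed simp
  have sum_pos: "0 < (\<Sum>i=1..n. disc_loss_tail M Xs Ys i x)"
    if "discounted_losses M X Y Xs Ys p q" "1 \<le> n" "0 \<le> x" for p q n x
  proof -
    interpret L: discounted_losses M X Y Xs Ys p q by fact
    have "0 < disc_loss_tail M Xs Ys 1 x" unfolding L.T_one by (rule L.tail_pos) fact
    also have "\<dots> \<le> (\<Sum>i=1..n. disc_loss_tail M Xs Ys i x)"
      using \<open>1 \<le> n\<close> by (intro member_le_sum) auto
    finally show ?thesis .
  qed

  have finite_horizon: "(\<lambda>x. ruin_prob M Xs Ys x (enat n)) \<sim>[at_top] (\<lambda>x. \<Sum>i=1..n. disc_loss_tail M Xs Ys i x)"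
    if n: "1 \<le> n" for n
  proof -
    have "integrable M (\<lambda>\<omega>. growth (a + \<epsilon>) 0 (Y \<omega>))"
      using \<epsilon>(1) a(2) by (intro growth_integrable_between[OF _ Y_nonneg _ _ _ _ moment_int]) auto
    then have m: "discounted_losses M X Y Xs Ys (a + \<epsilon>) 0"
      using \<epsilon>(1) a(2) lo0 by (intro model) auto
    interpret L: discounted_losses M X Y Xs Ys "a + \<epsilon>" 0 by (rule m)
    show ?thesis
    proof (rule asymp_equiv_if_relative_error)
      show "\<forall>\<^sub>F x in at_top. 0 < (\<Sum>i=1..n. disc_loss_tail M Xs Ys i x)"
        using eventually_ge_at_top[of 0] by eventually_elim (rule sum_pos[OF m n])
    qed (rule L.ruin_prob_finite_horizon[OF _ n])
  qed

  have infinite_horizon: "((\<lambda>x. SUP n\<in>{1::nat..}.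
              ereal \<bar>ruin_prob M Xs Ys x (enat n) / (\<Sum>i=1..n. disc_loss_tail M Xs Ys i x) - 1\<bar>)
            \<longlongrightarrow> 0) at_top \<and>
          (\<forall>\<^sub>F x in at_top. summable (\<lambda>i. disc_loss_tail M Xs Ys (Suc i) x)) \<and>
          (\<lambda>x. ruin_prob M Xs Ys x \<infinity>) \<sim>[at_top] (\<lambda>x. \<Sum>i. disc_loss_tail M Xs Ys (Suc i) x)"
    if PD: "class_PD F" and \<beta>: "0 \<le> \<beta>" "ereal \<beta> \<le> lower_matuszewska F"
      and lu: "lower_matuszewska F \<le> upper_matuszewska F" and \<alpha>: "upper_matuszewska F \<le> ereal \<alpha>"
      and contr: "(\<integral>\<^sup>+\<omega>. ennreal (max (Y \<omega> powr \<alpha>) (Y \<omega> powr \<beta>)) \<partial>M) < 1" for \<alpha> \<beta>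
  proof -
    have "0 < lower_matuszewska F" by (rule lower_matuszewska_pos[OF PD F_mono F_tail_pos])
    then obtain b where b: "lower_matuszewska F = ereal b" "0 < b"
      using lu a by (cases "lower_matuszewska F") auto
    have ord: "\<beta> \<le> b" "b \<le> a" "a \<le> \<alpha>" using \<beta> lu \<alpha> a b by auto
    have contr_int: "integrable M (\<lambda>\<omega>. growth \<alpha> \<beta> (Y \<omega>))"
      using order.strict_trans[OF contr ennreal_one_less_top]
      by (intro integrableI_nonneg) (auto simp: growth_def le_max_iff_disj)
    have "ennreal (\<integral>\<omega>. growth \<alpha> \<beta> (Y \<omega>) \<partial>M) < 1"
      using contr nn_integral_eq_integral[OF contr_int AE_I2[OF growth_nonneg]] by (simp add: growth_def)
    then have contr': "(\<integral>\<omega>. growth \<alpha> \<beta> (Y \<omega>) \<partial>M) < 1"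
      by (simp add: ennreal_less_one_iff)
    have "integrable M (\<lambda>\<omega>. Y \<omega> powr \<alpha>)"
      by (rule Bochner_Integration.integrable_bound[OF contr_int]) (auto simp: growth_def le_max_iff_disj)
    then have int_max: "integrable M (\<lambda>\<omega>. Y \<omega> powr max \<alpha> (a + \<epsilon>))"
      using moment_int by (simp add: max_def)
    obtain p q where p: "a < p" and q: "0 \<le> q" "q < b" and int: "integrable M (\<lambda>\<omega>. growth p q (Y \<omega>))"
      and rho: "(\<integral>\<omega>. growth p q (Y \<omega>) \<partial>M) < 1"
      using contracting_exponents_open[OF assms(3) Y_nonneg a(2) ord(3) \<beta>(1) ord(1) b(2) \<epsilon>(1) int_max contr' ord(2)]
      by blast
    have m: "discounted_losses M X Y Xs Ys p q"
      using p q ord int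
      by (intro model lower_matuszewska_greaterD[OF F_mono F_tail_pos]) (auto simp: b)
    interpret L: discounted_losses M X Y Xs Ys p q by (rule m)
    have rho': "L.\<rho> < 1" using rho by (simp add: L.\<rho>_def)
    show ?thesis
    proof (intro conjI)
      show "((\<lambda>x. SUP n\<in>{1::nat..}.
              ereal \<bar>ruin_prob M Xs Ys x (enat n) / (\<Sum>i=1..n. disc_loss_tail M Xs Ys i x) - 1\<bar>)
            \<longlongrightarrow> 0) at_top"
      proof (rule SUP_ratio_tendsto_0)
        show "\<forall>\<^sub>F x in at_top. \<forall>n\<ge>1. 0 < (\<Sum>i=1..n. disc_loss_tail M Xs Ys i x)"
          using eventually_ge_at_top[of 0] by eventually_elim (use sum_pos[OF m] in blast)
      qed (rule L.ruin_prob_uniform[OF rho'])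
      show "\<forall>\<^sub>F x in at_top. summable (\<lambda>i. disc_loss_tail M Xs Ys (Suc i) x)"
        by (rule L.T_summable[OF rho'])
      show "(\<lambda>x. ruin_prob M Xs Ys x \<infinity>) \<sim>[at_top] (\<lambda>x. \<Sum>i. disc_loss_tail M Xs Ys (Suc i) x)"
      proof (rule asymp_equiv_if_relative_error)
        show "\<forall>\<^sub>F x in at_top. 0 < (\<Sum>i. disc_loss_tail M Xs Ys (Suc i) x)"
          using L.T_summable[OF rho'] eventually_ge_at_top[of 0]
        proof eventually_elim
          case (elim x)
          have "0 < disc_loss_tail M Xs Ys (Suc 0) x"
            using sum_pos[OF m, of 1 x] elim by simp
          then show ?case using elim(1) by (intro suminf_pos2[of _ 0]) auto
        qed
      qed (rule L.ruin_prob_infinite_horizon[OF rho'])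
    qed
  qed
  show ?thesis using finite_horizon infinite_horizon by blast
qed

end
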